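(* Let $\{P_\theta\}_{\theta\in\Theta}$ be a one-dimensional exponential family with densities $p_\theta(x)=\exp(\theta x-A(\theta))$ with respect to a base measure $\mu$, and let $P_0=P_{\theta_0}$ belong to this family. Let $\mathcal{P}_{\mathrm{par}}=\{P_\theta\}_{\theta\in\Theta}$ and $\mathcal{P}_{\mathrm{nonpar}}=\{P:\mathbb{E}_P[X]\in\operatorname{range}(\nabla A),\ \mathbb{E}_P[|X|^4]\le M\}$ with $M<\infty$. Let $L_{\wedge B}(t)=t^2\wedge B$ with $0<B<\infty$. Let $\mathcal{Q}_\varepsilon$ be the collection of $(2,\varepsilon^2)$-Rényi differentially private channels and let $\mathcal{P}_{\mathrm{all},0}\subset\mathcal{P}_{\mathrm{nonpar}}$ be a collection of sub-models with scores $g$ dense in $L^1(P_0)$ at $P_0$. Then there exist numerical constants $0<c_0\le c_1<\infty$ such that for all large enough $n$, $$\mathfrak{M}^{\mathrm{loc}}_n(P_0,L_{\wedge B},\mathcal{P}_{\mathrm{all},0},\mathcal{Q}_\varepsilon)\ \ge\ c_0\cdot\frac{1}{n\varepsilon^2}\operatorname*{ess\,sup}_x\frac{(\mathbb{E}_{P_0}[X]-x)^2}{\operatorname{Var}_0(X)^2}$$ and $$\mathfrak{M}^{\mathrm{loc}}_n(P_0,L_{\wedge B},\mathcal{P}_{\mathrm{par}},\mathcal{Q}_\varepsilon)\ \in\ [c_0,c_1]\cdot\frac{1}{n\varepsilon^2}\cdot\frac{1}{\big(\mathbb{E}_0[|X-\mathbb{E}_0[X]|]\big)^2}.$$ Additionally,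 $\dfrac{1}{(\mathbb{E}_0[|X-\mathbb{E}_0[X]|])^2}\le\operatorname*{ess\,sup}_x\dfrac{(\mathbb{E}_0[X]-x)^2}{\operatorname{Var}_0(X)^2}$.
   Context: The exponential family is regular and minimal: $A''(\theta)=\operatorname{Var}_\theta(X)>0$ on $\operatorname{dom}A$ and $A$ is analytic on the interior of its domain. The parameter of a distribution $P$ is $\theta(P)=\operatorname{argmin}_\theta\mathbb{E}_P[-\log p_\theta(X)]$, i.e. the $\theta$ with $\mathbb{E}_\theta[X]=\mathbb{E}_P[X]$. $\mathbb{E}_0,\operatorname{Var}_0$ are under $P_0$, and the essential supremum is with respect to $P_0$. A sub-model $h\mapsto P_h$, $h\in\mathbb{R}$, has score $g$ at $P_0$ if $\int|dP_h-dP_0-hg\,dP_0|=o(|h|)$ as $h\to0$. A sequentially interactive channel $Q$ produces $Z_1,\dots,Z_n$ via Markov kernels $Z_i\mid X_i=x,Z_{1:i-1}=z_{1:i-1}\sim Q(\cdot\mid x,z_{1:i-1})$; it is $(2,\varepsilon^2)$-Rényi differentially private if $D_2(Q(\cdot\mid x,z_{1:i-1})\|Q(\cdot\mid x',z_{1:i-1}))\le\varepsilon^2$ for all $i,x,x',z_{1:i-1}$, where $D_2(P\|Q)=\log\int(dP/dQ)^2dQ$. The local minimax risk is $$\mathfrak{M}^{\mathrm{loc}}_n(P_0,L,\mathcal{P},\mathcal{Q})=\sup_{P_1\in\mathcal{P}}\ \inf_{\hat\theta,\,Q\in\mathcal{Q}}\ \max_{P\in\{P_0,P_1\}}\mathbb{E}_{Q\circ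 P}\big[L(\hat\theta(Z_1,\dots,Z_n)-\theta(P))\big],$$ with $Q\circ P$ the law of $Z_{1:n}$ when $X_i\overset{iid}\sim P$ and the infimum over all estimators $\hat\theta$; for a collection of sub-models the supremum is over all distributions in the sub-models.
   Formalization: The constants depend on an upper bound for ε (false uniformly in ε). The first inequality is for data in a bounded interval, or for scores with remainder and density weighted by 1+|x|, with any finite v ≤ ess sup in place of the ess sup (false if infinite). Scores are dense among mean-zero ones. *)

theory Defs
  imports "HOL-Probability.Probability" "HOL-Probability.Essential_Supremum"
begin

section \<open>One-dimensional exponential families\<close>

text \<open>The base measure \<open>\<mu>\<close> is a measure on the Borel sets of the real line, and the sufficient
  statistic is the observation itself. The index set \<open>\<Theta>\<close> is the natural parameter space
  \<open>dom A\<close>.\<close>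

definition natural_params :: "real measure \<Rightarrow> real set" where
  "natural_params \<mu> = {\<theta>. integrable \<mu> (\<lambda>x. exp (\<theta> * x))}"

definition log_partition :: "real measure \<Rightarrow> real \<Rightarrow> real" where
  "log_partition \<mu> \<theta> = ln (\<integral>x. exp (\<theta> * x) \<partial>\<mu>)"

definition exp_density :: "real measure \<Rightarrow> real \<Rightarrow> real \<Rightarrow> real" where
  "exp_density \<mu> \<theta> x = exp (\<theta> * x - log_partition \<mu> \<theta>)"

definition exp_member :: "real measure \<Rightarrow> real \<Rightarrow> real measure" where
  "exp_member \<mu> \<theta> = density \<mu> (\<lambda>x. ennreal (exp_density \<mu> \<theta> x))"

definition mean :: "real measure \<Rightarrow> real" where
  "mean P = (\<integral>x. x \<partial>P)"

definition var :: "real measure \<Rightarrow> real" where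
  "var P = (\<integral>x. (x - mean P)\<^sup>2 \<partial>P)"

definition mean_abs_dev :: "real measure \<Rightarrow> real" where
  "mean_abs_dev P = (\<integral>x. \<bar>x - mean P\<bar> \<partial>P)"

text \<open>Regularity is openness of \<open>dom A\<close> and minimality is positivity of the variance.
  Analyticity of \<open>A\<close> and \<open>A'' = Var\<close> are consequences. Sigma-finiteness of \<open>\<mu>\<close> is automatic
  once \<open>dom A\<close> is nonempty, and a positive variance excludes \<open>\<mu> = 0\<close>.\<close>

definition regular_minimal_family :: "real measure \<Rightarrow> bool" where
  "regular_minimal_family \<mu> \<longleftrightarrow>
     sets \<mu> = sets borel \<and> open (natural_params \<mu>) \<and>
     (\<forall>\<theta>\<in>natural_params \<mu>. 0 < var (exp_member \<mu> \<theta>))"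

definition parametric_class :: "real measure \<Rightarrow> real measure set" where
  "parametric_class \<mu> = exp_member \<mu> ` natural_params \<mu>"

definition nonparametric_class :: "real measure \<Rightarrow> real \<Rightarrow> real measure set" where
  "nonparametric_class \<mu> M =
     {P. prob_space P \<and> sets P = sets borel \<and>
         mean P \<in> deriv (log_partition \<mu>) ` natural_params \<mu> \<and>
         (\<integral>\<^sup>+x. ennreal (\<bar>x\<bar> ^ 4) \<partial>P) \<le> ennreal M}"

definition param_of :: "real measure \<Rightarrow> real measure \<Rightarrow> real" where
  "param_of \<mu> P =
     arg_min_on (\<lambda>\<theta>. \<integral>x. - ln (exp_density \<mu> \<theta> x) \<partial>P) (natural_params \<mu>)"

section \<open>Sequentially interactive private channels\<close>

text \<open>Observations and private outputs are indexed from \<open>0\<close>. Outputs are real-valued: every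
  standard Borel output space is Borel isomorphic to a Borel subset of the line. A history
  \<open>z\<close> of length \<open>i\<close> is a point of the product space over \<open>{..<i}\<close>, and \<open>Q i x z\<close> is the law of
  output \<open>i\<close> given observation \<open>x\<close> and history \<open>z\<close>.\<close>

type_synonym channel = "nat \<Rightarrow> real \<Rightarrow> (nat \<Rightarrow> real) \<Rightarrow> real measure"

abbreviation histories :: "nat \<Rightarrow> (nat \<Rightarrow> real) measure" where
  "histories n \<equiv> PiM {..<n} (\<lambda>_. borel)"

definition is_channel :: "nat \<Rightarrow> channel \<Rightarrow> bool" where
  "is_channel n Q \<longleftrightarrow>
     (\<forall>i<n. (\<lambda>(x, z). Q i x z) \<in> borel \<Otimes>\<^sub>M histories i \<rightarrow>\<^sub>M prob_algebra borel)"

definition renyi2 :: "'a measure \<Rightarrow> 'a measure \<Rightarrow> ereal" where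
  "renyi2 P Q =
     (let I = (\<integral>\<^sup>+x. (RN_deriv Q P x)\<^sup>2 \<partial>Q)
      in if absolutely_continuous Q P \<and> I < \<infinity> then ereal (ln (enn2real I)) else \<infinity>)"

definition renyi_private_channels :: "real \<Rightarrow> nat \<Rightarrow> channel set" where
  "renyi_private_channels \<epsilon> n =
     {Q. is_channel n Q \<and>
         (\<forall>i<n. \<forall>x x'. \<forall>z\<in>space (histories i). renyi2 (Q i x z) (Q i x' z) \<le> ereal (\<epsilon>\<^sup>2))}"

text \<open>The law of the first \<open>n\<close> outputs for i.i.d. observations from \<open>P\<close>. Observation \<open>i\<close> is
  independent of the earlier observations and outputs, so it may be drawn when it is used.\<close>

primrec output_law :: "channel \<Rightarrow> real measure \<Rightarrow> nat \<Rightarrow> (nat \<Rightarrow> real) measure" where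
  "output_law Q P 0 = return (histories 0) (\<lambda>_. undefined)"
| "output_law Q P (Suc i) =
     output_law Q P i \<bind> (\<lambda>z. P \<bind> (\<lambda>x. Q i x z \<bind>
       (\<lambda>y. return (histories (Suc i)) (z(i := y)))))"

section \<open>Local minimax risk\<close>

definition trunc_sq_loss :: "real \<Rightarrow> real \<Rightarrow> real" where
  "trunc_sq_loss B t = min (t\<^sup>2) B"

definition risk ::
  "nat \<Rightarrow> (real measure \<Rightarrow> real) \<Rightarrow> (real \<Rightarrow> real) \<Rightarrow> ((nat \<Rightarrow> real) \<Rightarrow> real) \<Rightarrow> channel \<Rightarrow>
   real measure \<Rightarrow> ennreal" where
  "risk n \<theta> L est Q P = (\<integral>\<^sup>+z. ennreal (L (est z - \<theta> P)) \<partial>output_law Q P n)"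

definition local_minimax ::
  "nat \<Rightarrow> (real measure \<Rightarrow> real) \<Rightarrow> real measure \<Rightarrow> (real \<Rightarrow> real) \<Rightarrow> real measure set \<Rightarrow>
   (nat \<Rightarrow> channel set) \<Rightarrow> ennreal" where
  "local_minimax n \<theta> P\<^sub>0 L \<P> \<Q> =
     (SUP P\<^sub>1\<in>\<P>. INF (est, Q)\<in>borel_measurable (histories n) \<times> \<Q> n.
        max (risk n \<theta> L est Q P\<^sub>0) (risk n \<theta> L est Q P\<^sub>1))"

section \<open>Sub-models and scores\<close>

definition sum_measure :: "real measure \<Rightarrow> real measure \<Rightarrow> real measure" where
  "sum_measure P P' = measure_of UNIV (sets borel) (\<lambda>A. emeasure P A + emeasure P' A)"

text \<open>\<open>remainder w P\<^sub>0 P g h\<close> is \<open>\<integral> w |dP - dP\<^sub>0 - h g dP\<^sub>0|\<close>, the integral being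
  taken with densities with respect to the dominating measure \<open>P + P\<^sub>0\<close>. The usual notion of score
  is the one with \<open>w = 1\<close>, and it suffices for bounded data. The weight \<open>1 + |x|\<close> is for unbounded
  data: there \<open>P \<mapsto> E\<^sub>P[X]\<close> is not differentiable along unweighted sub-models even under a
  fourth-moment bound (for \<open>0 < \<delta> < 1/3\<close>, mass \<open>|h| powr (1 + \<delta>)\<close> at distance
  \<open>c |h| powr (- \<delta>)\<close> cancels any first-order shift of the mean at cost \<open>o(|h|)\<close>), and
  \<open>g \<mapsto> E\<^sub>0[g X]\<close> is not continuous in the unweighted norm. On bounded data the weighted and
  unweighted notions coincide.\<close>

definition remainder ::
  "(real \<Rightarrow> real) \<Rightarrow> real measure \<Rightarrow> real measure \<Rightarrow> (real \<Rightarrow> real) \<Rightarrow> real \<Rightarrow> ennreal" where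
  "remainder w P\<^sub>0 P g h =
     (let \<nu> = sum_measure P P\<^sub>0;
          p = (\<lambda>x. enn2real (RN_deriv \<nu> P x));
          p\<^sub>0 = (\<lambda>x. enn2real (RN_deriv \<nu> P\<^sub>0 x))
      in \<integral>\<^sup>+x. ennreal (w x * \<bar>p x - p\<^sub>0 x - h * g x * p\<^sub>0 x\<bar>) \<partial>\<nu>)"

definition has_score ::
  "(real \<Rightarrow> real) \<Rightarrow> real measure \<Rightarrow> (real \<Rightarrow> real measure) \<Rightarrow> (real \<Rightarrow> real) \<Rightarrow> bool" where
  "has_score w P\<^sub>0 P g \<longleftrightarrow>
     g \<in> borel_measurable borel \<and> integrable P\<^sub>0 (\<lambda>x. w x * g x) \<and>
     ((\<lambda>h. remainder w P\<^sub>0 (P h) g h / ennreal \<bar>h\<bar>) \<longlongrightarrow> 0) (at 0)"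

text \<open>A collection of sub-models inside a class of distributions, each having a score, with scores
  dense. A score integrates to \<open>0\<close> under \<open>P\<^sub>0\<close> because each \<open>P h\<close> has total mass \<open>1\<close>, so the
  space in which scores can be dense is the mean-zero subspace.\<close>

definition submodels_dense_scores ::
  "(real \<Rightarrow> real) \<Rightarrow> real measure \<Rightarrow> real measure set \<Rightarrow> (real \<Rightarrow> real measure) set \<Rightarrow> bool" where
  "submodels_dense_scores w P\<^sub>0 \<P> \<S> \<longleftrightarrow>
     (\<forall>P\<in>\<S>. (\<forall>h. P h \<in> \<P>) \<and> (\<exists>g. has_score w P\<^sub>0 P g)) \<and>
     (\<forall>f\<in>borel_measurable borel.
        integrable P\<^sub>0 (\<lambda>x. w x * f x) \<longrightarrow> (\<integral>x. f x \<partial>P\<^sub>0) = 0 \<longrightarrow>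
        (\<forall>e>0. \<exists>P\<in>\<S>. \<exists>g. has_score w P\<^sub>0 P g \<and> (\<integral>x. w x * \<bar>f x - g x\<bar> \<partial>P\<^sub>0) < e))"

definition all_members :: "(real \<Rightarrow> real measure) set \<Rightarrow> real measure set" where
  "all_members \<S> = {P h | P h. P \<in> \<S>}"

end

theory Submission
  imports Defs
begin

text \<open>Everything rests on two-point problems, \<open>P\<^sub>0\<close> against one alternative \<open>P\<^sub>1\<close>, and on what a private
channel does to them.

\<^emph>\<open>Lower bounds.\<close> A channel of Renyi level \<open>\<epsilon>\<^sup>2\<close> turns the \<open>L\<^sup>1\<close> distance \<open>T\<close> of two inputs into a
chi-square divergence of at most \<open>(exp (\<epsilon>\<^sup>2) - 1) * T\<^sup>2\<close> of the two outputs
(\<open>private_mixture_contraction\<close>). The chi-square divergence is used in the variational form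
\<open>(E\<^sub>1 f)\<^sup>2 \<le> K * E\<^sub>0 f\<^sup>2\<close>, which passes through adaptive kernels by plain integration, so that \<open>n\<close>
rounds multiply \<open>K\<close> (\<open>output_law_contraction\<close>). Hence \<open>T\<close> of order \<open>1 / (\<epsilon> * sqrt n)\<close> leaves the
two hypotheses indistinguishable, and the squared gap of the parameters at that distance bounds the
risk from below (\<open>local_minimax_rate\<close>). What remains is how fast the parameter can move per unit of
\<open>L\<^sup>1\<close> distance. Along the exponential family the speed is \<open>1 / E\<^sub>0\<bar>X - m\<bar>\<close>, since the score is
\<open>x - m\<close>. Along a sub-model with score \<open>g\<close> it is \<open>E\<^sub>0[g X] / (Var\<^sub>0 * E\<^sub>0\<bar>g\<bar>)\<close>, and by duality of
\<open>L\<^sup>1\<close> and \<open>L\<^sup>\<infinity>\<close> the supremum over mean-zero \<open>g\<close> is the essential supremum of \<open>\<bar>x - m\<bar> / Var\<^sub>0\<close> up to a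
factor. It is nearly attained by a normalized and centred indicator of a set on which \<open>x - m\<close>
is nearly extremal; density of the scores provides a sub-model close to it
(\<open>submodel_lower_bound\<close>).

\<^emph>\<open>Upper bound.\<close> For the parametric class each observation is reduced to the bit \<open>x > m\<close>, which is
sent through randomized response. The probability of the bit is monotone in the parameter
(\<open>upper_tail_mono\<close>) and has slope \<open>E\<^sub>0\<bar>X - m\<bar> / 2\<close> at \<open>\<theta>\<^sub>0\<close>, half of the \<open>L\<^sup>1\<close> speed in the lower bound.
The likelihood-ratio test between \<open>\<theta>\<^sub>0\<close> and \<open>\<theta>\<^sub>1\<close> has error at most
\<open>exp (- const * n * \<epsilon>\<^sup>2 * d\<^sup>2)\<close>, where \<open>d\<close> is the difference of the two probabilities
(\<open>two_point_risk_upper\<close>). For near alternatives \<open>d\<close> is proportional to the parameter gap and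
\<open>x * exp (- x) \<le> 1\<close> gives the rate; for far ones \<open>d\<close> is bounded below and the exponential beats
the loss bound \<open>B\<close>, uniformly in the alternative.

The comparison of the two rates is the inequality \<open>Var\<^sub>0 \<le> ess sup \<bar>x - m\<bar> * E\<^sub>0\<bar>X - m\<bar>\<close>.\<close>

section \<open>Exponential tilts of a centred random variable\<close>


lemma abs_exp_remainder_le: "\<bar>exp y - 1 - y\<bar> \<le> y\<^sup>2 * exp \<bar>y\<bar>" for y :: real
proof -
  obtain t where t: "\<bar>t\<bar> \<le> \<bar>y\<bar>" "exp y = (\<Sum>m<2. y ^ m / fact m) + exp t / fact 2 * y ^ 2"
    using Maclaurin_exp_le[of y 2] by blast
  have "\<bar>exp y - 1 - y\<bar> = exp t / 2 * y\<^sup>2"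
    using t(2) by (simp add: numeral_2_eq_2)
  also have "\<dots> \<le> exp \<bar>y\<bar> * y\<^sup>2"
  proof (rule mult_right_mono)
    have "exp t \<le> exp \<bar>y\<bar>" using t(1) by simp
    then show "exp t / 2 \<le> exp \<bar>y\<bar>" using exp_gt_zero[of t] by linarith
  qed simp
  finally show ?thesis by (simp add: mult.commute)
qed

text \<open>Half of an exponential moment of order \<open>s\<close> pays for every polynomial factor; the other half is
kept for the tilt by \<open>\<bar>h\<bar> \<le> s / 2\<close>.\<close>

lemma poly_le_exp:
  assumes "0 < s" "0 \<le> (y::real)"
  shows "(1 + y) * y\<^sup>2 \<le> ((6/s)^2 + (6/s)^3) * exp (s * y / 2)"
proof -
  have y: "y \<le> (6/s) * exp (s * y / 6)"
    using exp_ge_add_one_self[of "s * y / 6"] assms by (simp add: field_simps)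
  have "y^2 \<le> ((6/s) * exp (s * y / 6))^2" using y assms by (intro power_mono) auto
  also have "\<dots> = (6/s)^2 * exp (s * y / 3)"
    by (simp add: power_mult_distrib power2_eq_square flip: exp_add)
  also have "\<dots> \<le> (6/s)^2 * exp (s * y / 2)"
    using assms by (intro mult_left_mono) (auto simp: field_simps)
  finally have 2: "y^2 \<le> (6/s)^2 * exp (s * y / 2)" .
  have "y^3 \<le> ((6/s) * exp (s * y / 6))^3" using y assms by (intro power_mono) auto
  also have "\<dots> = (6/s)^3 * exp (s * y / 2)"
    unfolding power_mult_distrib exp_of_nat_mult[symmetric] by simp
  finally have 3: "y^3 \<le> (6/s)^3 * exp (s * y / 2)" .
  show ?thesis using 2 3 by (simp add: algebra_simps power3_eq_cube power2_eq_square)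
qed

text \<open>Taylor expansion under the integral sign: the pointwise remainder is at most
\<open>(h * y)\<^sup>2 * exp \<bar>h * y\<bar>\<close>, which the exponential moment of order \<open>s\<close> dominates. Dividing by \<open>G h\<close>
costs another \<open>O(h\<^sup>2)\<close>, because the linear term of \<open>G\<close> vanishes for a centred variable. The weight
\<open>1 + \<bar>Y x\<bar>\<close> admits test functions of linear growth, and with them the expansion of the mean.\<close>

lemma (in prob_space) exp_tilt_expansion:
  fixes Y :: "'a \<Rightarrow> real"
  assumes [measurable]: "random_variable borel Y"
    and s: "0 < s" and I: "integrable M (\<lambda>x. exp (s * \<bar>Y x\<bar>))"
    and Y0: "expectation Y = 0"
  defines "G \<equiv> \<lambda>h. expectation (\<lambda>x. exp (h * Y x))"
  obtains C where "0 < C"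
    and "\<And>h. \<bar>h\<bar> \<le> s / 2 \<Longrightarrow> integrable M (\<lambda>x. exp (h * Y x)) \<and> 1 \<le> G h \<and> G h \<le> 1 + C * h\<^sup>2 \<and>
      integrable M (\<lambda>x. (1 + \<bar>Y x\<bar>) * \<bar>exp (h * Y x) / G h - 1 - h * Y x\<bar>) \<and>
      expectation (\<lambda>x. (1 + \<bar>Y x\<bar>) * \<bar>exp (h * Y x) / G h - 1 - h * Y x\<bar>) \<le> C * h\<^sup>2"
proof -
  define K where "K = expectation (\<lambda>x. exp (s * \<bar>Y x\<bar>))"
  define c where "c = (6/s)^2 + (6/s)^3"
  define d where "d = 1 + 2 / s"
  have c: "0 < c" and d: "0 < d" using s by (auto simp: c_def d_def intro!: add_pos_pos)
  have K: "1 \<le> K"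
  proof -
    have "expectation (\<lambda>x. 1) \<le> K"
      unfolding K_def using s I by (intro integral_mono) auto
    then show ?thesis by (simp add: prob_space)
  qed
  have YI: "integrable M Y"
  proof (rule Bochner_Integration.integrable_bound[OF integrable_mult_right[OF I, of "1/s"]])
    show "AE x in M. norm (Y x) \<le> norm (1 / s * exp (s * \<bar>Y x\<bar>))"
    proof (rule AE_I2)
      fix x
      have "s * \<bar>Y x\<bar> \<le> exp (s * \<bar>Y x\<bar>)" using exp_ge_add_one_self[of "s * \<bar>Y x\<bar>"] by linarith
      then show "norm (Y x) \<le> norm (1 / s * exp (s * \<bar>Y x\<bar>))" using s by (simp add: field_simps)
    qed
  qed simp
  define C where "C = c * K + c * K * (d * K)"
  have C: "0 < C" using c d K by (auto simp: C_def intro!: add_pos_pos mult_pos_pos)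
  have cC: "c * K \<le> C" using c d K by (auto simp: C_def)
  show thesis
  proof (rule that[OF C])
    fix h :: real assume h: "\<bar>h\<bar> \<le> s / 2"
    have hY: "h * Y x \<le> s * \<bar>Y x\<bar> / 2" "\<bar>h * Y x\<bar> \<le> s * \<bar>Y x\<bar> / 2" for x
    proof -
      show "\<bar>h * Y x\<bar> \<le> s * \<bar>Y x\<bar> / 2"
        using mult_right_mono[OF h, of "\<bar>Y x\<bar>"] by (simp add: abs_mult)
      then show "h * Y x \<le> s * \<bar>Y x\<bar> / 2" by linarith
    qed
    have le1: "(1 + \<bar>Y x\<bar>) * \<bar>exp (h * Y x) - 1 - h * Y x\<bar> \<le> c * h\<^sup>2 * exp (s * \<bar>Y x\<bar>)" for x
    proof -
      have "(1 + \<bar>Y x\<bar>) * \<bar>exp (h * Y x) - 1 - h * Y x\<bar>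
          \<le> (1 + \<bar>Y x\<bar>) * ((h * Y x)\<^sup>2 * exp (s * \<bar>Y x\<bar> / 2))"
      proof (rule mult_left_mono)
        have "\<bar>exp (h * Y x) - 1 - h * Y x\<bar> \<le> (h * Y x)\<^sup>2 * exp \<bar>h * Y x\<bar>"
          by (rule abs_exp_remainder_le)
        also have "\<dots> \<le> (h * Y x)\<^sup>2 * exp (s * \<bar>Y x\<bar> / 2)"
          using hY(2)[of x] by (intro mult_left_mono) auto
        finally show "\<bar>exp (h * Y x) - 1 - h * Y x\<bar> \<le> (h * Y x)\<^sup>2 * exp (s * \<bar>Y x\<bar> / 2)" .
      qed simp
      also have "\<dots> = h\<^sup>2 * ((1 + \<bar>Y x\<bar>) * \<bar>Y x\<bar>\<^sup>2) * exp (s * \<bar>Y x\<bar> / 2)"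
        by (simp add: power_mult_distrib algebra_simps)
      also have "\<dots> \<le> h\<^sup>2 * (c * exp (s * \<bar>Y x\<bar> / 2)) * exp (s * \<bar>Y x\<bar> / 2)"
        using poly_le_exp[OF s, of "\<bar>Y x\<bar>"] unfolding c_def
        by (intro mult_left_mono mult_right_mono) auto
      also have "\<dots> = c * h\<^sup>2 * exp (s * \<bar>Y x\<bar>)"
        by (simp add: algebra_simps flip: exp_add)
      finally show ?thesis .
    qed
    have I1: "integrable M (\<lambda>x. (1 + \<bar>Y x\<bar>) * \<bar>exp (h * Y x) - 1 - h * Y x\<bar>)"
      using c le1 by (intro Bochner_Integration.integrable_bound[OF integrable_mult_right[OF I, of "c * h\<^sup>2"]])
        (auto simp: abs_mult)
    have E1: "expectation (\<lambda>x. (1 + \<bar>Y x\<bar>) * \<bar>exp (h * Y x) - 1 - h * Y x\<bar>) \<le> c * K * h\<^sup>2"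
    proof -
      have "expectation (\<lambda>x. (1 + \<bar>Y x\<bar>) * \<bar>exp (h * Y x) - 1 - h * Y x\<bar>)
          \<le> expectation (\<lambda>x. c * h\<^sup>2 * exp (s * \<bar>Y x\<bar>))"
        using I I1 le1 by (intro integral_mono) auto
      then show ?thesis by (simp add: K_def mult_ac)
    qed
    have le2: "(1 + \<bar>Y x\<bar>) * exp (h * Y x) \<le> d * exp (s * \<bar>Y x\<bar>)" for x
    proof -
      have "1 + \<bar>Y x\<bar> \<le> d * exp (s * \<bar>Y x\<bar> / 2)"
      proof -
        have a: "1 + s * \<bar>Y x\<bar> / 2 \<le> exp (s * \<bar>Y x\<bar> / 2)" by (rule exp_ge_add_one_self)
        have "\<bar>Y x\<bar> = 2 / s * (s * \<bar>Y x\<bar> / 2)" using s by simp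
        also have "\<dots> \<le> 2 / s * exp (s * \<bar>Y x\<bar> / 2)" using a s by (intro mult_left_mono) (linarith, simp)
        finally have "\<bar>Y x\<bar> \<le> 2 / s * exp (s * \<bar>Y x\<bar> / 2)" .
        moreover have "1 \<le> exp (s * \<bar>Y x\<bar> / 2)" using s by simp
        ultimately show ?thesis unfolding d_def distrib_right mult_1 by linarith
      qed
      then have "(1 + \<bar>Y x\<bar>) * exp (h * Y x) \<le> d * exp (s * \<bar>Y x\<bar> / 2) * exp (s * \<bar>Y x\<bar> / 2)"
        using hY(1)[of x] d by (intro mult_mono) auto
      then show ?thesis by (simp add: algebra_simps flip: exp_add)
    qed
    have I2: "integrable M (\<lambda>x. (1 + \<bar>Y x\<bar>) * exp (h * Y x))"
      using d le2 by (intro Bochner_Integration.integrable_bound[OF integrable_mult_right[OF I, of d]])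
        (auto simp: abs_mult)
    have E2: "expectation (\<lambda>x. (1 + \<bar>Y x\<bar>) * exp (h * Y x)) \<le> d * K"
    proof -
      have "expectation (\<lambda>x. (1 + \<bar>Y x\<bar>) * exp (h * Y x)) \<le> expectation (\<lambda>x. d * exp (s * \<bar>Y x\<bar>))"
        using I I2 le2 by (intro integral_mono) auto
      then show ?thesis by (simp add: K_def mult_ac)
    qed
    have I3: "integrable M (\<lambda>x. exp (h * Y x))"
      by (intro Bochner_Integration.integrable_bound[OF I2]) (auto simp: abs_mult algebra_simps)
    have G1: "1 \<le> G h"
    proof -
      have "expectation (\<lambda>x. 1 + h * Y x) \<le> G h"
        unfolding G_def using YI I3 by (intro integral_mono) auto
      then show ?thesis using YI Y0 by (simp add: prob_space)
    qed
    have G2: "G h \<le> 1 + c * K * h\<^sup>2"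
    proof -
      have "G h - 1 = expectation (\<lambda>x. exp (h * Y x) - 1 - h * Y x)"
        unfolding G_def using YI I3 Y0 by (simp add: prob_space)
      also have "\<dots> \<le> expectation (\<lambda>x. (1 + \<bar>Y x\<bar>) * \<bar>exp (h * Y x) - 1 - h * Y x\<bar>)"
      proof (intro integral_mono)
        show "exp (h * Y x) - 1 - h * Y x \<le> (1 + \<bar>Y x\<bar>) * \<bar>exp (h * Y x) - 1 - h * Y x\<bar>" for x
          using mult_right_mono[of 1 "1 + \<bar>Y x\<bar>" "\<bar>exp (h * Y x) - 1 - h * Y x\<bar>"] by simp
      qed (use I1 I3 YI in auto)
      finally show ?thesis using E1 by linarith
    qed
    have le4: "(1 + \<bar>Y x\<bar>) * \<bar>exp (h * Y x) / G h - 1 - h * Y x\<bar>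
        \<le> (1 + \<bar>Y x\<bar>) * \<bar>exp (h * Y x) - 1 - h * Y x\<bar>
          + c * K * h\<^sup>2 * ((1 + \<bar>Y x\<bar>) * exp (h * Y x))" for x
    proof -
      have g: "\<bar>1 / G h - 1\<bar> \<le> c * K * h\<^sup>2"
      proof -
        have "\<bar>1 / G h - 1\<bar> = (G h - 1) / G h" using G1 by (simp add: field_simps abs_if)
        also have "\<dots> \<le> (G h - 1) / 1" using G1 by (intro divide_left_mono) auto
        also have "\<dots> \<le> c * K * h\<^sup>2" using G2 by simp
        finally show ?thesis .
      qed
      have "exp (h * Y x) / G h - 1 - h * Y x
          = (exp (h * Y x) - 1 - h * Y x) + exp (h * Y x) * (1 / G h - 1)"
        by (simp add: algebra_simps)
      also have "\<bar>\<dots>\<bar> \<le> \<bar>exp (h * Y x) - 1 - h * Y x\<bar> + \<bar>exp (h * Y x) * (1 / G h - 1)\<bar>"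
        by (rule abs_triangle_ineq)
      also have "\<dots> \<le> \<bar>exp (h * Y x) - 1 - h * Y x\<bar> + exp (h * Y x) * (c * K * h\<^sup>2)"
        unfolding abs_mult using g by (intro add_left_mono) (auto intro!: mult_left_mono)
      finally have "\<bar>exp (h * Y x) / G h - 1 - h * Y x\<bar> \<le> \<dots>" .
      from mult_left_mono[OF this, of "1 + \<bar>Y x\<bar>"] show ?thesis by (simp add: algebra_simps)
    qed
    have I5: "integrable M (\<lambda>x. (1 + \<bar>Y x\<bar>) * \<bar>exp (h * Y x) - 1 - h * Y x\<bar>
          + c * K * h\<^sup>2 * ((1 + \<bar>Y x\<bar>) * exp (h * Y x)))"
      using I1 I2 by (intro Bochner_Integration.integrable_add integrable_mult_right) auto
    have I4: "integrable M (\<lambda>x. (1 + \<bar>Y x\<bar>) * \<bar>exp (h * Y x) / G h - 1 - h * Y x\<bar>)"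
    proof (rule Bochner_Integration.integrable_bound[OF I5])
      show "AE x in M. norm ((1 + \<bar>Y x\<bar>) * \<bar>exp (h * Y x) / G h - 1 - h * Y x\<bar>)
          \<le> norm ((1 + \<bar>Y x\<bar>) * \<bar>exp (h * Y x) - 1 - h * Y x\<bar>
          + c * K * h\<^sup>2 * ((1 + \<bar>Y x\<bar>) * exp (h * Y x)))"
        using le4 by (intro AE_I2) (smt (verit, best) real_norm_def abs_ge_zero mult_nonneg_nonneg)
    qed simp
    have "expectation (\<lambda>x. (1 + \<bar>Y x\<bar>) * \<bar>exp (h * Y x) / G h - 1 - h * Y x\<bar>)
       \<le> expectation (\<lambda>x. (1 + \<bar>Y x\<bar>) * \<bar>exp (h * Y x) - 1 - h * Y x\<bar>
          + c * K * h\<^sup>2 * ((1 + \<bar>Y x\<bar>) * exp (h * Y x)))"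
      using I4 I5 le4 by (intro integral_mono) auto
    also have "\<dots> = expectation (\<lambda>x. (1 + \<bar>Y x\<bar>) * \<bar>exp (h * Y x) - 1 - h * Y x\<bar>)
          + c * K * h\<^sup>2 * expectation (\<lambda>x. (1 + \<bar>Y x\<bar>) * exp (h * Y x))"
      using I1 I2 by (subst Bochner_Integration.integral_add) (auto intro!: integrable_mult_right)
    also have "\<dots> \<le> c * K * h\<^sup>2 + c * K * h\<^sup>2 * (d * K)"
      using E1 E2 c K by (intro add_mono mult_left_mono) auto
    also have "\<dots> = C * h\<^sup>2" by (simp add: C_def algebra_simps)
    finally have E4: "expectation (\<lambda>x. (1 + \<bar>Y x\<bar>) * \<bar>exp (h * Y x) / G h - 1 - h * Y x\<bar>) \<le> C * h\<^sup>2" .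
    have "G h \<le> 1 + C * h\<^sup>2" using G2 mult_right_mono[OF cC, of "h\<^sup>2"] by simp
    with I3 G1 I4 E4 show "integrable M (\<lambda>x. exp (h * Y x)) \<and> 1 \<le> G h \<and> G h \<le> 1 + C * h\<^sup>2 \<and>
      integrable M (\<lambda>x. (1 + \<bar>Y x\<bar>) * \<bar>exp (h * Y x) / G h - 1 - h * Y x\<bar>) \<and>
      expectation (\<lambda>x. (1 + \<bar>Y x\<bar>) * \<bar>exp (h * Y x) / G h - 1 - h * Y x\<bar>) \<le> C * h\<^sup>2"
      by blast
  qed
qed

section \<open>Exponential families near a parameter\<close>


lemma add_one_less_exp: "1 + y < exp y" if "y \<noteq> 0" for y :: real
proof (cases "0 \<le> 1 + y / 2")
  case True
  have "1 + y < (1 + y / 2)\<^sup>2" using that zero_less_power2[of y] by (simp add: power2_eq_square algebra_simps)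
  also have "\<dots> \<le> (exp (y / 2))\<^sup>2" using True exp_ge_add_one_self[of "y / 2"] by (intro power_mono)
  also have "\<dots> = exp y" by (simp add: power2_eq_square flip: exp_add)
  finally show ?thesis .
next
  case False
  then show ?thesis using exp_gt_zero[of y] by linarith
qed

lemma exp_density_measurable [measurable]: "exp_density \<mu> \<theta> \<in> borel_measurable borel"
  unfolding exp_density_def by measurable

lemma sets_base_measure: "regular_minimal_family \<mu> \<Longrightarrow> sets \<mu> = sets borel"
  by (simp add: regular_minimal_family_def)

text \<open>A vanishing partition function makes \<open>\<mu>\<close> null and every variance zero, which minimality excludes.
Without this the logarithm in the log-partition function would be a default value.\<close>

lemma partition_pos:
  assumes "regular_minimal_family \<mu>" "\<theta> \<in> natural_params \<mu>"
  shows "0 < (\<integral>x. exp (\<theta> * x) \<partial>\<mu>)"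
proof (rule ccontr)
  have [measurable_cong, simp]: "sets \<mu> = sets borel" using assms(1) by (rule sets_base_measure)
  have I: "integrable \<mu> (\<lambda>x. exp (\<theta> * x))" using assms(2) by (simp add: natural_params_def)
  assume "\<not> ?thesis"
  moreover have "0 \<le> (\<integral>x. exp (\<theta> * x) \<partial>\<mu>)" by simp
  ultimately have "(\<integral>x. exp (\<theta> * x) \<partial>\<mu>) = 0" by linarith
  then have "AE x in \<mu>. False"
    using integral_nonneg_eq_0_iff_AE[OF I] by simp
  then have "AE x in \<mu>. exp_density \<mu> \<theta> x * (x - mean (exp_member \<mu> \<theta>))\<^sup>2 = 0" by eventually_elim auto
  then have "(\<integral>x. exp_density \<mu> \<theta> x * (x - mean (exp_member \<mu> \<theta>))\<^sup>2 \<partial>\<mu>) = 0"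
    by (rule integral_eq_zero_AE)
  then have "var (exp_member \<mu> \<theta>) = 0"
    unfolding var_def exp_member_def by (subst integral_density) (auto simp: exp_density_def[abs_def])
  with assms show False by (auto simp: regular_minimal_family_def)
qed

lemma exp_density_eq:
  assumes "regular_minimal_family \<mu>" "\<theta> \<in> natural_params \<mu>"
  shows "exp_density \<mu> \<theta> = (\<lambda>x. exp (\<theta> * x) / (\<integral>x. exp (\<theta> * x) \<partial>\<mu>))"
  using partition_pos[OF assms] by (simp add: exp_density_def[abs_def] log_partition_def exp_diff)

lemma prob_exp_member:
  assumes "regular_minimal_family \<mu>" "\<theta> \<in> natural_params \<mu>"
  shows "prob_space (exp_member \<mu> \<theta>)"
proof
  have [measurable_cong, simp]: "sets \<mu> = sets borel" using assms(1) by (rule sets_base_measure)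
  have I: "integrable \<mu> (exp_density \<mu> \<theta>)"
    using assms(2) by (simp add: exp_density_eq[OF assms] natural_params_def)
  have "emeasure (exp_member \<mu> \<theta>) (space (exp_member \<mu> \<theta>)) = (\<integral>\<^sup>+x. ennreal (exp_density \<mu> \<theta> x) \<partial>\<mu>)"
    unfolding exp_member_def space_density
    by (subst emeasure_density) (auto intro!: nn_integral_cong simp del: \<open>sets \<mu> = sets borel\<close>)
  also have "\<dots> = ennreal (\<integral>x. exp_density \<mu> \<theta> x \<partial>\<mu>)"
    using I by (subst nn_integral_eq_integral) (auto simp: exp_density_def)
  also have "\<dots> = 1"
    using partition_pos[OF assms] by (simp add: exp_density_eq[OF assms])
  finally show "emeasure (exp_member \<mu> \<theta>) (space (exp_member \<mu> \<theta>)) = 1" .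
qed

lemma sets_exp_member [simp]: "sets (exp_member \<mu> \<theta>) = sets \<mu>"
  by (simp add: exp_member_def)

lemma integral_exp_member:
  fixes f :: "real \<Rightarrow> real"
  assumes "regular_minimal_family \<mu>" "\<theta> \<in> natural_params \<mu>" "f \<in> borel_measurable borel"
  shows "integrable (exp_member \<mu> \<theta>) f \<longleftrightarrow> integrable \<mu> (\<lambda>x. exp_density \<mu> \<theta> x * f x)"
    and "(\<integral>x. f x \<partial>exp_member \<mu> \<theta>) = (\<integral>x. exp_density \<mu> \<theta> x * f x \<partial>\<mu>)"
proof -
  have [measurable_cong, simp]: "sets \<mu> = sets borel" using assms(1) by (rule sets_base_measure)
  have [measurable]: "exp_density \<mu> \<theta> \<in> borel_measurable \<mu>" unfolding exp_density_def by measurable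
  have [measurable]: "f \<in> borel_measurable \<mu>" using assms(3) by simp
  show "integrable (exp_member \<mu> \<theta>) f \<longleftrightarrow> integrable \<mu> (\<lambda>x. exp_density \<mu> \<theta> x * f x)"
    unfolding exp_member_def by (subst integrable_density) (auto simp: exp_density_def)
  show "(\<integral>x. f x \<partial>exp_member \<mu> \<theta>) = (\<integral>x. exp_density \<mu> \<theta> x * f x \<partial>\<mu>)"
    unfolding exp_member_def by (subst integral_density) (auto simp: exp_density_def)
qed

text \<open>Openness of the natural parameter space puts both \<open>\<theta> + s\<close> and \<open>\<theta> - s\<close> in it, and
\<open>exp (s * \<bar>x\<bar>)\<close> is at most \<open>exp (s * x) + exp (- s * x)\<close>.\<close>

lemma integrable_exp_abs:
  assumes R: "regular_minimal_family \<mu>" and \<theta>: "\<theta> \<in> natural_params \<mu>"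
  obtains s where "0 < s" "integrable (exp_member \<mu> \<theta>) (\<lambda>x. exp (s * \<bar>x\<bar>))"
proof -
  have [measurable_cong, simp]: "sets \<mu> = sets borel" using R by (rule sets_base_measure)
  obtain e where e: "0 < e" "ball \<theta> e \<subseteq> natural_params \<mu>"
    using R \<theta> unfolding regular_minimal_family_def open_contains_ball by blast
  define s where "s = e / 2"
  have s: "0 < s" "\<theta> + s \<in> natural_params \<mu>" "\<theta> - s \<in> natural_params \<mu>"
    using e by (auto simp: s_def dist_real_def intro!: subsetD[OF e(2)])
  define Z where "Z = (\<integral>x. exp (\<theta> * x) \<partial>\<mu>)"
  have Z: "0 < Z" unfolding Z_def by (rule partition_pos[OF R \<theta>])
  have "integrable \<mu> (\<lambda>x. exp_density \<mu> \<theta> x * exp (s * \<bar>x\<bar>))"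
  proof (rule Bochner_Integration.integrable_bound)
    show "integrable \<mu> (\<lambda>x. (exp ((\<theta> + s) * x) + exp ((\<theta> - s) * x)) / Z)"
      using s by (simp add: natural_params_def)
    show "AE x in \<mu>. norm (exp_density \<mu> \<theta> x * exp (s * \<bar>x\<bar>))
        \<le> norm ((exp ((\<theta> + s) * x) + exp ((\<theta> - s) * x)) / Z)"
    proof (rule AE_I2)
      fix x :: real
      have "exp (\<theta> * x) * exp (s * \<bar>x\<bar>) \<le> exp ((\<theta> + s) * x) + exp ((\<theta> - s) * x)"
        by (cases "0 \<le> x") (auto simp: algebra_simps simp flip: exp_add)
      then show "norm (exp_density \<mu> \<theta> x * exp (s * \<bar>x\<bar>))
        \<le> norm ((exp ((\<theta> + s) * x) + exp ((\<theta> - s) * x)) / Z)"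
        using Z unfolding exp_density_eq[OF R \<theta>] Z_def[symmetric]
        by (simp add: abs_mult divide_right_mono)
    qed
  qed (auto simp: exp_density_def)
  then have "integrable (exp_member \<mu> \<theta>) (\<lambda>x. exp (s * \<bar>x\<bar>))"
    by (subst integral_exp_member[OF R \<theta>]) auto
  with s(1) show thesis by (rule that)
qed

lemma integrable_poly_exp_member:
  assumes R: "regular_minimal_family \<mu>" and \<theta>: "\<theta> \<in> natural_params \<mu>"
  shows "integrable (exp_member \<mu> \<theta>) (\<lambda>x. x)" "integrable (exp_member \<mu> \<theta>) (\<lambda>x. (x - c)\<^sup>2)"
proof -
  have sm[measurable_cong, simp]: "sets \<mu> = sets borel" using R by (rule sets_base_measure)
  interpret prob_space "exp_member \<mu> \<theta>" by (rule prob_exp_member[OF R \<theta>])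
  have [measurable_cong]: "sets (exp_member \<mu> \<theta>) = sets borel" by simp
  obtain s where s: "0 < s" and I: "integrable (exp_member \<mu> \<theta>) (\<lambda>x. exp (s * \<bar>x\<bar>))"
    by (rule integrable_exp_abs[OF R \<theta>])
  have I2: "integrable (exp_member \<mu> \<theta>) (\<lambda>x. x\<^sup>2)"
  proof (rule Bochner_Integration.integrable_bound)
    show "integrable (exp_member \<mu> \<theta>) (\<lambda>x. ((6/s)^2 + (6/s)^3) * exp (s * \<bar>x\<bar>))" using I by simp
    show "AE x in exp_member \<mu> \<theta>. norm (x\<^sup>2) \<le> norm (((6/s)^2 + (6/s)^3) * exp (s * \<bar>x\<bar>))"
    proof (rule AE_I2)
      fix x :: real
      have p: "0 \<le> (6/s)^2 + (6/s)^3" using s by simp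
      have "x\<^sup>2 \<le> (1 + \<bar>x\<bar>) * \<bar>x\<bar>\<^sup>2" by (simp add: algebra_simps)
      also have "\<dots> \<le> ((6/s)^2 + (6/s)^3) * exp (s * \<bar>x\<bar> / 2)" using poly_le_exp[OF s, of "\<bar>x\<bar>"] by simp
      also have "\<dots> \<le> ((6/s)^2 + (6/s)^3) * exp (s * \<bar>x\<bar>)"
        using p s by (intro mult_left_mono) auto
      finally show "norm (x\<^sup>2) \<le> norm (((6/s)^2 + (6/s)^3) * exp (s * \<bar>x\<bar>))" using p by (simp add: abs_mult)
    qed
  qed auto
  show I1: "integrable (exp_member \<mu> \<theta>) (\<lambda>x. x)"
    by (rule square_integrable_imp_integrable[OF _ I2]) simp
  have "integrable (exp_member \<mu> \<theta>) (\<lambda>x. x\<^sup>2 - 2 * c * x + c\<^sup>2)" using I1 I2 by auto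
  then show "integrable (exp_member \<mu> \<theta>) (\<lambda>x. (x - c)\<^sup>2)"
    by (simp add: power2_eq_square algebra_simps)
qed

lemma exp_member_change:
  assumes R: "regular_minimal_family \<mu>" and \<theta>: "\<theta> \<in> natural_params \<mu>" "\<theta>' \<in> natural_params \<mu>"
    and f: "f \<in> borel_measurable borel"
  defines "L \<equiv> \<lambda>x. exp ((\<theta>' - \<theta>) * x - (log_partition \<mu> \<theta>' - log_partition \<mu> \<theta>))"
  shows "integrable (exp_member \<mu> \<theta>') f \<longleftrightarrow> integrable (exp_member \<mu> \<theta>) (\<lambda>x. L x * f x)"
    and "(\<integral>x. f x \<partial>exp_member \<mu> \<theta>') = (\<integral>x. L x * f x \<partial>exp_member \<mu> \<theta>)"
proof -
  have "exp_density \<mu> \<theta> x * L x = exp_density \<mu> \<theta>' x" for x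
    by (simp add: exp_density_def L_def algebra_simps flip: exp_add)
  then have eq: "exp_density \<mu> \<theta> x * (L x * f x) = exp_density \<mu> \<theta>' x * f x" for x
    by (simp add: mult.assoc[symmetric])
  have m: "(\<lambda>x. L x * f x) \<in> borel_measurable borel" using f unfolding L_def by measurable
  show "integrable (exp_member \<mu> \<theta>') f \<longleftrightarrow> integrable (exp_member \<mu> \<theta>) (\<lambda>x. L x * f x)"
    "(\<integral>x. f x \<partial>exp_member \<mu> \<theta>') = (\<integral>x. L x * f x \<partial>exp_member \<mu> \<theta>)"
    using integral_exp_member[OF R \<theta>(1) m] integral_exp_member[OF R \<theta>(2) f] by (simp_all add: eq)
qed

text \<open>Up to its value at \<open>\<theta>\<close>, the log-partition function is the cumulant generating function of \<open>P\<^sub>\<theta>\<close>.\<close>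

lemma natural_params_shift:
  assumes R: "regular_minimal_family \<mu>" and \<theta>: "\<theta> \<in> natural_params \<mu>"
  shows "\<theta> + h \<in> natural_params \<mu> \<longleftrightarrow> integrable (exp_member \<mu> \<theta>) (\<lambda>x. exp (h * x))"
    and "\<theta> + h \<in> natural_params \<mu> \<Longrightarrow>
      exp (log_partition \<mu> (\<theta> + h) - log_partition \<mu> \<theta>) = (\<integral>x. exp (h * x) \<partial>exp_member \<mu> \<theta>)"
proof -
  define Z where "Z = (\<integral>x. exp (\<theta> * x) \<partial>\<mu>)"
  have Z: "0 < Z" unfolding Z_def by (rule partition_pos[OF R \<theta>])
  have eq: "exp_density \<mu> \<theta> x * exp (h * x) = exp ((\<theta> + h) * x) / Z" for x
    using exp_density_eq[OF R \<theta>] by (simp add: Z_def algebra_simps exp_add)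
  show "\<theta> + h \<in> natural_params \<mu> \<longleftrightarrow> integrable (exp_member \<mu> \<theta>) (\<lambda>x. exp (h * x))"
    using Z by (subst integral_exp_member[OF R \<theta>]) (auto simp: natural_params_def eq divide_inverse)
  assume "\<theta> + h \<in> natural_params \<mu>"
  then have Z': "0 < (\<integral>x. exp ((\<theta> + h) * x) \<partial>\<mu>)" by (rule partition_pos[OF R])
  have "(\<integral>x. exp (h * x) \<partial>exp_member \<mu> \<theta>) = (\<integral>x. exp ((\<theta> + h) * x) \<partial>\<mu>) / Z"
    by (subst integral_exp_member[OF R \<theta>]) (auto simp: eq)
  then show "exp (log_partition \<mu> (\<theta> + h) - log_partition \<mu> \<theta>) = (\<integral>x. exp (h * x) \<partial>exp_member \<mu> \<theta>)"
    using Z Z' by (simp add: log_partition_def Z_def exp_diff)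
qed

lemma mean_abs_dev_pos:
  assumes R: "regular_minimal_family \<mu>" and \<theta>: "\<theta> \<in> natural_params \<mu>"
  shows "0 < mean_abs_dev (exp_member \<mu> \<theta>)"
proof (rule ccontr)
  interpret prob_space "exp_member \<mu> \<theta>" by (rule prob_exp_member[OF R \<theta>])
  have sm[measurable_cong]: "sets (exp_member \<mu> \<theta>) = sets borel" using R by (simp add: regular_minimal_family_def)
  assume "\<not> ?thesis"
  moreover have "0 \<le> mean_abs_dev (exp_member \<mu> \<theta>)" by (simp add: mean_abs_dev_def)
  ultimately have "mean_abs_dev (exp_member \<mu> \<theta>) = 0" by linarith
  then have "AE x in exp_member \<mu> \<theta>. x - mean (exp_member \<mu> \<theta>) = 0"
    unfolding mean_abs_dev_def using integrable_poly_exp_member(1)[OF R \<theta>]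
    by (subst (asm) integral_nonneg_eq_0_iff_AE) auto
  then have "AE x in exp_member \<mu> \<theta>. (x - mean (exp_member \<mu> \<theta>))\<^sup>2 = 0" by eventually_elim simp
  then have "var (exp_member \<mu> \<theta>) = 0" unfolding var_def by (rule integral_eq_zero_AE)
  with assms show False by (auto simp: regular_minimal_family_def)
qed

text \<open>The likelihood ratio of \<open>P\<^bsub>\<theta>+h\<^esub>\<close> to \<open>P\<^sub>\<theta>\<close> is \<open>1 + h * (x - m)\<close> up to a remainder that is
\<open>O(h\<^sup>2)\<close> in the norm weighted by \<open>1 + \<bar>x - m\<bar>\<close>. All local properties of the family follow by
choosing \<open>\<phi>\<close>: a bounded function gives the \<open>L\<^sup>1\<close> distance, an upper tail the power of the
test, and \<open>x - m\<close> the derivative of the mean. The bounds on the log-partition function are stated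
separately because they give its derivative.\<close>

lemma exp_family_expansion:
  assumes R: "regular_minimal_family \<mu>" and \<theta>: "\<theta> \<in> natural_params \<mu>"
  defines "P \<equiv> exp_member \<mu> \<theta>"
  defines "m \<equiv> mean P"
  obtains s C where "0 < s" "0 < C"
    and "\<And>h. \<bar>h\<bar> \<le> s \<Longrightarrow> \<theta> + h \<in> natural_params \<mu>"
    and "\<And>h. \<bar>h\<bar> \<le> s \<Longrightarrow> 0 \<le> log_partition \<mu> (\<theta> + h) - log_partition \<mu> \<theta> - h * m \<and>
            log_partition \<mu> (\<theta> + h) - log_partition \<mu> \<theta> - h * m \<le> C * h\<^sup>2"
    and "\<And>h \<phi>. \<bar>h\<bar> \<le> s \<Longrightarrow> \<phi> \<in> borel_measurable borel \<Longrightarrow> (\<And>x. \<bar>\<phi> x\<bar> \<le> 1 + \<bar>x - m\<bar>) \<Longrightarrow>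
            \<bar>(\<integral>x. \<phi> x \<partial>exp_member \<mu> (\<theta> + h)) - (\<integral>x. \<phi> x \<partial>P) - h * (\<integral>x. \<phi> x * (x - m) \<partial>P)\<bar> \<le> C * h\<^sup>2"
proof -
  interpret prob_space P unfolding P_def by (rule prob_exp_member[OF R \<theta>])
  have sP[measurable_cong]: "sets P = sets borel" using R by (simp add: P_def regular_minimal_family_def)
  obtain s where s: "0 < s" and I: "integrable P (\<lambda>x. exp (s * \<bar>x\<bar>))"
    unfolding P_def by (rule integrable_exp_abs[OF R \<theta>])
  have IX: "integrable P (\<lambda>x. x)" "integrable P (\<lambda>x. (x - m)\<^sup>2)"
    unfolding P_def by (rule integrable_poly_exp_member[OF R \<theta>])+
  have I': "integrable P (\<lambda>x. exp (s * \<bar>x - m\<bar>))"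
  proof (rule Bochner_Integration.integrable_bound)
    show "integrable P (\<lambda>x. exp (s * \<bar>m\<bar>) * exp (s * \<bar>x\<bar>))" using I by simp
    show "AE x in P. norm (exp (s * \<bar>x - m\<bar>)) \<le> norm (exp (s * \<bar>m\<bar>) * exp (s * \<bar>x\<bar>))"
    proof (rule AE_I2)
      fix x :: real
      have "s * \<bar>x - m\<bar> \<le> s * (\<bar>m\<bar> + \<bar>x\<bar>)" using s by (intro mult_left_mono) auto
      then show "norm (exp (s * \<bar>x - m\<bar>)) \<le> norm (exp (s * \<bar>m\<bar>) * exp (s * \<bar>x\<bar>))"
        by (simp add: algebra_simps flip: exp_add)
    qed
  qed auto
  have E0: "expectation (\<lambda>x. x - m) = 0" using IX by (simp add: prob_space m_def mean_def)
  define G where "G h = expectation (\<lambda>x. exp (h * (x - m)))" for h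
  obtain C where C: "0 < C" and *: "\<And>h. \<bar>h\<bar> \<le> s / 2 \<Longrightarrow>
      integrable P (\<lambda>x. exp (h * (x - m))) \<and> 1 \<le> G h \<and> G h \<le> 1 + C * h\<^sup>2 \<and>
      integrable P (\<lambda>x. (1 + \<bar>x - m\<bar>) * \<bar>exp (h * (x - m)) / G h - 1 - h * (x - m)\<bar>) \<and>
      expectation (\<lambda>x. (1 + \<bar>x - m\<bar>) * \<bar>exp (h * (x - m)) / G h - 1 - h * (x - m)\<bar>) \<le> C * h\<^sup>2"
    unfolding G_def using exp_tilt_expansion[OF _ s I' E0] by auto
  have eq: "exp (h * (x - m)) = exp (h * x) / exp (h * m)" for h x
    by (simp add: algebra_simps exp_diff)
  have nat: "\<theta> + h \<in> natural_params \<mu>" if h: "\<bar>h\<bar> \<le> s / 2" for h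
    using *[OF h] unfolding natural_params_shift[OF R \<theta>] P_def[symmetric] by (simp add: eq divide_inverse)
  have AG: "exp (log_partition \<mu> (\<theta> + h) - log_partition \<mu> \<theta>) = exp (h * m) * G h" if h: "\<bar>h\<bar> \<le> s / 2" for h
    unfolding natural_params_shift(2)[OF R \<theta> nat[OF h]] P_def[symmetric] G_def by (simp add: eq)
  have A: "log_partition \<mu> (\<theta> + h) - log_partition \<mu> \<theta> - h * m = ln (G h)" if h: "\<bar>h\<bar> \<le> s / 2" for h
  proof -
    have "G h = exp (log_partition \<mu> (\<theta> + h) - log_partition \<mu> \<theta> - h * m)"
      using AG[OF h] by (simp add: exp_diff)
    then show ?thesis by simp
  qed
  show thesis
  proof (rule that[of "s / 2" C])
    show "0 < s / 2" "0 < C" using s C by auto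
    show "\<theta> + h \<in> natural_params \<mu>" if "\<bar>h\<bar> \<le> s / 2" for h using nat that .
    show "0 \<le> log_partition \<mu> (\<theta> + h) - log_partition \<mu> \<theta> - h * m \<and>
            log_partition \<mu> (\<theta> + h) - log_partition \<mu> \<theta> - h * m \<le> C * h\<^sup>2" if h: "\<bar>h\<bar> \<le> s / 2" for h
    proof -
      have "ln (G h) \<le> G h - 1" using *[OF h] by (intro ln_le_minus_one) auto
      then show ?thesis unfolding A[OF h] using *[OF h] by auto
    qed
    fix h \<phi> assume h: "\<bar>h\<bar> \<le> s / 2" and \<phi>[measurable]: "\<phi> \<in> borel_measurable borel"
      and le: "\<And>x. \<bar>\<phi> x\<bar> \<le> 1 + \<bar>x - m\<bar>"
    define L where "L x = exp (h * (x - m)) / G h" for x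
    have [measurable]: "L \<in> borel_measurable borel" unfolding L_def by simp
    have L: "exp ((\<theta> + h - \<theta>) * x - (log_partition \<mu> (\<theta> + h) - log_partition \<mu> \<theta>)) = L x" for x
      using AG[OF h] by (simp add: L_def exp_diff eq)
    define r where "r x = \<phi> x * (L x - 1 - h * (x - m))" for x
    have [measurable]: "r \<in> borel_measurable borel" unfolding r_def by measurable
    have rle: "\<bar>r x\<bar> \<le> (1 + \<bar>x - m\<bar>) * \<bar>L x - 1 - h * (x - m)\<bar>" for x
      unfolding r_def abs_mult using le by (intro mult_right_mono) auto
    have IW: "integrable P (\<lambda>x. (1 + \<bar>x - m\<bar>) * \<bar>L x - 1 - h * (x - m)\<bar>)"
      and EW: "expectation (\<lambda>x. (1 + \<bar>x - m\<bar>) * \<bar>L x - 1 - h * (x - m)\<bar>) \<le> C * h\<^sup>2"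
      using *[OF h] unfolding L_def by blast+
    have Ir: "integrable P r"
    proof (rule Bochner_Integration.integrable_bound[OF IW])
      show "AE x in P. norm (r x) \<le> norm ((1 + \<bar>x - m\<bar>) * \<bar>L x - 1 - h * (x - m)\<bar>)"
        using rle by (intro AE_I2) (simp add: abs_mult)
    qed simp
    have I\<phi>: "integrable P \<phi>"
    proof (rule Bochner_Integration.integrable_bound)
      show "integrable P (\<lambda>x. 1 + \<bar>x - m\<bar>)" using IX by auto
      show "AE x in P. norm (\<phi> x) \<le> norm (1 + \<bar>x - m\<bar>)" using le by (intro AE_I2) simp
    qed simp
    have I2: "integrable P (\<lambda>x. \<phi> x * (x - m))"
    proof (rule Bochner_Integration.integrable_bound)
      show "integrable P (\<lambda>x. \<bar>x - m\<bar> + (x - m)\<^sup>2)" using IX by (intro Bochner_Integration.integrable_add integrable_abs) auto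
      show "AE x in P. norm (\<phi> x * (x - m)) \<le> norm (\<bar>x - m\<bar> + (x - m)\<^sup>2)"
      proof (rule AE_I2)
        fix x
        have "\<bar>\<phi> x * (x - m)\<bar> \<le> (1 + \<bar>x - m\<bar>) * \<bar>x - m\<bar>" unfolding abs_mult using le by (intro mult_right_mono) auto
        then show "norm (\<phi> x * (x - m)) \<le> norm (\<bar>x - m\<bar> + (x - m)\<^sup>2)"
          by (simp add: algebra_simps power2_eq_square)
      qed
    qed simp
    have "(\<integral>x. \<phi> x \<partial>exp_member \<mu> (\<theta> + h)) = (\<integral>x. L x * \<phi> x \<partial>P)"
      using exp_member_change(2)[OF R \<theta> nat[OF h] \<phi>] unfolding L P_def by simp
    also have "\<dots> = (\<integral>x. r x + \<phi> x + h * (\<phi> x * (x - m)) \<partial>P)"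
      by (simp add: r_def algebra_simps)
    also have "\<dots> = (\<integral>x. r x \<partial>P) + (\<integral>x. \<phi> x \<partial>P) + h * (\<integral>x. \<phi> x * (x - m) \<partial>P)"
      using Ir I\<phi> I2 by (subst Bochner_Integration.integral_add) auto
    finally have "(\<integral>x. \<phi> x \<partial>exp_member \<mu> (\<theta> + h)) - (\<integral>x. \<phi> x \<partial>P) - h * (\<integral>x. \<phi> x * (x - m) \<partial>P) = (\<integral>x. r x \<partial>P)"
      by simp
    moreover have "\<bar>\<integral>x. r x \<partial>P\<bar> \<le> C * h\<^sup>2"
    proof -
      have "\<bar>\<integral>x. r x \<partial>P\<bar> \<le> (\<integral>x. \<bar>r x\<bar> \<partial>P)" by (rule integral_abs_bound)
      also have "\<dots> \<le> (\<integral>x. (1 + \<bar>x - m\<bar>) * \<bar>L x - 1 - h * (x - m)\<bar> \<partial>P)"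
        by (rule integral_mono[OF integrable_abs[OF Ir] IW rle])
      also have "\<dots> \<le> C * h\<^sup>2" by (rule EW)
      finally show ?thesis .
    qed
    ultimately show "\<bar>(\<integral>x. \<phi> x \<partial>exp_member \<mu> (\<theta> + h)) - (\<integral>x. \<phi> x \<partial>P) - h * (\<integral>x. \<phi> x * (x - m) \<partial>P)\<bar> \<le> C * h\<^sup>2"
      by simp
  qed
qed

lemma deriv_log_partition:
  assumes R: "regular_minimal_family \<mu>" and \<theta>: "\<theta> \<in> natural_params \<mu>"
  shows "deriv (log_partition \<mu>) \<theta> = mean (exp_member \<mu> \<theta>)"
proof (rule DERIV_imp_deriv)
  let ?A = "log_partition \<mu>" and ?m = "mean (exp_member \<mu> \<theta>)"
  obtain s C where s: "0 < s" "0 < C"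
    and A: "\<And>h. \<bar>h\<bar> \<le> s \<Longrightarrow> 0 \<le> ?A (\<theta> + h) - ?A \<theta> - h * ?m \<and> ?A (\<theta> + h) - ?A \<theta> - h * ?m \<le> C * h\<^sup>2"
    by (rule exp_family_expansion[OF R \<theta>]) blast
  have "((\<lambda>h. (?A (\<theta> + h) - ?A \<theta>) / h - ?m) \<longlongrightarrow> 0) (at 0)"
  proof (rule Lim_null_comparison)
    have "\<forall>\<^sub>F h in at 0. h \<noteq> 0 \<and> \<bar>h\<bar> < s"
      using s(1) by (auto simp: eventually_at dist_real_def)
    then show "\<forall>\<^sub>F h in at 0. norm ((?A (\<theta> + h) - ?A \<theta>) / h - ?m) \<le> C * \<bar>h\<bar>"
    proof eventually_elim
      case (elim h)
      have "\<bar>(?A (\<theta> + h) - ?A \<theta>) / h - ?m\<bar> = \<bar>?A (\<theta> + h) - ?A \<theta> - h * ?m\<bar> / \<bar>h\<bar>"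
        using elim by (simp add: field_simps flip: abs_divide)
      also have "\<dots> \<le> C * h\<^sup>2 / \<bar>h\<bar>" using A[of h] elim by (intro divide_right_mono) auto
      also have "\<dots> = C * \<bar>h\<bar>" using elim by (simp add: power2_eq_square field_simps abs_if)
      finally show ?case by simp
    qed
    show "((\<lambda>h. C * \<bar>h\<bar>) \<longlongrightarrow> 0) (at 0)" by (auto intro!: tendsto_eq_intros)
  qed
  then have "((\<lambda>h. (?A (\<theta> + h) - ?A \<theta>) / h) \<longlongrightarrow> ?m) (at 0)" by (subst Lim_null)
  then show "DERIV ?A \<theta> :> ?m" by (simp add: DERIV_def)
qed

text \<open>The gap is \<open>ln (E\<^sub>\<theta>[exp (h * (X - m))])\<close>, and \<open>1 + y < exp y\<close> off \<open>y = 0\<close>; it could vanish only if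
\<open>X\<close> were constant under \<open>P\<^sub>\<theta>\<close>.\<close>

lemma log_partition_strict_tangent:
  assumes R: "regular_minimal_family \<mu>" and \<theta>: "\<theta> \<in> natural_params \<mu>" "\<theta>' \<in> natural_params \<mu>" and ne: "\<theta>' \<noteq> \<theta>"
  shows "(\<theta>' - \<theta>) * mean (exp_member \<mu> \<theta>) < log_partition \<mu> \<theta>' - log_partition \<mu> \<theta>"
proof -
  define P where "P = exp_member \<mu> \<theta>"
  define m where "m = mean P"
  define h where "h = \<theta>' - \<theta>"
  interpret prob_space P unfolding P_def by (rule prob_exp_member[OF R \<theta>(1)])
  have sP[measurable_cong]: "sets P = sets borel" using R by (simp add: P_def regular_minimal_family_def)
  have IX: "integrable P (\<lambda>x. x)" unfolding P_def by (rule integrable_poly_exp_member[OF R \<theta>(1)])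
  have th: "\<theta>' = \<theta> + h" by (simp add: h_def)
  have eq: "exp (h * (x - m)) = exp (h * x) / exp (h * m)" for x
    by (simp add: algebra_simps exp_diff)
  have I: "integrable P (\<lambda>x. exp (h * (x - m)))"
    using \<theta>(2) unfolding th natural_params_shift[OF R \<theta>(1)] P_def[symmetric] by (simp add: eq)
  have I2: "integrable P (\<lambda>x. exp (h * (x - m)) - 1 - h * (x - m))" using I IX by auto
  have nn: "0 \<le> exp y - 1 - y" for y :: real using exp_ge_add_one_self[of y] by linarith
  have "0 < (\<integral>x. exp (h * (x - m)) - 1 - h * (x - m) \<partial>P)"
  proof (rule ccontr)
    assume "\<not> ?thesis"
    moreover have "0 \<le> (\<integral>x. exp (h * (x - m)) - 1 - h * (x - m) \<partial>P)" using nn by (intro integral_nonneg_AE) auto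
    ultimately have "(\<integral>x. exp (h * (x - m)) - 1 - h * (x - m) \<partial>P) = 0" by linarith
    then have "AE x in P. exp (h * (x - m)) - 1 - h * (x - m) = 0"
      using nn I2 by (subst (asm) integral_nonneg_eq_0_iff_AE) auto
    then have "AE x in P. (x - m)\<^sup>2 = 0"
    proof eventually_elim
      case (elim x)
      have "h * (x - m) = 0"
      proof (rule ccontr)
        assume "h * (x - m) \<noteq> 0"
        then have "1 + h * (x - m) < exp (h * (x - m))" by (rule add_one_less_exp)
        with elim show False by simp
      qed
      then show ?case using ne by (simp add: h_def)
    qed
    then have "var P = 0" unfolding var_def m_def by (rule integral_eq_zero_AE)
    with R \<theta>(1) show False by (auto simp: regular_minimal_family_def P_def)
  qed
  also have "\<dots> = (\<integral>x. exp (h * (x - m)) \<partial>P) - 1"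
    using I IX by (simp add: prob_space m_def mean_def)
  also have "(\<integral>x. exp (h * (x - m)) \<partial>P) = exp (log_partition \<mu> \<theta>' - log_partition \<mu> \<theta> - h * m)"
    using natural_params_shift(2)[OF R \<theta>(1), of h] \<theta>(2) unfolding th P_def[symmetric]
    by (simp add: eq exp_diff)
  finally have "1 < exp (log_partition \<mu> \<theta>' - log_partition \<mu> \<theta> - h * m)" by simp
  then have "0 < log_partition \<mu> \<theta>' - log_partition \<mu> \<theta> - h * m" by simp
  then show ?thesis by (simp add: h_def m_def P_def)
qed

text \<open>The cross entropy under \<open>P\<close> at \<open>t\<close> is the log-partition function minus \<open>t * mean P\<close>. Strict
convexity makes the minimizer unique, so the choice made by the argmin operator is forced.\<close>

lemma param_of_eq:
  assumes R: "regular_minimal_family \<mu>" and \<theta>: "\<theta> \<in> natural_params \<mu>"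
    and P: "prob_space P" "integrable P (\<lambda>x. x)" "mean P = mean (exp_member \<mu> \<theta>)"
  shows "param_of \<mu> P = \<theta>"
proof -
  interpret prob_space P by fact
  define F where "F t = (\<integral>x. - ln (exp_density \<mu> t x) \<partial>P)" for t
  have F: "F t = log_partition \<mu> t - t * mean P" for t
    using P(2) by (simp add: F_def exp_density_def prob_space mean_def)
  have lt: "F \<theta> < F t" if "t \<in> natural_params \<mu>" "t \<noteq> \<theta>" for t
    using log_partition_strict_tangent[OF R \<theta> that] by (simp add: F P(3) algebra_simps)
  have "arg_min F (\<lambda>t. t \<in> natural_params \<mu>) = \<theta>"
    unfolding arg_min_def
  proof (rule some_equality)
    show "is_arg_min F (\<lambda>t. t \<in> natural_params \<mu>) \<theta>"
      using \<theta> lt by (auto simp: is_arg_min_def) (metis less_asym)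
    show "t = \<theta>" if "is_arg_min F (\<lambda>t. t \<in> natural_params \<mu>) t" for t
      using that \<theta> lt by (auto simp: is_arg_min_def)
  qed
  then show ?thesis unfolding param_of_def arg_min_on_def F_def[abs_def] .
qed

lemma param_of_exp_member:
  assumes "regular_minimal_family \<mu>" "\<theta> \<in> natural_params \<mu>"
  shows "param_of \<mu> (exp_member \<mu> \<theta>) = \<theta>"
  using param_of_eq[OF assms prob_exp_member[OF assms] integrable_poly_exp_member(1)[OF assms]] by simp

text \<open>Monotone likelihood ratio. The density \<open>L\<close> of \<open>P\<^bsub>\<theta>'\<^esub>\<close> with respect to \<open>P\<^sub>\<theta>\<close> is increasing, so
either it is at least \<open>1\<close> on the whole upper tail, or at most \<open>1\<close> on the whole lower tail.\<close>

lemma upper_tail_mono: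
  assumes R: "regular_minimal_family \<mu>" and \<theta>: "\<theta> \<in> natural_params \<mu>" "\<theta>' \<in> natural_params \<mu>" and le: "\<theta> \<le> \<theta>'"
  shows "measure (exp_member \<mu> \<theta>) {m<..} \<le> measure (exp_member \<mu> \<theta>') {m<..}"
proof -
  let ?P = "exp_member \<mu> \<theta>" and ?P' = "exp_member \<mu> \<theta>'"
  define L where "L x = exp ((\<theta>' - \<theta>) * x - (log_partition \<mu> \<theta>' - log_partition \<mu> \<theta>))" for x
  interpret P: prob_space ?P by (rule prob_exp_member[OF R \<theta>(1)])
  interpret P': prob_space ?P' by (rule prob_exp_member[OF R \<theta>(2)])
  have sP[measurable_cong]: "sets ?P = sets borel" "sets ?P' = sets borel" using R by (simp_all add: regular_minimal_family_def)
  have [simp]: "space ?P = UNIV" "space ?P' = UNIV" using sP[THEN sets_eq_imp_space_eq] by simp_all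
  have L: "L x \<le> L y" if "x \<le> y" for x y
    using that le by (simp add: L_def mult_left_mono)
  have ch: "measure ?P' A = (\<integral>x. L x * indicator A x \<partial>?P)" "integrable ?P (\<lambda>x. L x * indicator A x)"
    if [measurable]: "A \<in> sets borel" for A
  proof -
    have "measure ?P' A = (\<integral>x. indicator A x \<partial>?P')" using that by (simp add: sP)
    also have "\<dots> = (\<integral>x. L x * indicator A x \<partial>?P)"
      unfolding L_def by (rule exp_member_change(2)[OF R \<theta>]) simp
    finally show "measure ?P' A = (\<integral>x. L x * indicator A x \<partial>?P)" .
    show "integrable ?P (\<lambda>x. L x * indicator A x)"
      unfolding L_def using P'.emeasure_finite[of A] that sets_base_measure[OF R]
      by (subst exp_member_change(1)[OF R \<theta>, symmetric]) (auto simp: integrable_indicator_iff less_top[symmetric])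
  qed
  show ?thesis
  proof (cases "1 \<le> L m")
    case True
    have "measure ?P {m<..} = (\<integral>x. indicator {m<..} x \<partial>?P)" by simp
    also have "\<dots> \<le> (\<integral>x. L x * indicator {m<..} x \<partial>?P)"
      using ch(2)[of "{m<..}"] True L
      by (intro integral_mono) (auto simp: sets_base_measure[OF R] integrable_indicator_iff P.emeasure_finite less_top[symmetric] intro: order_trans[OF True L] split: split_indicator)
    finally show ?thesis by (simp add: ch(1))
  next
    case False
    have "measure ?P' {..m} = (\<integral>x. L x * indicator {..m} x \<partial>?P)" by (simp add: ch(1))
    also have "\<dots> \<le> (\<integral>x. indicator {..m} x \<partial>?P)"
      using ch(2)[of "{..m}"] False L[of _ m]
      by (intro integral_mono) (auto simp: sets_base_measure[OF R] integrable_indicator_iff P.emeasure_finite less_top[symmetric] intro: order_trans[of _ "L m"] split: split_indicator)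
    finally have "measure ?P' {..m} \<le> measure ?P {..m}" by simp
    moreover have "- {m<..} = {..m}" by auto
    ultimately show ?thesis
      using P.prob_compl[of "{m<..}"] P'.prob_compl[of "{m<..}"] by (simp add: sets_base_measure[OF R] Compl_eq_Diff_UNIV)
  qed
qed

section \<open>Contraction by private channels\<close>


text \<open>The total variation norm of \<open>P\<^sub>1 - P\<^sub>0\<close> is at most \<open>T\<close>, tested on bounded functions so that no
dominating measure has to be chosen. For probability measures this norm is twice the usual total variation distance.\<close>

definition signed_dist_le :: "'a measure \<Rightarrow> 'a measure \<Rightarrow> real \<Rightarrow> bool" where
  "signed_dist_le P\<^sub>0 P\<^sub>1 T \<longleftrightarrow>
     (\<forall>\<phi>\<in>borel_measurable P\<^sub>0. \<forall>a. (\<forall>x\<in>space P\<^sub>0. \<bar>\<phi> x\<bar> \<le> a) \<longrightarrow> \<bar>(\<integral>x. \<phi> x \<partial>P\<^sub>1) - (\<integral>x. \<phi> x \<partial>P\<^sub>0)\<bar> \<le> a * T)"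

text \<open>The variational form of \<open>\<chi>\<^sup>2(P\<parallel>Q) \<le> K - 1\<close>, restricted to functions with values in the unit
interval.\<close>

definition variance_contraction :: "real \<Rightarrow> 'a measure \<Rightarrow> 'a measure \<Rightarrow> bool" where
  "variance_contraction K P Q \<longleftrightarrow>
     (\<forall>f\<in>borel_measurable Q. (\<forall>y\<in>space Q. 0 \<le> f y \<and> f y \<le> 1) \<longrightarrow>
        ((\<integral>y. f y \<partial>P) - (\<integral>y. f y \<partial>Q))\<^sup>2 \<le> (K - 1) * ((\<integral>y. (f y)\<^sup>2 \<partial>Q) - (\<integral>y. f y \<partial>Q)\<^sup>2))"

lemma (in prob_space) integrable_bounded_measurable:
  fixes f :: "'a \<Rightarrow> real"
  assumes "f \<in> borel_measurable M" "\<And>x. x \<in> space M \<Longrightarrow> \<bar>f x\<bar> \<le> b"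
  shows "integrable M f"
  using assms by (intro integrable_const_bound[where B = b]) auto

lemma (in prob_space) expectation_square_le:
  fixes f :: "'a \<Rightarrow> real"
  assumes "integrable M f" "integrable M (\<lambda>x. (f x)\<^sup>2)"
  shows "(expectation f)\<^sup>2 \<le> expectation (\<lambda>x. (f x)\<^sup>2)"
  using variance_eq[OF assms] variance_positive[of f] by linarith

text \<open>The inequality is sharpest at the shift \<open>t = d / (K - 1)\<close>.\<close>

lemma quadratic_optimize:
  fixes d v K :: real
  assumes K: "1 < K" and le: "\<And>t. (d + t)\<^sup>2 \<le> K * (v + t\<^sup>2)"
  shows "d\<^sup>2 \<le> (K - 1) * v"
proof -
  have "(d + d / (K - 1))\<^sup>2 \<le> K * (v + (d / (K - 1))\<^sup>2)" by (rule le)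
  then have "(K - 1)\<^sup>2 * (d + d / (K - 1))\<^sup>2 \<le> (K - 1)\<^sup>2 * (K * (v + (d / (K - 1))\<^sup>2))"
    by (intro mult_left_mono) auto
  also have "(K - 1)\<^sup>2 * (d + d / (K - 1))\<^sup>2 = (K * d)\<^sup>2"
    unfolding power_mult_distrib[symmetric] using K by (simp add: divide_simps) (simp add: algebra_simps)
  also have "(K - 1)\<^sup>2 * (K * (v + (d / (K - 1))\<^sup>2)) = K * ((K - 1)\<^sup>2 * v + d\<^sup>2)"
    using K by (simp add: field_simps)
  finally have "K * (K * d\<^sup>2) \<le> K * ((K - 1)\<^sup>2 * v + d\<^sup>2)" by (simp add: power2_eq_square mult_ac)
  then have "K * d\<^sup>2 \<le> (K - 1)\<^sup>2 * v + d\<^sup>2" using K by simp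
  then have "(K - 1) * d\<^sup>2 \<le> (K - 1) * ((K - 1) * v)" by (simp add: algebra_simps power2_eq_square)
  then show ?thesis using K by simp
qed

text \<open>Cauchy-Schwarz for the density \<open>dP/dQ\<close> gives only \<open>(E\<^sub>P g)\<^sup>2 \<le> exp e * E\<^sub>Q g\<^sup>2\<close>. Applied to
\<open>g = f - E\<^sub>Q f + t\<close> and optimized over the free shift \<open>t\<close>, it improves to the factor \<open>exp e - 1\<close>,
which vanishes with the privacy level.\<close>

lemma renyi2_variance_contraction:
  fixes P Q :: "'a measure"
  assumes P: "prob_space P" and Q: "prob_space Q" and s: "sets P = sets Q"
    and e: "0 < e" and R: "renyi2 P Q \<le> ereal e"
  shows "variance_contraction (exp e) P Q"
  unfolding variance_contraction_def
proof (intro ballI impI)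
  fix f :: "'a \<Rightarrow> real" assume f[measurable]: "f \<in> borel_measurable Q" and f01: "\<forall>y\<in>space Q. 0 \<le> f y \<and> f y \<le> 1"
  interpret P: prob_space P by fact
  interpret Q: prob_space Q by fact
  have sp: "space P = space Q" using s by (rule sets_eq_imp_space_eq)
  define r where "r = RN_deriv Q P"
  have r[measurable]: "r \<in> borel_measurable Q" unfolding r_def by simp
  define I where "I = (\<integral>\<^sup>+x. (r x)\<^sup>2 \<partial>Q)"
  have ac: "absolutely_continuous Q P" and If: "I < \<infinity>" and lnI: "ln (enn2real I) \<le> e"
    using R unfolding renyi2_def Let_def I_def r_def by (auto split: if_splits)
  have Ie: "I \<le> ennreal (exp e)"
  proof (cases "0 < enn2real I")
    case True
    then have "enn2real I \<le> exp e" using lnI by (metis exp_le_cancel_iff exp_ln)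
    then show ?thesis using If by (metis ennreal_enn2real ennreal_leI infinity_ennreal_def)
  next
    case False
    then have "enn2real I = 0" using enn2real_nonneg[of I] by linarith
    then have "I = 0" using If by (auto simp: enn2real_eq_0_iff)
    then show ?thesis by simp
  qed
  have CS: "(\<integral>x. g x \<partial>P)\<^sup>2 \<le> exp e * (\<integral>x. (g x)\<^sup>2 \<partial>Q)"
    if g[measurable]: "g \<in> borel_measurable Q" and gb: "\<And>x. x \<in> space Q \<Longrightarrow> \<bar>g x\<bar> \<le> b" for g b
  proof -
    have g': "g \<in> borel_measurable P" using g by (simp add: measurable_cong_sets[OF s])
    have I1: "integrable P g" using gb by (intro P.integrable_bounded_measurable[OF g', of b]) (simp add: sp)
    have gb2: "\<bar>(g x)\<^sup>2\<bar> \<le> b\<^sup>2" if "x \<in> space Q" for x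
      using gb[OF that] by (metis abs_power2 abs_ge_zero power_mono power2_abs)
    have I2: "integrable Q (\<lambda>x. (g x)\<^sup>2)" using gb2 by (intro Q.integrable_bounded_measurable) auto
    have "ennreal ((\<integral>x. \<bar>g x\<bar> \<partial>P)\<^sup>2) = (\<integral>\<^sup>+x. ennreal \<bar>g x\<bar> \<partial>P)\<^sup>2"
      using I1 by (subst nn_integral_eq_integral) (auto simp: ennreal_power)
    also have "(\<integral>\<^sup>+x. ennreal \<bar>g x\<bar> \<partial>P) = (\<integral>\<^sup>+x. r x * ennreal \<bar>g x\<bar> \<partial>Q)"
      unfolding r_def using ac s by (intro Q.RN_deriv_nn_integral) auto
    also have "\<dots>\<^sup>2 \<le> I * (\<integral>\<^sup>+x. (ennreal \<bar>g x\<bar>)\<^sup>2 \<partial>Q)"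
      unfolding I_def by (rule Cauchy_Schwarz_nn_integral) auto
    also have "\<dots> \<le> ennreal (exp e) * (\<integral>\<^sup>+x. (ennreal \<bar>g x\<bar>)\<^sup>2 \<partial>Q)"
      using Ie by (intro mult_right_mono) auto
    also have "(\<integral>\<^sup>+x. (ennreal \<bar>g x\<bar>)\<^sup>2 \<partial>Q) = ennreal (\<integral>x. (g x)\<^sup>2 \<partial>Q)"
      using I2 by (simp add: ennreal_power nn_integral_eq_integral)
    finally have "ennreal ((\<integral>x. \<bar>g x\<bar> \<partial>P)\<^sup>2) \<le> ennreal (exp e * (\<integral>x. (g x)\<^sup>2 \<partial>Q))"
      by (simp add: ennreal_mult)
    then have "(\<integral>x. \<bar>g x\<bar> \<partial>P)\<^sup>2 \<le> exp e * (\<integral>x. (g x)\<^sup>2 \<partial>Q)"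
      by (subst (asm) ennreal_le_iff) auto
    moreover have "(\<integral>x. g x \<partial>P)\<^sup>2 \<le> (\<integral>x. \<bar>g x\<bar> \<partial>P)\<^sup>2"
      using integral_abs_bound[of P g] by (metis abs_ge_zero power2_abs power_mono)
    ultimately show ?thesis by linarith
  qed
  define c where "c = (\<integral>y. f y \<partial>Q)"
  have If: "integrable Q f" "integrable Q (\<lambda>y. (f y)\<^sup>2)"
    using f01 by (auto intro!: Q.integrable_bounded_measurable[where b = 1] simp: power_le_one)
  have fP: "f \<in> borel_measurable P" using f by (simp add: measurable_cong_sets[OF s])
  have IP: "integrable P f"
    using f01 fP by (auto intro!: P.integrable_bounded_measurable[where b = 1] simp: sp)
  show "((\<integral>y. f y \<partial>P) - (\<integral>y. f y \<partial>Q))\<^sup>2 \<le> (exp e - 1) * ((\<integral>y. (f y)\<^sup>2 \<partial>Q) - (\<integral>y. f y \<partial>Q)\<^sup>2)"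
  proof (rule quadratic_optimize)
    show "1 < exp e" using e by simp
    fix t
    have "(\<integral>x. f x - c + t \<partial>P)\<^sup>2 \<le> exp e * (\<integral>x. (f x - c + t)\<^sup>2 \<partial>Q)"
    proof (rule CS)
      show "\<bar>f x - c + t\<bar> \<le> 1 + \<bar>c\<bar> + \<bar>t\<bar>" if "x \<in> space Q" for x using bspec[OF f01 that] by linarith
    qed simp
    also have "(\<integral>x. f x - c + t \<partial>P) = (\<integral>y. f y \<partial>P) - c + t" using IP by (simp add: P.prob_space)
    also have "(\<integral>x. (f x - c + t)\<^sup>2 \<partial>Q) = (\<integral>x. (f x)\<^sup>2 + 2 * (t - c) * f x + (t - c)\<^sup>2 \<partial>Q)"
      by (simp add: power2_eq_square algebra_simps)
    also have "\<dots> = (\<integral>x. (f x)\<^sup>2 \<partial>Q) - c\<^sup>2 + t\<^sup>2"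
      using If by (simp add: Q.prob_space c_def[symmetric] power2_eq_square algebra_simps)
    finally show "((\<integral>y. f y \<partial>P) - (\<integral>y. f y \<partial>Q) + t)\<^sup>2 \<le> exp e * ((\<integral>y. (f y)\<^sup>2 \<partial>Q) - (\<integral>y. f y \<partial>Q)\<^sup>2 + t\<^sup>2)"
      by (simp add: c_def)
  qed
qed

text \<open>Write \<open>\<phi> x\<close> for the expectation of \<open>f\<close> under the output law of \<open>x\<close>. Privacy and Jensen's
inequality confine \<open>\<phi>\<close> to within \<open>sqrt ((K - 1) * (S - c\<^sup>2))\<close> of its mean \<open>c\<close>, uniformly in the input,
where \<open>S\<close> is the second moment of \<open>f\<close> under the output law of \<open>P\<^sub>0\<close>. Changing the input law from \<open>P\<^sub>0\<close> to \<open>P\<^sub>1\<close>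
therefore moves the expectation of \<open>\<phi>\<close> by at most \<open>T\<close> times that: the privacy factor and the squared
\<open>L\<^sup>1\<close> distance multiply.\<close>

lemma private_mixture_contraction:
  fixes P\<^sub>0 P\<^sub>1 :: "'a measure" and f :: "'b \<Rightarrow> real"
  assumes P0: "prob_space P\<^sub>0" and P1: "prob_space P\<^sub>1" and s: "sets P\<^sub>1 = sets P\<^sub>0"
    and \<kappa>: "\<kappa> \<in> P\<^sub>0 \<rightarrow>\<^sub>M prob_algebra N" and K: "1 \<le> K"
    and contr: "\<And>x x'. x \<in> space P\<^sub>0 \<Longrightarrow> x' \<in> space P\<^sub>0 \<Longrightarrow> variance_contraction K (\<kappa> x) (\<kappa> x')"
    and T: "signed_dist_le P\<^sub>0 P\<^sub>1 T"
    and f[measurable]: "f \<in> borel_measurable N" and f01: "\<And>y. y \<in> space N \<Longrightarrow> 0 \<le> f y \<and> f y \<le> 1"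
  shows "(\<integral>x. \<integral>y. f y \<partial>\<kappa> x \<partial>P\<^sub>1)\<^sup>2 \<le> (1 + (K - 1) * T\<^sup>2) * (\<integral>x. \<integral>y. (f y)\<^sup>2 \<partial>\<kappa> x \<partial>P\<^sub>0)"
proof -
  interpret P0: prob_space P\<^sub>0 by fact
  interpret P1: prob_space P\<^sub>1 by fact
  have sp: "space P\<^sub>1 = space P\<^sub>0" using s by (rule sets_eq_imp_space_eq)
  define \<phi> where "\<phi> x = (\<integral>y. f y \<partial>\<kappa> x)" for x
  define \<psi> where "\<psi> x = (\<integral>y. (f y)\<^sup>2 \<partial>\<kappa> x)" for x
  note \<kappa>' = measurable_prob_algebraD[OF \<kappa>]
  have \<phi>m[measurable]: "\<phi> \<in> borel_measurable P\<^sub>0" unfolding \<phi>_def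
    by (rule measurable_compose[OF \<kappa>' integral_measurable_subprob_algebra]) simp
  have \<psi>m[measurable]: "\<psi> \<in> borel_measurable P\<^sub>0" unfolding \<psi>_def
    by (rule measurable_compose[OF \<kappa>' integral_measurable_subprob_algebra]) simp
  have \<kappa>x: "prob_space (\<kappa> x)" "sets (\<kappa> x) = sets N" if "x \<in> space P\<^sub>0" for x
    using measurable_space[OF \<kappa> that] by (auto simp: space_prob_algebra)
  have fx: "f \<in> borel_measurable (\<kappa> x)" if "x \<in> space P\<^sub>0" for x
    using f by (simp add: measurable_cong_sets[OF \<kappa>x(2)[OF that] refl])
  have f01x: "0 \<le> f y \<and> f y \<le> 1" if "x \<in> space P\<^sub>0" "y \<in> space (\<kappa> x)" for x y
    using f01 that sets_eq_imp_space_eq[OF \<kappa>x(2)[OF that(1)]] by simp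
  have b: "0 \<le> \<phi> x \<and> \<phi> x \<le> 1" "0 \<le> \<psi> x \<and> \<psi> x \<le> 1" if x: "x \<in> space P\<^sub>0" for x
  proof -
    interpret X: prob_space "\<kappa> x" using \<kappa>x(1)[OF x] .
    have [measurable]: "f \<in> borel_measurable (\<kappa> x)" using fx[OF x] .
    show "0 \<le> \<phi> x \<and> \<phi> x \<le> 1" unfolding \<phi>_def using f01x[OF x]
      by (auto intro!: integral_nonneg_AE AE_I2 X.integral_le_const X.integrable_bounded_measurable[where b = 1])
    show "0 \<le> \<psi> x \<and> \<psi> x \<le> 1" unfolding \<psi>_def using f01x[OF x]
      by (auto intro!: integral_nonneg_AE AE_I2 X.integral_le_const X.integrable_bounded_measurable[where b = 1] simp: power_le_one)
  qed
  have I0: "integrable P\<^sub>0 \<phi>" "integrable P\<^sub>0 \<psi>" "integrable P\<^sub>0 (\<lambda>x. (\<phi> x)\<^sup>2)"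
    using b by (auto intro!: P0.integrable_bounded_measurable[where b = 1] simp: power_le_one)
  have \<phi>1[measurable]: "\<phi> \<in> borel_measurable P\<^sub>1" using \<phi>m by (simp add: measurable_cong_sets[OF s refl])
  have I1: "integrable P\<^sub>1 \<phi>"
    using b by (auto intro!: P1.integrable_bounded_measurable[where b = 1] simp: sp)
  define c where "c = (\<integral>x. \<phi> x \<partial>P\<^sub>0)"
  define S where "S = (\<integral>x. \<psi> x \<partial>P\<^sub>0)"
  define d where "d = (\<integral>x. \<phi> x \<partial>P\<^sub>1) - c"
  define a where "a = sqrt ((K - 1) * (S - c\<^sup>2))"
  have pt: "(\<phi> x - c)\<^sup>2 \<le> (K - 1) * (S - c\<^sup>2)" if x: "x \<in> space P\<^sub>0" for x
  proof -
    have Id: "integrable P\<^sub>0 (\<lambda>x'. (\<phi> x - \<phi> x')\<^sup>2)"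
    proof (rule P0.integrable_bounded_measurable[where b = 1])
      fix x' assume "x' \<in> space P\<^sub>0"
      then have "\<bar>\<phi> x - \<phi> x'\<bar> \<le> 1" using b(1)[OF x] b(1)[of x'] by linarith
      then show "\<bar>(\<phi> x - \<phi> x')\<^sup>2\<bar> \<le> 1" by (simp add: abs_square_le_1)
    qed simp
    have "(\<phi> x - c)\<^sup>2 = (\<integral>x'. \<phi> x - \<phi> x' \<partial>P\<^sub>0)\<^sup>2" using I0 by (simp add: c_def P0.prob_space)
    also have "\<dots> \<le> (\<integral>x'. (\<phi> x - \<phi> x')\<^sup>2 \<partial>P\<^sub>0)"
      using I0 Id by (intro P0.expectation_square_le) auto
    also have "\<dots> \<le> (\<integral>x'. (K - 1) * (\<psi> x' - (\<phi> x')\<^sup>2) \<partial>P\<^sub>0)"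
    proof (rule integral_mono[OF Id])
      show "integrable P\<^sub>0 (\<lambda>x'. (K - 1) * (\<psi> x' - (\<phi> x')\<^sup>2))" using I0 by auto
      fix x' assume x': "x' \<in> space P\<^sub>0"
      show "(\<phi> x - \<phi> x')\<^sup>2 \<le> (K - 1) * (\<psi> x' - (\<phi> x')\<^sup>2)"
        using contr[OF x x'] fx[OF x'] f01x[OF x'] unfolding variance_contraction_def \<phi>_def \<psi>_def by blast
    qed
    also have "\<dots> = (K - 1) * (S - (\<integral>x. (\<phi> x)\<^sup>2 \<partial>P\<^sub>0))" using I0 by (simp add: S_def)
    also have "\<dots> \<le> (K - 1) * (S - c\<^sup>2)"
      using K P0.expectation_square_le[OF I0(1,3)] by (intro mult_left_mono) (auto simp: c_def)
    finally show ?thesis .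
  qed
  obtain x0 where x0: "x0 \<in> space P\<^sub>0" using P0.not_empty by blast
  have pos: "0 \<le> (K - 1) * (S - c\<^sup>2)" using pt[OF x0] by (rule order_trans[OF zero_le_power2])
  have "\<bar>(\<integral>x. \<phi> x - c \<partial>P\<^sub>1) - (\<integral>x. \<phi> x - c \<partial>P\<^sub>0)\<bar> \<le> a * T"
  proof -
    have "\<forall>x\<in>space P\<^sub>0. \<bar>\<phi> x - c\<bar> \<le> a" using pt unfolding a_def by (auto intro!: real_le_rsqrt)
    then show ?thesis using T unfolding signed_dist_le_def by fastforce
  qed
  also have "(\<integral>x. \<phi> x - c \<partial>P\<^sub>1) - (\<integral>x. \<phi> x - c \<partial>P\<^sub>0) = d"
    using I0 I1 by (simp add: d_def c_def P0.prob_space P1.prob_space)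
  finally have "d\<^sup>2 \<le> (a * T)\<^sup>2" by (metis abs_ge_zero power2_abs power_mono)
  also have "\<dots> = (K - 1) * T\<^sup>2 * (S - c\<^sup>2)" using pos by (simp add: power_mult_distrib a_def mult_ac)
  finally have d2: "d\<^sup>2 \<le> (K - 1) * T\<^sup>2 * (S - c\<^sup>2)" .
  define \<delta> where "\<delta> = (K - 1) * T\<^sup>2"
  have \<delta>: "0 \<le> \<delta>" using K by (simp add: \<delta>_def)
  have "c\<^sup>2 \<le> S"
  proof -
    have "c\<^sup>2 \<le> (\<integral>x. (\<phi> x)\<^sup>2 \<partial>P\<^sub>0)" unfolding c_def using P0.expectation_square_le I0 by blast
    also have "\<dots> \<le> S" unfolding S_def
    proof (intro integral_mono I0)
      fix x assume x: "x \<in> space P\<^sub>0"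
      interpret X: prob_space "\<kappa> x" using \<kappa>x(1)[OF x] .
      have [measurable]: "f \<in> borel_measurable (\<kappa> x)" using fx[OF x] .
      show "(\<phi> x)\<^sup>2 \<le> \<psi> x" unfolding \<phi>_def \<psi>_def using f01x[OF x]
        by (intro X.expectation_square_le)
          (auto intro!: X.integrable_bounded_measurable[where b = 1] simp: power_le_one)
    qed
    finally show ?thesis .
  qed
  \<comment> \<open>From \<open>d\<^sup>2 \<le> \<delta> * (S - c\<^sup>2)\<close> by completing a square.\<close>
  have "(c + d)\<^sup>2 \<le> (1 + \<delta>) * S"
  proof (cases "\<delta> = 0")
    case True
    then show ?thesis using d2 \<open>c\<^sup>2 \<le> S\<close> by (simp add: \<delta>_def[symmetric])
  next
    case False
    then have dp: "0 < \<delta>" using \<delta> by simp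
    have "d\<^sup>2 / \<delta> \<le> S - c\<^sup>2" using d2 dp by (simp add: \<delta>_def[symmetric] field_simps)
    then have "(1 + \<delta>) * (c\<^sup>2 + d\<^sup>2 / \<delta>) \<le> (1 + \<delta>) * S" using dp by (intro mult_left_mono) auto
    moreover have "(1 + \<delta>) * (c\<^sup>2 + d\<^sup>2 / \<delta>) - (c + d)\<^sup>2 = (\<delta> * c - d)\<^sup>2 / \<delta>"
      using dp by (simp add: field_simps power2_eq_square)
    moreover have "0 \<le> (\<delta> * c - d)\<^sup>2 / \<delta>" using dp by simp
    ultimately show ?thesis by linarith
  qed
  then show ?thesis by (simp add: d_def \<delta>_def S_def \<psi>_def \<phi>_def)
qed

definition next_output :: "channel \<Rightarrow> real measure \<Rightarrow> nat \<Rightarrow> (nat \<Rightarrow> real) \<Rightarrow> (nat \<Rightarrow> real) measure" where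
  "next_output Q P i z = P \<bind> (\<lambda>x. Q i x z \<bind> (\<lambda>y. return (histories (Suc i)) (z(i := y))))"

lemma next_output_measurable:
  assumes Q: "is_channel n Q" "i < n" and P: "prob_space P" "sets P = sets borel"
  shows "next_output Q P i \<in> histories i \<rightarrow>\<^sub>M prob_algebra (histories (Suc i))"
proof -
  have up: "(\<lambda>(z, y). z(i := y)) \<in> histories i \<Otimes>\<^sub>M borel \<rightarrow>\<^sub>M histories (Suc i)"
    unfolding lessThan_Suc using measurable_add_dim[of i "{..<i}" "\<lambda>_. borel"] by simp
  have Qm: "(\<lambda>(x, z). Q i x z) \<in> borel \<Otimes>\<^sub>M histories i \<rightarrow>\<^sub>M prob_algebra borel"
    using Q by (simp add: is_channel_def)
  have Pm: "(\<lambda>_. P) \<in> histories i \<rightarrow>\<^sub>M prob_algebra borel"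
    using P by (intro measurable_const) (simp add: space_prob_algebra)
  have 1: "(\<lambda>p. Q i (snd p) (fst p)) \<in> histories i \<Otimes>\<^sub>M borel \<rightarrow>\<^sub>M prob_algebra borel"
    using measurable_compose[OF measurable_Pair[OF measurable_snd measurable_fst] Qm] by simp
  have 2: "(\<lambda>(p, y). return (histories (Suc i)) ((fst p)(i := y)))
      \<in> (histories i \<Otimes>\<^sub>M (borel :: real measure)) \<Otimes>\<^sub>M borel \<rightarrow>\<^sub>M prob_algebra (histories (Suc i))"
  proof -
    have q: "(\<lambda>q. (fst (fst q), snd q)) \<in> (histories i \<Otimes>\<^sub>M (borel::real measure)) \<Otimes>\<^sub>M (borel::real measure) \<rightarrow>\<^sub>M histories i \<Otimes>\<^sub>M borel"
      by measurable
    from measurable_compose[OF measurable_compose[OF q up] measurable_return_prob_space]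
    show ?thesis by (simp add: case_prod_unfold)
  qed
  have 3: "(\<lambda>(z, x). Q i x z \<bind> (\<lambda>y. return (histories (Suc i)) (z(i := y))))
      \<in> histories i \<Otimes>\<^sub>M borel \<rightarrow>\<^sub>M prob_algebra (histories (Suc i))"
    using measurable_bind_prob_space2[OF 1 2] by (simp add: case_prod_unfold)
  show ?thesis unfolding next_output_def[abs_def] by (rule measurable_bind_prob_space2[OF Pm 3])
qed

lemma output_law_prob:
  assumes Q: "is_channel n Q" and P: "prob_space P" "sets P = sets borel" and i: "i \<le> n"
  shows "output_law Q P i \<in> space (prob_algebra (histories i))"
  using i
proof (induction i)
  case 0
  then show ?case by (auto simp: space_prob_algebra space_PiM intro!: prob_space_return)
next
  case (Suc i)
  then have "output_law Q P i \<in> space (prob_algebra (histories i))" by simp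
  from prob_space_bind'[OF this next_output_measurable[OF Q _ P]] sets_bind'[OF this next_output_measurable[OF Q _ P]] Suc(2)
  show ?case by (simp add: space_prob_algebra next_output_def[abs_def])
qed

lemma
  assumes Q: "is_channel n Q" "i < n" and z: "z \<in> space (histories i)"
  shows measurable_append: "(\<lambda>y. z(i := y)) \<in> borel \<rightarrow>\<^sub>M histories (Suc i)"
    and channel_section: "(\<lambda>x. Q i x z) \<in> borel \<rightarrow>\<^sub>M prob_algebra borel"
    and measurable_return_append:
      "(\<lambda>y. return (histories (Suc i)) (z(i := y))) \<in> borel \<rightarrow>\<^sub>M prob_algebra (histories (Suc i))"
    and measurable_output_append:
      "(\<lambda>x. Q i x z \<bind> (\<lambda>y. return (histories (Suc i)) (z(i := y)))) \<in> borel \<rightarrow>\<^sub>M prob_algebra (histories (Suc i))"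
proof -
  have up: "(\<lambda>(z, y). z(i := y)) \<in> histories i \<Otimes>\<^sub>M borel \<rightarrow>\<^sub>M histories (Suc i)"
    unfolding lessThan_Suc using measurable_add_dim[of i "{..<i}" "\<lambda>_. borel"] by simp
  show upz: "(\<lambda>y. z(i := y)) \<in> borel \<rightarrow>\<^sub>M histories (Suc i)"
    using measurable_compose[OF measurable_Pair1'[OF z] up] by simp
  have Qm: "(\<lambda>(x, z). Q i x z) \<in> borel \<Otimes>\<^sub>M histories i \<rightarrow>\<^sub>M prob_algebra borel"
    using Q by (simp add: is_channel_def)
  show Qz: "(\<lambda>x. Q i x z) \<in> borel \<rightarrow>\<^sub>M prob_algebra borel"
    using measurable_compose[OF measurable_Pair2'[OF z] Qm] by simp
  show r: "(\<lambda>y. return (histories (Suc i)) (z(i := y))) \<in> borel \<rightarrow>\<^sub>M prob_algebra (histories (Suc i))"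
    by (rule measurable_compose[OF upz measurable_return_prob_space])
  show "(\<lambda>x. Q i x z \<bind> (\<lambda>y. return (histories (Suc i)) (z(i := y)))) \<in> borel \<rightarrow>\<^sub>M prob_algebra (histories (Suc i))"
    by (rule measurable_bind_prob_space[OF Qz r])
qed

lemma nn_integral_output_law_Suc:
  assumes Q: "is_channel n Q" "i < n" and P: "prob_space P" "sets P = sets borel"
    and f[measurable]: "f \<in> borel_measurable (histories (Suc i))"
  shows "(\<integral>\<^sup>+z'. f z' \<partial>output_law Q P (Suc i)) = (\<integral>\<^sup>+z. \<integral>\<^sup>+x. \<integral>\<^sup>+y. f (z(i := y)) \<partial>Q i x z \<partial>P \<partial>output_law Q P i)"
proof -
  have o: "sets (output_law Q P i) = sets (histories i)"
    using output_law_prob[OF Q(1) P, of i] Q(2) by (simp add: space_prob_algebra)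
  have "(\<integral>\<^sup>+z'. f z' \<partial>output_law Q P (Suc i)) = (\<integral>\<^sup>+z. \<integral>\<^sup>+z'. f z' \<partial>next_output Q P i z \<partial>output_law Q P i)"
    using measurable_prob_algebraD[OF next_output_measurable[OF Q P]]
    unfolding output_law.simps next_output_def[symmetric]
    by (intro nn_integral_bind[OF f]) (simp add: measurable_cong_sets[OF o refl])
  also have "\<dots> = (\<integral>\<^sup>+z. \<integral>\<^sup>+x. \<integral>\<^sup>+y. f (z(i := y)) \<partial>Q i x z \<partial>P \<partial>output_law Q P i)"
  proof (rule nn_integral_cong)
    fix z assume "z \<in> space (output_law Q P i)"
    then have z: "z \<in> space (histories i)" using sets_eq_imp_space_eq[OF o] by simp
    have "(\<integral>\<^sup>+z'. f z' \<partial>next_output Q P i z)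
        = (\<integral>\<^sup>+x. \<integral>\<^sup>+z'. f z' \<partial>(Q i x z \<bind> (\<lambda>y. return (histories (Suc i)) (z(i := y)))) \<partial>P)"
      unfolding next_output_def using measurable_prob_algebraD[OF measurable_output_append[OF Q z]]
      by (intro nn_integral_bind[OF f]) (simp add: measurable_cong_sets[OF P(2) refl])
    also have "\<dots> = (\<integral>\<^sup>+x. \<integral>\<^sup>+y. f (z(i := y)) \<partial>Q i x z \<partial>P)"
    proof (rule nn_integral_cong)
      fix x
      have sx: "sets (Q i x z) = sets borel"
        using measurable_space[OF channel_section[OF Q z], of x] by (simp add: space_prob_algebra)
      have "(\<integral>\<^sup>+z'. f z' \<partial>(Q i x z \<bind> (\<lambda>y. return (histories (Suc i)) (z(i := y)))))
          = (\<integral>\<^sup>+y. \<integral>\<^sup>+z'. f z' \<partial>return (histories (Suc i)) (z(i := y)) \<partial>Q i x z)"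
        using measurable_prob_algebraD[OF measurable_return_append[OF Q z]]
        by (intro nn_integral_bind[OF f]) (simp add: measurable_cong_sets[OF sx refl])
      also have "\<dots> = (\<integral>\<^sup>+y. f (z(i := y)) \<partial>Q i x z)"
        using measurable_space[OF measurable_append[OF Q z]] by (intro nn_integral_cong nn_integral_return) auto
      finally show "(\<integral>\<^sup>+z'. f z' \<partial>(Q i x z \<bind> (\<lambda>y. return (histories (Suc i)) (z(i := y)))))
          = (\<integral>\<^sup>+y. f (z(i := y)) \<partial>Q i x z)" .
    qed
    finally show "(\<integral>\<^sup>+z'. f z' \<partial>next_output Q P i z) = (\<integral>\<^sup>+x. \<integral>\<^sup>+y. f (z(i := y)) \<partial>Q i x z \<partial>P)" .
  qed
  finally show ?thesis .
qed

lemma integral_next_output: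
  fixes f :: "(nat \<Rightarrow> real) \<Rightarrow> real"
  assumes Q: "is_channel n Q" "i < n" and P: "prob_space P" "sets P = sets borel"
    and z: "z \<in> space (histories i)"
    and f[measurable]: "f \<in> borel_measurable (histories (Suc i))"
    and b: "\<And>z'. z' \<in> space (histories (Suc i)) \<Longrightarrow> \<bar>f z'\<bar> \<le> b"
  shows "(\<integral>z'. f z' \<partial>next_output Q P i z) = (\<integral>x. \<integral>y. f (z(i := y)) \<partial>Q i x z \<partial>P)"
proof -
  interpret P: prob_space P by fact
  have Qx: "prob_space (Q i x z)" "sets (Q i x z) = sets borel" for x
    using measurable_space[OF channel_section[OF Q z], of x] by (simp_all add: space_prob_algebra)
  have inner: "(\<integral>z'. f z' \<partial>(Q i x z \<bind> (\<lambda>y. return (histories (Suc i)) (z(i := y))))) = (\<integral>y. f (z(i := y)) \<partial>Q i x z)" for x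
  proof -
    interpret Qx: prob_space "Q i x z" by (rule Qx)
    have "(\<integral>z'. f z' \<partial>(Q i x z \<bind> (\<lambda>y. return (histories (Suc i)) (z(i := y)))))
        = (\<integral>y. \<integral>z'. f z' \<partial>return (histories (Suc i)) (z(i := y)) \<partial>Q i x z)"
    proof (rule integral_bind[OF f b])
      show "(\<lambda>y. return (histories (Suc i)) (z(i := y))) \<in> Q i x z \<rightarrow>\<^sub>M subprob_algebra (histories (Suc i))"
        using measurable_prob_algebraD[OF measurable_return_append[OF Q z]] by (simp add: measurable_cong_sets[OF Qx(2) refl])
      show "AE y in Q i x z. emeasure (return (histories (Suc i)) (z(i := y))) (space (return (histories (Suc i)) (z(i := y)))) \<le> ennreal 1"
        by (intro AE_I2) (simp add: indicator_def)
      show "finite_measure (Q i x z)" by unfold_locales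
    qed
    also have "\<dots> = (\<integral>y. f (z(i := y)) \<partial>Q i x z)"
      using measurable_space[OF measurable_append[OF Q z]]
      by (intro Bochner_Integration.integral_cong refl integral_return) auto
    finally show ?thesis .
  qed
  show ?thesis unfolding next_output_def inner[symmetric]
  proof (rule integral_bind[OF f b])
    show "(\<lambda>x. Q i x z \<bind> (\<lambda>y. return (histories (Suc i)) (z(i := y)))) \<in> P \<rightarrow>\<^sub>M subprob_algebra (histories (Suc i))"
      using measurable_prob_algebraD[OF measurable_output_append[OF Q z]] by (simp add: measurable_cong_sets[OF P(2) refl])
    show "AE x in P. emeasure (Q i x z \<bind> (\<lambda>y. return (histories (Suc i)) (z(i := y))))
        (space (Q i x z \<bind> (\<lambda>y. return (histories (Suc i)) (z(i := y))))) \<le> ennreal 1"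
    proof (rule AE_I2)
      fix x
      have "prob_space (Q i x z \<bind> (\<lambda>y. return (histories (Suc i)) (z(i := y))))"
        using measurable_space[OF measurable_output_append[OF Q z], of x] by (simp add: space_prob_algebra)
      then show "emeasure (Q i x z \<bind> (\<lambda>y. return (histories (Suc i)) (z(i := y))))
        (space (Q i x z \<bind> (\<lambda>y. return (histories (Suc i)) (z(i := y))))) \<le> ennreal 1"
        by (simp add: prob_space.emeasure_space_1)
    qed
    show "finite_measure P" by unfold_locales
  qed
qed

lemma integral_output_law_Suc:
  fixes f :: "(nat \<Rightarrow> real) \<Rightarrow> real"
  assumes Q: "is_channel n Q" "i < n" and P: "prob_space P" "sets P = sets borel"
    and f[measurable]: "f \<in> borel_measurable (histories (Suc i))"
    and b: "\<And>z'. z' \<in> space (histories (Suc i)) \<Longrightarrow> \<bar>f z'\<bar> \<le> b"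
  shows "(\<integral>z'. f z' \<partial>output_law Q P (Suc i)) = (\<integral>z. \<integral>z'. f z' \<partial>next_output Q P i z \<partial>output_law Q P i)"
  unfolding output_law.simps next_output_def[symmetric]
proof (rule integral_bind[OF f b])
  have o: "sets (output_law Q P i) = sets (histories i)" "prob_space (output_law Q P i)"
    using output_law_prob[OF Q(1) P, of i] Q(2) by (simp_all add: space_prob_algebra)
  interpret o: prob_space "output_law Q P i" by (rule o)
  note m = next_output_measurable[OF Q P]
  show "next_output Q P i \<in> output_law Q P i \<rightarrow>\<^sub>M subprob_algebra (histories (Suc i))"
    using measurable_prob_algebraD[OF m] by (simp add: measurable_cong_sets[OF o(1) refl])
  show "finite_measure (output_law Q P i)" by unfold_locales
  show "AE z in output_law Q P i. emeasure (next_output Q P i z) (space (next_output Q P i z)) \<le> ennreal 1"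
    using measurable_space[OF m] sets_eq_imp_space_eq[OF o(1)]
    by (intro AE_I2) (auto simp: space_prob_algebra prob_space.emeasure_space_1)
qed

text \<open>The inequality \<open>(E\<^sub>1 f)\<^sup>2 \<le> K * E\<^sub>0 f\<^sup>2\<close> is stable under composition with kernels: apply it first to
the last output for a fixed history, then to the resulting function of the history. Adaptivity of
the channel is harmless because the bound for the last output is the same for all histories.\<close>

lemma output_law_contraction:
  assumes Q: "is_channel n Q"
    and K: "1 \<le> K"
    and contr: "\<And>i x x' z. i < n \<Longrightarrow> z \<in> space (histories i) \<Longrightarrow> variance_contraction K (Q i x z) (Q i x' z)"
    and P0: "prob_space P\<^sub>0" "sets P\<^sub>0 = sets borel" and P1: "prob_space P\<^sub>1" "sets P\<^sub>1 = sets borel"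
    and T: "signed_dist_le P\<^sub>0 P\<^sub>1 T"
    and i: "i \<le> n" and f: "f \<in> borel_measurable (histories i)"
    and f01: "\<And>z. z \<in> space (histories i) \<Longrightarrow> 0 \<le> f z \<and> f z \<le> (1::real)"
  shows "(\<integral>z. f z \<partial>output_law Q P\<^sub>1 i)\<^sup>2 \<le> (1 + (K - 1) * T\<^sup>2) ^ i * (\<integral>z. (f z)\<^sup>2 \<partial>output_law Q P\<^sub>0 i)"
  using i f f01
proof (induction i arbitrary: f)
  case 0
  have "(\<lambda>_. undefined) \<in> space (histories 0)" by (simp add: space_PiM)
  then show ?case using 0 by (simp add: integral_return)
next
  case (Suc i)
  then have i: "i < n" by simp
  note [measurable] = Suc.prems(2)
  let ?\<delta> = "(K - 1) * T\<^sup>2"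
  have \<delta>: "0 \<le> ?\<delta>" using K by simp
  have o: "sets (output_law Q P i) = sets (histories i)" "prob_space (output_law Q P i)"
    if "prob_space P" "sets P = sets borel" for P
    using output_law_prob[OF Q that, of i] i by (simp_all add: space_prob_algebra)
  interpret o: prob_space "output_law Q P\<^sub>0 i" by (rule o[OF P0])
  note no = next_output_measurable[OF Q i]
  define g where "g z = (\<integral>z'. f z' \<partial>next_output Q P\<^sub>1 i z)" for z
  define q where "q z = (\<integral>z'. (f z')\<^sup>2 \<partial>next_output Q P\<^sub>0 i z)" for z
  have gm: "g \<in> borel_measurable (histories i)" unfolding g_def
    by (rule measurable_compose[OF measurable_prob_algebraD[OF no[OF P1]] integral_measurable_subprob_algebra]) simp
  have qm: "q \<in> borel_measurable (histories i)" unfolding q_def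
    by (rule measurable_compose[OF measurable_prob_algebraD[OF no[OF P0]] integral_measurable_subprob_algebra]) simp
  have f2: "0 \<le> (f z)\<^sup>2 \<and> (f z)\<^sup>2 \<le> 1" if "z \<in> space (histories (Suc i))" for z
    using Suc.prems(3)[OF that] by (simp add: power_le_one)
  have N: "prob_space (next_output Q P i z)" "sets (next_output Q P i z) = sets (histories (Suc i))"
    if "prob_space P" "sets P = sets borel" "z \<in> space (histories i)" for P z
    using measurable_space[OF no[OF that(1,2)] that(3)] by (simp_all add: space_prob_algebra)
  have bnd: "0 \<le> (\<integral>z'. h z' \<partial>next_output Q P i z) \<and> (\<integral>z'. h z' \<partial>next_output Q P i z) \<le> 1"
    if P: "prob_space P" "sets P = sets borel" and z: "z \<in> space (histories i)"
      and h: "h \<in> borel_measurable (histories (Suc i))" "\<And>z. z \<in> space (histories (Suc i)) \<Longrightarrow> 0 \<le> h z \<and> h z \<le> (1::real)"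
    for h z P
  proof -
    interpret N: prob_space "next_output Q P i z" by (rule N[OF P z])
    have sp: "space (next_output Q P i z) = space (histories (Suc i))" by (rule sets_eq_imp_space_eq[OF N(2)[OF P z]])
    have hm: "h \<in> borel_measurable (next_output Q P i z)" using h(1) by (simp add: measurable_cong_sets[OF N(2)[OF P z] refl])
    have I: "integrable (next_output Q P i z) h"
      using h(2) by (intro N.integrable_bounded_measurable[OF hm, of 1]) (auto simp: sp)
    show ?thesis using h(2) I by (auto intro!: integral_nonneg_AE AE_I2 N.integral_le_const simp: sp)
  qed
  have g01: "0 \<le> g z \<and> g z \<le> 1" if "z \<in> space (histories i)" for z
    unfolding g_def using that Suc.prems(3) by (intro bnd[OF P1]) auto
  have q01: "0 \<le> q z \<and> q z \<le> 1" if "z \<in> space (histories i)" for z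
    unfolding q_def using that f2 by (intro bnd[OF P0]) auto
  have step: "(g z)\<^sup>2 \<le> (1 + ?\<delta>) * q z" if z: "z \<in> space (histories i)" for z
  proof -
    have "g z = (\<integral>x. \<integral>y. f (z(i := y)) \<partial>Q i x z \<partial>P\<^sub>1)" unfolding g_def
      by (rule integral_next_output[OF Q i P1 z, where b = 1]) (use Suc.prems(3) in auto)
    moreover have "q z = (\<integral>x. \<integral>y. (f (z(i := y)))\<^sup>2 \<partial>Q i x z \<partial>P\<^sub>0)" unfolding q_def
      by (rule integral_next_output[OF Q i P0 z, where b = 1]) (use f2 in auto)
    moreover have "(\<integral>x. \<integral>y. f (z(i := y)) \<partial>Q i x z \<partial>P\<^sub>1)\<^sup>2 \<le> (1 + ?\<delta>) * (\<integral>x. \<integral>y. (f (z(i := y)))\<^sup>2 \<partial>Q i x z \<partial>P\<^sub>0)"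
    proof (rule private_mixture_contraction[OF P0(1) P1(1) _ _ K _ T])
      show "sets P\<^sub>1 = sets P\<^sub>0" using P0 P1 by simp
      show "(\<lambda>x. Q i x z) \<in> P\<^sub>0 \<rightarrow>\<^sub>M prob_algebra borel"
        using channel_section[OF Q i z] by (simp add: measurable_cong_sets[OF P0(2) refl])
      show "variance_contraction K (Q i x z) (Q i x' z)" for x x' using contr[OF i z] .
      show "(\<lambda>y. f (z(i := y))) \<in> borel_measurable borel"
        by (rule measurable_compose[OF measurable_append[OF Q i z] Suc.prems(2)])
      fix y :: real
      have "z(i := y) \<in> space (histories (Suc i))"
        using measurable_space[OF measurable_append[OF Q i z], of y] by simp
      then show "0 \<le> f (z(i := y)) \<and> f (z(i := y)) \<le> 1" by (rule Suc.prems(3))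
    qed
    ultimately show ?thesis by simp
  qed
  have sp0: "space (output_law Q P\<^sub>0 i) = space (histories i)" by (rule sets_eq_imp_space_eq[OF o(1)[OF P0]])
  have gm0: "g \<in> borel_measurable (output_law Q P\<^sub>0 i)" "q \<in> borel_measurable (output_law Q P\<^sub>0 i)"
    using gm qm by (simp_all add: measurable_cong_sets[OF o(1)[OF P0] refl])
  have "(\<integral>z. f z \<partial>output_law Q P\<^sub>1 (Suc i)) = (\<integral>z. g z \<partial>output_law Q P\<^sub>1 i)" unfolding g_def
    by (rule integral_output_law_Suc[OF Q i P1, where b = 1]) (use Suc.prems(3) in auto)
  also have "\<dots>\<^sup>2 \<le> (1 + ?\<delta>) ^ i * (\<integral>z. (g z)\<^sup>2 \<partial>output_law Q P\<^sub>0 i)"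
    using i g01 gm by (intro Suc.IH) auto
  also have "\<dots> \<le> (1 + ?\<delta>) ^ i * (\<integral>z. (1 + ?\<delta>) * q z \<partial>output_law Q P\<^sub>0 i)"
  proof (intro mult_left_mono integral_mono)
    show "integrable (output_law Q P\<^sub>0 i) (\<lambda>z. (g z)\<^sup>2)"
      using gm0 g01 by (intro o.integrable_bounded_measurable[where b = 1]) (auto simp: sp0 power_le_one)
    show "integrable (output_law Q P\<^sub>0 i) (\<lambda>z. (1 + ?\<delta>) * q z)"
      using gm0 q01 by (intro integrable_mult_right o.integrable_bounded_measurable[where b = 1]) (auto simp: sp0)
    show "(g z)\<^sup>2 \<le> (1 + ?\<delta>) * q z" if "z \<in> space (output_law Q P\<^sub>0 i)" for z
      using step that by (simp add: sp0)
    show "0 \<le> (1 + ?\<delta>) ^ i" using \<delta> by simp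
  qed
  also have "\<dots> = (1 + ?\<delta>) ^ Suc i * (\<integral>z. q z \<partial>output_law Q P\<^sub>0 i)" by simp
  also have "(\<integral>z. q z \<partial>output_law Q P\<^sub>0 i) = (\<integral>z. (f z)\<^sup>2 \<partial>output_law Q P\<^sub>0 (Suc i))" unfolding q_def
    by (rule integral_output_law_Suc[OF Q i P0, where b = 1, symmetric]) (use f2 in auto)
  finally show ?case .
qed

lemma output_law_two_point:
  assumes Q: "Q \<in> renyi_private_channels \<epsilon> n" and \<epsilon>: "0 < \<epsilon>"
    and P0: "prob_space P\<^sub>0" "sets P\<^sub>0 = sets borel" and P1: "prob_space P\<^sub>1" "sets P\<^sub>1 = sets borel"
    and T: "signed_dist_le P\<^sub>0 P\<^sub>1 T"
    and A: "A \<in> sets (histories n)"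
  shows "(measure (output_law Q P\<^sub>1 n) A)\<^sup>2 \<le> exp (real n * ((exp (\<epsilon>\<^sup>2) - 1) * T\<^sup>2)) * measure (output_law Q P\<^sub>0 n) A"
proof -
  have Qc: "is_channel n Q" using Q by (simp add: renyi_private_channels_def)
  have o: "sets (output_law Q P n) = sets (histories n)" "prob_space (output_law Q P n)"
    if "prob_space P" "sets P = sets borel" for P
    using output_law_prob[OF Qc that, of n] by (simp_all add: space_prob_algebra)
  have ind: "(\<integral>z. indicator A z \<partial>output_law Q P n) = measure (output_law Q P n) A"
    if "prob_space P" "sets P = sets borel" for P
    using A o(1)[OF that] sets.sets_into_space[OF A] sets_eq_imp_space_eq[OF o(1)[OF that]]
    by (simp add: Int_absorb1 Int_absorb2)
  have ind2: "(indicator A z)\<^sup>2 = (indicator A z :: real)" for z by (simp add: indicator_def)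
  have "(\<integral>z. indicator A z \<partial>output_law Q P\<^sub>1 n)\<^sup>2
      \<le> (1 + (exp (\<epsilon>\<^sup>2) - 1) * T\<^sup>2) ^ n * (\<integral>z. (indicator A z)\<^sup>2 \<partial>output_law Q P\<^sub>0 n)"
  proof (rule output_law_contraction[OF Qc _ _ P0 P1 T order_refl])
    show "1 \<le> exp (\<epsilon>\<^sup>2)" by simp
    fix i x x' z assume i: "i < n" and z: "z \<in> space (histories i)"
    have "prob_space (Q i x z) \<and> sets (Q i x z) = sets borel" for x
      using measurable_space[OF channel_section[OF Qc i z], of x] by (simp add: space_prob_algebra)
    then show "variance_contraction (exp (\<epsilon>\<^sup>2)) (Q i x z) (Q i x' z)"
      using Q i z \<epsilon> by (intro renyi2_variance_contraction) (auto simp: renyi_private_channels_def)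
  qed (use A in auto)
  also have "\<dots> \<le> exp (real n * ((exp (\<epsilon>\<^sup>2) - 1) * T\<^sup>2)) * (\<integral>z. (indicator A z)\<^sup>2 \<partial>output_law Q P\<^sub>0 n)"
  proof (rule mult_right_mono)
    have "(1 + (exp (\<epsilon>\<^sup>2) - 1) * T\<^sup>2) ^ n \<le> exp ((exp (\<epsilon>\<^sup>2) - 1) * T\<^sup>2) ^ n"
      by (rule power_mono) auto
    then show "(1 + (exp (\<epsilon>\<^sup>2) - 1) * T\<^sup>2) ^ n \<le> exp (real n * ((exp (\<epsilon>\<^sup>2) - 1) * T\<^sup>2))"
      by (simp add: exp_of_nat_mult)
  qed simp
  finally show ?thesis unfolding ind2 ind[OF P0] ind[OF P1] .
qed

section \<open>Two-point lower bounds\<close>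


text \<open>Le Cam's argument. On the event \<open>A\<close> that the estimate is at least half of the gap away from
\<open>\<theta> P\<^sub>0\<close> it errs under \<open>P\<^sub>0\<close>, off \<open>A\<close> it errs under \<open>P\<^sub>1\<close>. If \<open>A\<close> has probability at least one half under
\<open>P\<^sub>1\<close>, the contraction gives it probability at least \<open>1 / 12\<close> under \<open>P\<^sub>0\<close>.\<close>

lemma two_point_risk_lower:
  fixes \<theta> :: "real measure \<Rightarrow> real"
  assumes est: "est \<in> borel_measurable (histories n)" and Q: "Q \<in> renyi_private_channels \<epsilon> n" and \<epsilon>: "0 < \<epsilon>"
    and P0: "prob_space P\<^sub>0" "sets P\<^sub>0 = sets borel" and P1: "prob_space P\<^sub>1" "sets P\<^sub>1 = sets borel"
    and T: "signed_dist_le P\<^sub>0 P\<^sub>1 T" and small: "real n * ((exp (\<epsilon>\<^sup>2) - 1) * T\<^sup>2) \<le> 1"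
    and B: "0 < B"
  defines "L \<equiv> trunc_sq_loss B" and "\<Delta> \<equiv> \<bar>\<theta> P\<^sub>1 - \<theta> P\<^sub>0\<bar>"
  shows "ennreal (min (\<Delta>\<^sup>2 / 4) B / 12) \<le> max (risk n \<theta> L est Q P\<^sub>0) (risk n \<theta> L est Q P\<^sub>1)"
proof -
  have Qc: "is_channel n Q" using Q by (simp add: renyi_private_channels_def)
  have o: "sets (output_law Q P n) = sets (histories n)" "prob_space (output_law Q P n)"
    if "prob_space P" "sets P = sets borel" for P
    using output_law_prob[OF Qc that, of n] by (simp_all add: space_prob_algebra)
  interpret o1: prob_space "output_law Q P\<^sub>1 n" by (rule o[OF P1])
  define w where "w = min (\<Delta>\<^sup>2 / 4) B"
  have w: "0 \<le> w" using B by (simp add: w_def)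
  define A where "A = {z \<in> space (histories n). \<Delta> / 2 \<le> \<bar>est z - \<theta> P\<^sub>0\<bar>}"
  have A: "A \<in> sets (histories n)" unfolding A_def using est by measurable
  have L: "w \<le> L t" if "\<Delta> / 2 \<le> \<bar>t\<bar>" for t
  proof -
    have "(\<Delta> / 2)\<^sup>2 \<le> \<bar>t\<bar>\<^sup>2" using that by (intro power_mono) (auto simp: \<Delta>_def)
    then show ?thesis by (simp add: w_def L_def trunc_sq_loss_def power_divide)
  qed
  have r: "ennreal (w * measure (output_law Q P n) S) \<le> risk n \<theta> L est Q P"
    if P: "prob_space P" "sets P = sets borel" and S: "S \<in> sets (histories n)"
      and far: "\<And>z. z \<in> S \<Longrightarrow> \<Delta> / 2 \<le> \<bar>est z - \<theta> P\<bar>" for P S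
  proof -
    interpret oP: prob_space "output_law Q P n" by (rule o[OF P])
    have "ennreal (w * measure (output_law Q P n) S) = (\<integral>\<^sup>+z. ennreal w * indicator S z \<partial>output_law Q P n)"
      using S w by (simp add: o(1)[OF P] nn_integral_cmult_indicator oP.emeasure_eq_measure ennreal_mult)
    also have "\<dots> \<le> risk n \<theta> L est Q P" unfolding risk_def
      using far L by (intro nn_integral_mono) (auto simp: indicator_def intro!: ennreal_leI)
    finally show ?thesis .
  qed
  have r0: "ennreal (w * measure (output_law Q P\<^sub>0 n) A) \<le> risk n \<theta> L est Q P\<^sub>0"
    by (rule r[OF P0 A]) (simp add: A_def)
  have r1: "ennreal (w * measure (output_law Q P\<^sub>1 n) (space (histories n) - A)) \<le> risk n \<theta> L est Q P\<^sub>1"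
  proof (rule r[OF P1])
    show "space (histories n) - A \<in> sets (histories n)" using A by auto
    fix z assume "z \<in> space (histories n) - A"
    then have "\<bar>est z - \<theta> P\<^sub>0\<bar> < \<Delta> / 2" by (auto simp: A_def)
    moreover have "\<Delta> \<le> \<bar>est z - \<theta> P\<^sub>0\<bar> + \<bar>est z - \<theta> P\<^sub>1\<bar>" unfolding \<Delta>_def by linarith
    ultimately show "\<Delta> / 2 \<le> \<bar>est z - \<theta> P\<^sub>1\<bar>" by linarith
  qed
  have compl: "measure (output_law Q P\<^sub>1 n) (space (histories n) - A) = 1 - measure (output_law Q P\<^sub>1 n) A"
    using o1.prob_compl[of A] A o[OF P1] sets_eq_imp_space_eq[OF o(1)[OF P1]] by simp
  have "(measure (output_law Q P\<^sub>1 n) A)\<^sup>2 \<le> exp (real n * ((exp (\<epsilon>\<^sup>2) - 1) * T\<^sup>2)) * measure (output_law Q P\<^sub>0 n) A"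
    by (rule output_law_two_point[OF Q \<epsilon> P0 P1 T A])
  also have "\<dots> \<le> 3 * measure (output_law Q P\<^sub>0 n) A"
  proof (rule mult_right_mono)
    have "exp (real n * ((exp (\<epsilon>\<^sup>2) - 1) * T\<^sup>2)) \<le> exp 1" using small by simp
    then show "exp (real n * ((exp (\<epsilon>\<^sup>2) - 1) * T\<^sup>2)) \<le> 3" using exp_le by linarith
  qed simp
  finally have two: "(measure (output_law Q P\<^sub>1 n) A)\<^sup>2 \<le> 3 * measure (output_law Q P\<^sub>0 n) A" .
  show ?thesis
  proof (cases "1 / 2 \<le> measure (output_law Q P\<^sub>1 n) A")
    case True
    have "(1 / 2)\<^sup>2 \<le> (measure (output_law Q P\<^sub>1 n) A)\<^sup>2" using True by (intro power_mono) auto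
    then have "1 / 12 \<le> measure (output_law Q P\<^sub>0 n) A" using two by (simp add: power2_eq_square)
    then have "w / 12 \<le> w * measure (output_law Q P\<^sub>0 n) A" using mult_left_mono[OF _ w] by fastforce
    then show ?thesis using r0 unfolding w_def[symmetric]
      by (meson ennreal_leI max.coboundedI1 order_trans)
  next
    case False
    then have "1 / 12 \<le> measure (output_law Q P\<^sub>1 n) (space (histories n) - A)" unfolding compl by simp
    then have "w / 12 \<le> w * measure (output_law Q P\<^sub>1 n) (space (histories n) - A)" using mult_left_mono[OF _ w] by fastforce
    then show ?thesis using r1 unfolding w_def[symmetric]
      by (meson ennreal_leI max.coboundedI2 order_trans)
  qed
qed

lemma local_minimax_lower:
  fixes \<theta> :: "real measure \<Rightarrow> real"
  assumes "P\<^sub>1 \<in> \<P>" and \<epsilon>: "0 < \<epsilon>"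
    and P0: "prob_space P\<^sub>0" "sets P\<^sub>0 = sets borel" and P1: "prob_space P\<^sub>1" "sets P\<^sub>1 = sets borel"
    and T: "signed_dist_le P\<^sub>0 P\<^sub>1 T" and small: "real n * ((exp (\<epsilon>\<^sup>2) - 1) * T\<^sup>2) \<le> 1"
    and B: "0 < B"
  shows "ennreal (min (\<bar>\<theta> P\<^sub>1 - \<theta> P\<^sub>0\<bar>\<^sup>2 / 4) B / 12)
    \<le> local_minimax n \<theta> P\<^sub>0 (trunc_sq_loss B) \<P> (renyi_private_channels \<epsilon>)"
  unfolding local_minimax_def
  by (rule SUP_upper2[OF assms(1)], rule INF_greatest)
    (use two_point_risk_lower[OF _ _ \<epsilon> P0 P1 T small B] in \<open>simp add: case_prod_unfold mem_Times_iff\<close>)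

text \<open>The alternative is taken at \<open>h = 1 / (\<kappa> * sqrt (n * k))\<close> with \<open>k = exp (\<epsilon>\<^sup>2) - 1\<close>, the largest
perturbation that keeps the contraction factor over \<open>n\<close> outputs bounded. The separation needs to be
linear only up to the cap \<open>s\<close>, since \<open>h\<close> tends to zero.\<close>

lemma local_minimax_rate:
  fixes \<theta> :: "real measure \<Rightarrow> real" and P :: "real \<Rightarrow> real measure"
  assumes \<epsilon>: "0 < \<epsilon>" and B: "0 < B" and P0: "prob_space P\<^sub>0" "sets P\<^sub>0 = sets borel"
    and pos: "0 < d" "0 < s" "0 < \<kappa>" "0 < l"
    and mem: "\<And>h. 0 < h \<Longrightarrow> h < d \<Longrightarrow> P h \<in> \<P>"
    and prob: "\<And>h. 0 < h \<Longrightarrow> h < d \<Longrightarrow> prob_space (P h) \<and> sets (P h) = sets borel"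
    and dist: "\<And>h. 0 < h \<Longrightarrow> h < d \<Longrightarrow> signed_dist_le P\<^sub>0 (P h) (\<kappa> * h)"
    and sep: "\<And>h. 0 < h \<Longrightarrow> h < d \<Longrightarrow> min s (l * h) \<le> \<bar>\<theta> (P h) - \<theta> P\<^sub>0\<bar>"
  shows "\<forall>\<^sub>F n in sequentially. ennreal (l\<^sup>2 / (48 * \<kappa>\<^sup>2 * (real n * (exp (\<epsilon>\<^sup>2) - 1))))
    \<le> local_minimax n \<theta> P\<^sub>0 (trunc_sq_loss B) \<P> (renyi_private_channels \<epsilon>)"
proof -
  define k where "k = exp (\<epsilon>\<^sup>2) - 1"
  have k: "0 < k" using \<epsilon> by (simp add: k_def)
  \<comment> \<open>This choice makes \<open>n * k * (\<kappa> * h)\<^sup>2 = 1\<close>.\<close>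
  define h where "h n = sqrt (1 / (\<kappa>\<^sup>2 * k * real n))" for n
  have hlim: "h \<longlonglongrightarrow> 0"
  proof -
    have "(\<lambda>n. sqrt (1 / (\<kappa>\<^sup>2 * k) * (1 / real n))) \<longlonglongrightarrow> sqrt (1 / (\<kappa>\<^sup>2 * k) * 0)"
      by (intro tendsto_intros lim_1_over_n)
    then show ?thesis by (simp add: h_def[abs_def])
  qed
  note lh = tendsto_mult[OF tendsto_const[of l] hlim]
  have "\<forall>\<^sub>F n in sequentially. h n < d" using hlim pos(1) by (rule order_tendstoD)
  moreover have "\<forall>\<^sub>F n in sequentially. l * h n < s" using pos(2) by (intro order_tendstoD(2)[OF lh]) simp
  moreover have "\<forall>\<^sub>F n in sequentially. (l * h n)\<^sup>2 / 4 < B"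
    using B by (intro order_tendstoD(2)[OF tendsto_divide[OF tendsto_power[OF lh] tendsto_const]]) auto
  ultimately show ?thesis using eventually_gt_at_top[of 0]
  proof eventually_elim
    case (elim n)
    have hn: "0 < h n" using elim k pos by (simp add: h_def)
    have h2: "(h n)\<^sup>2 = 1 / (\<kappa>\<^sup>2 * k * real n)" using k by (simp add: h_def)
    let ?\<Delta> = "\<bar>\<theta> (P (h n)) - \<theta> P\<^sub>0\<bar>"
    have "l * h n \<le> ?\<Delta>" using sep[OF hn elim(1)] elim by simp
    then have "(l * h n)\<^sup>2 \<le> ?\<Delta>\<^sup>2" using hn pos by (intro power_mono) auto
    then have "(l * h n)\<^sup>2 / 4 \<le> min (?\<Delta>\<^sup>2 / 4) B" using elim by simp
    moreover have "l\<^sup>2 / (48 * \<kappa>\<^sup>2 * (real n * k)) = (l * h n)\<^sup>2 / 4 / 12"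
      by (simp add: power_mult_distrib h2 mult_ac)
    ultimately have "l\<^sup>2 / (48 * \<kappa>\<^sup>2 * (real n * k)) \<le> min (?\<Delta>\<^sup>2 / 4) B / 12" by linarith
    then have "ennreal (l\<^sup>2 / (48 * \<kappa>\<^sup>2 * (real n * (exp (\<epsilon>\<^sup>2) - 1)))) \<le> ennreal (min (?\<Delta>\<^sup>2 / 4) B / 12)"
      unfolding k_def by (rule ennreal_leI)
    also have "\<dots> \<le> local_minimax n \<theta> P\<^sub>0 (trunc_sq_loss B) \<P> (renyi_private_channels \<epsilon>)"
    proof (rule local_minimax_lower[OF mem[OF hn elim(1)] \<epsilon> P0 _ _ dist[OF hn elim(1)] _ B])
      show "real n * ((exp (\<epsilon>\<^sup>2) - 1) * (\<kappa> * h n)\<^sup>2) \<le> 1"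
        unfolding k_def[symmetric] using elim k pos by (simp add: power_mult_distrib h2)
    qed (use prob[OF hn elim(1)] in auto)
    finally show ?case .
  qed
qed

section \<open>Randomized response\<close>

lemma ennreal_mult_add_mult:
  assumes "0 \<le> a" "0 \<le> b" "0 \<le> c" "0 \<le> d"
  shows "ennreal a * ennreal b + ennreal c * ennreal d = ennreal (a * b + c * d)"
  using assms by (simp add: ennreal_mult ennreal_plus)

definition rademacher :: "real measure" where
  "rademacher = distr (measure_pmf (pmf_of_set {-1, 1})) borel id"

definition response_sign :: "real \<Rightarrow> real" where
  "response_sign y = (if 0 < y then 1 else - 1)"

text \<open>The law of a random sign with mean \<open>\<beta>\<close>, given by a density so that likelihood ratios of two
such laws are explicit.\<close>

definition biased_sign :: "real \<Rightarrow> real measure" where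
  "biased_sign \<beta> = density rademacher (\<lambda>y. ennreal (1 + \<beta> * response_sign y))"

lemma sets_rademacher [simp, measurable_cong]: "sets rademacher = sets borel"
  and space_rademacher [simp]: "space rademacher = UNIV"
  by (simp_all add: rademacher_def)

lemma sets_biased_sign [simp, measurable_cong]: "sets (biased_sign \<beta>) = sets borel"
  and space_biased_sign [simp]: "space (biased_sign \<beta>) = UNIV"
  by (simp_all add: biased_sign_def)

lemma response_sign_measurable [measurable]: "response_sign \<in> borel_measurable borel"
  unfolding response_sign_def[abs_def] by measurable

lemma nn_integral_rademacher:
  assumes "f \<in> borel_measurable borel"
  shows "(\<integral>\<^sup>+y. f y \<partial>rademacher) = (f (- 1) + f 1) / 2"
  unfolding rademacher_def using assms
  by (subst nn_integral_distr) (auto simp: nn_integral_pmf_of_set)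

lemma nn_integral_biased_sign:
  assumes "\<bar>\<beta>\<bar> \<le> 1" "f \<in> borel_measurable borel"
  shows "(\<integral>\<^sup>+y. f y \<partial>biased_sign \<beta>) = ennreal ((1 - \<beta>) / 2) * f (- 1) + ennreal ((1 + \<beta>) / 2) * f 1"
proof -
  have "(\<integral>\<^sup>+y. f y \<partial>biased_sign \<beta>) = (\<integral>\<^sup>+y. ennreal (1 + \<beta> * response_sign y) * f y \<partial>rademacher)"
    unfolding biased_sign_def using assms(2) by (subst nn_integral_density) auto
  also have "\<dots> = (ennreal (1 - \<beta>) * f (- 1) + ennreal (1 + \<beta>) * f 1) / 2"
    using assms(2) by (subst nn_integral_rademacher) (auto simp: response_sign_def)
  also have "\<dots> = ennreal ((1 - \<beta>) / 2) * f (- 1) + ennreal ((1 + \<beta>) / 2) * f 1"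
    using assms(1) by (simp add: add_divide_distrib_ennreal divide_ennreal[symmetric] ennreal_divide_times ennreal_times_divide divide_ennreal_def algebra_simps)
  finally show ?thesis .
qed

lemma prob_biased_sign:
  assumes "\<bar>\<beta>\<bar> \<le> 1"
  shows "prob_space (biased_sign \<beta>)"
proof
  have "emeasure (biased_sign \<beta>) (space (biased_sign \<beta>)) = (\<integral>\<^sup>+y. 1 \<partial>biased_sign \<beta>)" by simp
  also have "\<dots> = ennreal ((1 - \<beta>) / 2) + ennreal ((1 + \<beta>) / 2)"
    using assms by (subst nn_integral_biased_sign) auto
  also have "\<dots> = ennreal ((1 - \<beta>) / 2 + (1 + \<beta>) / 2)" using assms by (subst ennreal_plus) auto
  also have "(1 - \<beta>) / 2 + (1 + \<beta>) / 2 = 1" by (simp add: field_simps)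
  finally show "emeasure (biased_sign \<beta>) (space (biased_sign \<beta>)) = 1" by simp
qed

text \<open>With densities \<open>g\<close> and \<open>g'\<close>, the integrand is
\<open>g\<^sup>2 / g' = g' + 2 * (g - g') + (g - g')\<^sup>2 / g'\<close>. The first two terms integrate to \<open>1\<close> and \<open>0\<close>, and the
last is at most \<open>(2 * \<alpha>)\<^sup>2 / (1 / 2)\<close>.\<close>

lemma renyi2_biased_sign:
  assumes \<beta>: "\<bar>\<beta>\<bar> \<le> \<alpha>" "\<bar>\<beta>'\<bar> \<le> \<alpha>" and \<alpha>: "\<alpha> \<le> 1 / 2"
  shows "renyi2 (biased_sign \<beta>) (biased_sign \<beta>') \<le> ereal (8 * \<alpha>\<^sup>2)"
proof -
  define g where "g b y = 1 + b * response_sign y" for b y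
  have [measurable]: "g b \<in> borel_measurable borel" for b unfolding g_def by simp
  have gpos: "1 / 2 \<le> g b y" if "\<bar>b\<bar> \<le> \<alpha>" for b y
    using that \<alpha> by (auto simp: g_def response_sign_def)
  let ?P = "biased_sign \<beta>" and ?Q = "biased_sign \<beta>'"
  have Q: "prob_space ?Q" using \<beta> \<alpha> by (intro prob_biased_sign) auto
  define r where "r y = g \<beta> y / g \<beta>' y" for y
  have [measurable]: "r \<in> borel_measurable borel" unfolding r_def by simp
  have r0: "0 \<le> r y" for y using gpos[OF \<beta>(1), of y] gpos[OF \<beta>(2), of y] by (simp add: r_def)
  have PQ: "density ?Q (\<lambda>y. ennreal (r y)) = ?P"
  proof -
    have "density ?Q (\<lambda>y. ennreal (r y)) = density rademacher (\<lambda>y. ennreal (g \<beta>' y) * ennreal (r y))"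
      unfolding biased_sign_def by (subst density_density_eq) (auto simp: g_def)
    also have "(\<lambda>y. ennreal (g \<beta>' y) * ennreal (r y)) = (\<lambda>y. ennreal (g \<beta> y))"
    proof
      fix y show "ennreal (g \<beta>' y) * ennreal (r y) = ennreal (g \<beta> y)"
        using gpos[OF \<beta>(2), of y] r0[of y] by (simp add: ennreal_mult[symmetric] r_def)
    qed
    finally show ?thesis by (simp add: biased_sign_def g_def)
  qed
  interpret Q: prob_space ?Q by (rule Q)
  have "AE y in ?Q. ennreal (r y) = RN_deriv ?Q ?P y"
    using PQ by (intro Q.RN_deriv_unique) auto
  then have "(\<integral>\<^sup>+y. (RN_deriv ?Q ?P y)\<^sup>2 \<partial>?Q) = (\<integral>\<^sup>+y. ennreal ((r y)\<^sup>2) \<partial>?Q)"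
    by (intro nn_integral_cong_AE, eventually_elim) (auto simp: ennreal_power r0 dest: sym)
  also have "\<dots> \<le> ennreal (1 + 8 * \<alpha>\<^sup>2)"
  proof -
    have b: "\<bar>\<beta>'\<bar> \<le> 1" using \<beta> \<alpha> by simp
    have pt: "g \<beta>' y * (r y)\<^sup>2 \<le> g \<beta>' y + 2 * (g \<beta> y - g \<beta>' y) + 8 * \<alpha>\<^sup>2" for y
    proof -
      have gp: "0 < g \<beta>' y" using gpos[OF \<beta>(2), of y] by linarith
      have "g \<beta>' y * (r y)\<^sup>2 = g \<beta>' y + 2 * (g \<beta> y - g \<beta>' y) + (g \<beta> y - g \<beta>' y)\<^sup>2 / g \<beta>' y"
        using gp by (simp add: r_def field_simps power2_eq_square)
      also have "(g \<beta> y - g \<beta>' y)\<^sup>2 / g \<beta>' y \<le> (2 * \<alpha>)\<^sup>2 / (1 / 2)"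
      proof (rule frac_le)
        have "\<bar>g \<beta> y - g \<beta>' y\<bar> \<le> 2 * \<alpha>" using \<beta> by (auto simp: g_def response_sign_def)
        then show "(g \<beta> y - g \<beta>' y)\<^sup>2 \<le> (2 * \<alpha>)\<^sup>2" by (metis abs_ge_zero power2_abs power_mono)
      qed (use gpos[OF \<beta>(2), of y] in auto)
      finally show ?thesis by (simp add: power2_eq_square)
    qed
    have g1: "g b (- 1) = 1 - b" "g b 1 = 1 + b" for b by (simp_all add: g_def response_sign_def)
    have gn: "0 \<le> g \<beta>' y" for y using gpos[OF \<beta>(2), of y] by linarith
    have "(\<integral>\<^sup>+y. ennreal ((r y)\<^sup>2) \<partial>?Q) = ennreal (g \<beta>' (- 1) / 2) * ennreal ((r (- 1))\<^sup>2) + ennreal (g \<beta>' 1 / 2) * ennreal ((r 1)\<^sup>2)"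
      unfolding g1 by (rule nn_integral_biased_sign[OF b]) simp
    also have "\<dots> = ennreal (g \<beta>' (- 1) * (r (- 1))\<^sup>2 / 2 + g \<beta>' 1 * (r 1)\<^sup>2 / 2)"
      using gn[of 1] gn[of "- 1"] by (simp add: ennreal_mult[symmetric] flip: ennreal_plus)
    also have "\<dots> \<le> ennreal (1 + 8 * \<alpha>\<^sup>2)"
      using pt[of 1] pt[of "- 1"] by (intro ennreal_leI) (simp add: g1)
    finally show ?thesis .
  qed
  finally have I: "(\<integral>\<^sup>+y. (RN_deriv ?Q ?P y)\<^sup>2 \<partial>?Q) \<le> ennreal (1 + 8 * \<alpha>\<^sup>2)" (is "?I \<le> _") .
  have Ir: "enn2real ?I \<le> 1 + 8 * \<alpha>\<^sup>2" using enn2real_mono[OF I] by (simp del: ennreal_plus)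
  have "ln (enn2real ?I) \<le> 8 * \<alpha>\<^sup>2"
  proof (cases "0 < enn2real ?I")
    case True
    have "ln (enn2real ?I) \<le> enn2real ?I - 1" using True by (rule ln_le_minus_one)
    then show ?thesis using Ir by simp
  next
    case False
    then have "enn2real ?I = 0" using enn2real_nonneg[of ?I] by linarith
    then show ?thesis by simp
  qed
  moreover have "?I < \<infinity>" using I by (rule order.strict_trans1) simp
  moreover have "absolutely_continuous ?Q ?P"
    unfolding PQ[symmetric] by (rule absolutely_continuousI_density) simp
  ultimately show ?thesis unfolding renyi2_def Let_def by simp
qed

definition threshold_response :: "real \<Rightarrow> real \<Rightarrow> channel" where
  "threshold_response \<alpha> m i x z = (if m < x then biased_sign \<alpha> else biased_sign (- \<alpha>))"

lemma threshold_response_private: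
  assumes \<alpha>: "0 \<le> \<alpha>" "\<alpha> \<le> 1 / 2" "8 * \<alpha>\<^sup>2 \<le> \<epsilon>\<^sup>2"
  shows "threshold_response \<alpha> m \<in> renyi_private_channels \<epsilon> n"
proof -
  have "is_channel n (threshold_response \<alpha> m)"
    unfolding is_channel_def
  proof (intro allI impI)
    fix i
    have sp: "biased_sign \<alpha> \<in> space (prob_algebra borel)" "biased_sign (- \<alpha>) \<in> space (prob_algebra borel)"
      using \<alpha> by (auto simp: space_prob_algebra intro!: prob_biased_sign)
    have "(\<lambda>p. if m < fst p then biased_sign \<alpha> else biased_sign (- \<alpha>)) \<in> borel \<Otimes>\<^sub>M histories i \<rightarrow>\<^sub>M prob_algebra borel"
      using sp by (intro measurable_If measurable_const) measurable
    then show "(\<lambda>(x, z). threshold_response \<alpha> m i x z) \<in> borel \<Otimes>\<^sub>M histories i \<rightarrow>\<^sub>M prob_algebra borel"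
      by (simp add: threshold_response_def case_prod_unfold)
  qed
  moreover have "renyi2 (threshold_response \<alpha> m i x z) (threshold_response \<alpha> m i x' z) \<le> ereal (\<epsilon>\<^sup>2)" for i x x' z
  proof -
    have "renyi2 (threshold_response \<alpha> m i x z) (threshold_response \<alpha> m i x' z) \<le> ereal (8 * \<alpha>\<^sup>2)"
      unfolding threshold_response_def using \<alpha> by (auto intro!: renyi2_biased_sign)
    also have "\<dots> \<le> ereal (\<epsilon>\<^sup>2)" using \<alpha> by simp
    finally show ?thesis .
  qed
  ultimately show ?thesis by (simp add: renyi_private_channels_def)
qed

text \<open>The mixture over the data is again a biased sign, whose bias is linear in the probability of the
bit.\<close>

lemma nn_integral_threshold_response:
  fixes \<alpha> m :: real
  assumes \<alpha>: "0 \<le> \<alpha>" "\<alpha> \<le> 1 / 2" and P: "prob_space P" "sets P = sets borel"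
    and w[measurable]: "w \<in> borel_measurable borel"
  defines "\<beta> \<equiv> \<alpha> * (2 * measure P {m<..} - 1)"
  shows "(\<integral>\<^sup>+x. \<integral>\<^sup>+y. w y \<partial>threshold_response \<alpha> m i x z \<partial>P) = ennreal ((1 - \<beta>) / 2) * w (- 1) + ennreal ((1 + \<beta>) / 2) * w 1"
proof -
  interpret P: prob_space P by fact
  define p where "p = measure P {m<..}"
  have p: "0 \<le> p" "p \<le> 1" by (auto simp: p_def)
  have sP: "space P = UNIV" using sets_eq_imp_space_eq[OF P(2)] by simp
  define F where "F b = (\<integral>\<^sup>+y. w y \<partial>biased_sign b)" for b
  have "(\<integral>\<^sup>+x. \<integral>\<^sup>+y. w y \<partial>threshold_response \<alpha> m i x z \<partial>P) = (\<integral>\<^sup>+x. F \<alpha> * indicator {m<..} x + F (- \<alpha>) * indicator {..m} x \<partial>P)"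
    by (intro nn_integral_cong) (auto simp: threshold_response_def F_def indicator_def)
  also have "\<dots> = F \<alpha> * ennreal p + F (- \<alpha>) * ennreal (1 - p)"
  proof -
    have "- {m<..} = {..m}" by auto
    then have "measure P {..m} = 1 - p"
      using P.prob_compl[of "{m<..}"] by (simp add: P(2) sP p_def Compl_eq_Diff_UNIV)
    then show ?thesis
      by (subst nn_integral_add) (auto simp: measurable_cong_sets[OF P(2) refl] P(2) nn_integral_cmult_indicator P.emeasure_eq_measure p_def)
  qed
  also have "F \<alpha> = ennreal ((1 - \<alpha>) / 2) * w (- 1) + ennreal ((1 + \<alpha>) / 2) * w 1"
    unfolding F_def using \<alpha> by (intro nn_integral_biased_sign) auto
  also have "F (- \<alpha>) = ennreal ((1 + \<alpha>) / 2) * w (- 1) + ennreal ((1 - \<alpha>) / 2) * w 1"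
    unfolding F_def using \<alpha> by (subst nn_integral_biased_sign) auto
  also have "(ennreal ((1 - \<alpha>) / 2) * w (- 1) + ennreal ((1 + \<alpha>) / 2) * w 1) * ennreal p
      + (ennreal ((1 + \<alpha>) / 2) * w (- 1) + ennreal ((1 - \<alpha>) / 2) * w 1) * ennreal (1 - p)
    = (ennreal ((1 - \<alpha>) / 2) * ennreal p + ennreal ((1 + \<alpha>) / 2) * ennreal (1 - p)) * w (- 1)
      + (ennreal ((1 + \<alpha>) / 2) * ennreal p + ennreal ((1 - \<alpha>) / 2) * ennreal (1 - p)) * w 1"
    by (simp only: distrib_left distrib_right ac_simps)
  also have "ennreal ((1 - \<alpha>) / 2) * ennreal p + ennreal ((1 + \<alpha>) / 2) * ennreal (1 - p)
      = ennreal ((1 - \<alpha>) / 2 * p + (1 + \<alpha>) / 2 * (1 - p))"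
    using \<alpha> p by (intro ennreal_mult_add_mult) auto
  also have "(1 - \<alpha>) / 2 * p + (1 + \<alpha>) / 2 * (1 - p) = (1 - \<beta>) / 2"
    by (simp add: \<beta>_def p_def[symmetric] field_simps)
  also have "ennreal ((1 + \<alpha>) / 2) * ennreal p + ennreal ((1 - \<alpha>) / 2) * ennreal (1 - p)
      = ennreal ((1 + \<alpha>) / 2 * p + (1 - \<alpha>) / 2 * (1 - p))"
    using \<alpha> p by (intro ennreal_mult_add_mult) auto
  also have "(1 + \<alpha>) / 2 * p + (1 - \<alpha>) / 2 * (1 - p) = (1 + \<beta>) / 2"
    by (simp add: \<beta>_def p_def[symmetric] field_simps)
  finally show ?thesis .
qed

text \<open>If the law of an output does not depend on the history, products over the outputs integrate to
powers, as for independent outputs.\<close>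

lemma nn_integral_prod_output_law:
  assumes Q: "is_channel n Q" and P: "prob_space P" "sets P = sets borel" and i: "i \<le> n"
    and w[measurable]: "w \<in> borel_measurable (borel :: real measure)"
    and I: "\<And>i z. i < n \<Longrightarrow> (\<integral>\<^sup>+x. \<integral>\<^sup>+y. w y \<partial>Q i x z \<partial>P) = (I :: ennreal)"
  shows "(\<integral>\<^sup>+z. (\<Prod>j<i. w (z j)) \<partial>output_law Q P i) = I ^ i"
  using i
proof (induction i)
  case 0
  then show ?case by (subst output_law.simps, subst nn_integral_return) (auto simp: space_PiM)
next
  case (Suc i)
  then have i: "i < n" by simp
  have [measurable]: "(\<lambda>z. \<Prod>j<k. w (z j)) \<in> borel_measurable (histories k)" for k by measurable
  have o: "sets (output_law Q P i) = sets (histories i)"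
    using output_law_prob[OF Q P, of i] i by (simp add: space_prob_algebra)
  have "(\<integral>\<^sup>+z. (\<Prod>j<Suc i. w (z j)) \<partial>output_law Q P (Suc i))
      = (\<integral>\<^sup>+z. \<integral>\<^sup>+x. \<integral>\<^sup>+y. (\<Prod>j<Suc i. w ((z(i := y)) j)) \<partial>Q i x z \<partial>P \<partial>output_law Q P i)"
    by (rule nn_integral_output_law_Suc[OF Q i P]) simp
  also have "\<dots> = (\<integral>\<^sup>+z. (\<Prod>j<i. w (z j)) * I \<partial>output_law Q P i)"
  proof (rule nn_integral_cong)
    fix z assume "z \<in> space (output_law Q P i)"
    then have z: "z \<in> space (histories i)" using sets_eq_imp_space_eq[OF o] by simp
    have Qx: "sets (Q i x z) = sets borel" for x
      using measurable_space[OF channel_section[OF Q i z], of x] by (simp add: space_prob_algebra)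
    have wQ: "w \<in> borel_measurable (Q i x z)" for x using w by (simp add: measurable_cong_sets[OF Qx refl])
    have mP: "(\<lambda>x. \<integral>\<^sup>+y. w y \<partial>Q i x z) \<in> borel_measurable P"
      using measurable_compose[OF measurable_prob_algebraD[OF channel_section[OF Q i z]] nn_integral_measurable_subprob_algebra[OF w]]
      by (simp add: measurable_cong_sets[OF P(2) refl])
    have "(\<Prod>j<Suc i. w ((z(i := y)) j)) = (\<Prod>j<i. w (z j)) * w y" for y
    proof -
      have "(\<Prod>j<i. w ((z(i := y)) j)) = (\<Prod>j<i. w (z j))" by (rule prod.cong) auto
      then show ?thesis by (simp add: lessThan_Suc mult.commute)
    qed
    then have "(\<integral>\<^sup>+x. \<integral>\<^sup>+y. (\<Prod>j<Suc i. w ((z(i := y)) j)) \<partial>Q i x z \<partial>P) = (\<integral>\<^sup>+x. (\<Prod>j<i. w (z j)) * (\<integral>\<^sup>+y. w y \<partial>Q i x z) \<partial>P)"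
      using wQ by (simp add: nn_integral_cmult)
    also have "\<dots> = (\<Prod>j<i. w (z j)) * (\<integral>\<^sup>+x. \<integral>\<^sup>+y. w y \<partial>Q i x z \<partial>P)"
      using mP by (rule nn_integral_cmult)
    finally show "(\<integral>\<^sup>+x. \<integral>\<^sup>+y. (\<Prod>j<Suc i. w ((z(i := y)) j)) \<partial>Q i x z \<partial>P) = (\<Prod>j<i. w (z j)) * I"
      using I[OF i] by simp
  qed
  also have "\<dots> = (\<integral>\<^sup>+z. (\<Prod>j<i. w (z j)) \<partial>output_law Q P i) * I"
    by (rule nn_integral_multc) (simp add: measurable_cong_sets[OF o refl])
  also have "\<dots> = I ^ Suc i" using Suc by (simp add: mult.commute)
  finally show ?case .
qed

text \<open>The defect in the arithmetic-geometric mean inequality; integrated over two densities it bounds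
their Hellinger affinity away from \<open>1\<close>.\<close>

lemma sqrt_mult_le_defect:
  fixes a b :: real
  assumes "0 \<le> a" "a \<le> 2" "0 \<le> b" "b \<le> 2"
  shows "sqrt (a * b) \<le> (a + b) / 2 - (a - b)\<^sup>2 / 16"
proof -
  define x y where "x = sqrt a" and "y = sqrt b"
  have xy: "0 \<le> x" "0 \<le> y" "x\<^sup>2 = a" "y\<^sup>2 = b" using assms by (auto simp: x_def y_def)
  have "(x + y)\<^sup>2 \<le> 2 * x\<^sup>2 + 2 * y\<^sup>2" using zero_le_power2[of "x - y"] by (simp add: power2_eq_square algebra_simps)
  then have "(x - y)\<^sup>2 * (x + y)\<^sup>2 \<le> (x - y)\<^sup>2 * 8" using assms xy by (intro mult_left_mono) auto
  moreover have "(x - y)\<^sup>2 * (x + y)\<^sup>2 = (a - b)\<^sup>2" unfolding xy(3,4)[symmetric] by (simp add: power2_eq_square algebra_simps)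
  moreover have "(x - y)\<^sup>2 = a + b - 2 * (x * y)" unfolding xy(3,4)[symmetric] by (simp add: power2_eq_square algebra_simps)
  moreover have "sqrt (a * b) = x * y" by (simp add: x_def y_def real_sqrt_mult)
  ultimately show ?thesis by argo
qed

text \<open>The likelihood-ratio test on randomized responses to the bit \<open>x > m\<close>. By Markov's inequality for
the square root of the likelihood ratio, both error probabilities are at most the \<open>n\<close>-th power of
the Hellinger affinity of one response. An exponential bound is needed, not just one of order
\<open>1 / n\<close>: far alternatives are charged \<open>B\<close>, and the constant in the rate must not depend on \<open>B\<close>.\<close>

lemma two_point_risk_upper:
  fixes \<theta> :: "real measure \<Rightarrow> real"
  assumes \<alpha>: "0 \<le> \<alpha>" "\<alpha> \<le> 1 / 2" "8 * \<alpha>\<^sup>2 \<le> \<epsilon>\<^sup>2"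
    and P0: "prob_space P\<^sub>0" "sets P\<^sub>0 = sets borel" and P1: "prob_space P\<^sub>1" "sets P\<^sub>1 = sets borel"
    and B: "0 < B"
  defines "L \<equiv> trunc_sq_loss B"
  shows "(INF (est, Q)\<in>borel_measurable (histories n) \<times> renyi_private_channels \<epsilon> n.
        max (risk n \<theta> L est Q P\<^sub>0) (risk n \<theta> L est Q P\<^sub>1))
    \<le> ennreal (L (\<theta> P\<^sub>1 - \<theta> P\<^sub>0) * exp (- (real n * \<alpha>\<^sup>2 * (measure P\<^sub>1 {m<..} - measure P\<^sub>0 {m<..})\<^sup>2 / 4)))"
proof -
  define Q where "Q = threshold_response \<alpha> m"
  have Q: "Q \<in> renyi_private_channels \<epsilon> n" unfolding Q_def by (rule threshold_response_private[OF \<alpha>])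
  then have Qc: "is_channel n Q" by (simp add: renyi_private_channels_def)
  define \<beta> where "\<beta> P = \<alpha> * (2 * measure P {m<..} - 1)" for P :: "real measure"
  have \<beta>: "\<bar>\<beta> P\<bar> \<le> 1 / 2" if "prob_space P" for P
  proof -
    interpret prob_space P by fact
    have "\<bar>2 * measure P {m<..} - 1\<bar> \<le> 1" using prob_le_1[of "{m<..}"] measure_nonneg[of P "{m<..}"] by linarith
    then have "\<bar>\<beta> P\<bar> \<le> \<alpha> * 1" unfolding \<beta>_def abs_mult using \<alpha> by (intro mult_mono) auto
    then show ?thesis using \<alpha> by simp
  qed
  define v where "v P P' y = sqrt ((1 + \<beta> P' * response_sign y) / (1 + \<beta> P * response_sign y))" for P P' y
  have [measurable]: "v P P' \<in> borel_measurable borel" for P P' unfolding v_def by measurable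
  have v0: "0 \<le> v P P' y" if "prob_space P" "prob_space P'" for P P' y
    using \<beta>[OF that(1)] \<beta>[OF that(2)] by (auto simp: v_def response_sign_def)
  have E: "(\<integral>\<^sup>+z. (\<Prod>j<n. ennreal (v P P' (z j))) \<partial>output_law Q P n) \<le> ennreal (exp (- (real n * ((\<beta> P' - \<beta> P)\<^sup>2 / 16))))"
    if P: "prob_space P" "sets P = sets borel" and P': "prob_space P'" for P P'
  proof -
    let ?a = "\<beta> P" and ?b = "\<beta> P'"
    note ab = \<beta>[OF P(1)] \<beta>[OF P']
    have sq: "x * sqrt (y / x) = sqrt (x * y)" if "0 < x" "0 < y" for x y :: real
    proof -
      have "x * y = x\<^sup>2 * (y / x)" using that by (simp add: power2_eq_square)
      then have "sqrt (x * y) = sqrt (x\<^sup>2) * sqrt (y / x)" by (simp only: real_sqrt_mult)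
      then show ?thesis using that by simp
    qed
    have "(\<integral>\<^sup>+z. (\<Prod>j<n. ennreal (v P P' (z j))) \<partial>output_law Q P n)
        = (ennreal ((1 - ?a) / 2) * ennreal (v P P' (- 1)) + ennreal ((1 + ?a) / 2) * ennreal (v P P' 1)) ^ n"
      unfolding \<beta>_def
      by (rule nn_integral_prod_output_law[OF Qc P order_refl])
        (simp_all add: Q_def nn_integral_threshold_response[OF \<alpha>(1,2) P])
    also have "\<dots> = ennreal ((1 - ?a) / 2 * v P P' (- 1) + (1 + ?a) / 2 * v P P' 1) ^ n"
      using ab v0[OF P(1) P'] by (subst ennreal_mult_add_mult) auto
    also have "(1 - ?a) / 2 * v P P' (- 1) + (1 + ?a) / 2 * v P P' 1 = ((1 - ?a) * v P P' (- 1) + (1 + ?a) * v P P' 1) / 2"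
      by (simp add: add_divide_distrib)
    also have "((1 - ?a) * v P P' (- 1) + (1 + ?a) * v P P' 1) / 2 = (sqrt ((1 - ?a) * (1 - ?b)) + sqrt ((1 + ?a) * (1 + ?b))) / 2"
      using ab by (simp add: v_def response_sign_def sq)
    also have "ennreal \<dots> ^ n \<le> ennreal (exp (- ((?b - ?a)\<^sup>2 / 16))) ^ n"
    proof (intro power_mono ennreal_leI)
      have "sqrt ((1 - ?a) * (1 - ?b)) \<le> (1 - ?a + (1 - ?b)) / 2 - (1 - ?a - (1 - ?b))\<^sup>2 / 16"
        using ab by (intro sqrt_mult_le_defect) auto
      moreover have "sqrt ((1 + ?a) * (1 + ?b)) \<le> (1 + ?a + (1 + ?b)) / 2 - (1 + ?a - (1 + ?b))\<^sup>2 / 16"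
        using ab by (intro sqrt_mult_le_defect) auto
      moreover have sq: "(1 - ?a - (1 - ?b))\<^sup>2 = (?b - ?a)\<^sup>2" "(1 + ?a - (1 + ?b))\<^sup>2 = (?b - ?a)\<^sup>2"
        by (simp_all add: power2_commute)
      ultimately have "(sqrt ((1 - ?a) * (1 - ?b)) + sqrt ((1 + ?a) * (1 + ?b))) / 2 \<le> 1 + - ((?b - ?a)\<^sup>2 / 16)"
        unfolding sq by argo
      also have "\<dots> \<le> exp (- ((?b - ?a)\<^sup>2 / 16))" by (rule exp_ge_add_one_self)
      finally show "(sqrt ((1 - ?a) * (1 - ?b)) + sqrt ((1 + ?a) * (1 + ?b))) / 2 \<le> exp (- ((?b - ?a)\<^sup>2 / 16))" .
    qed simp
    also have "\<dots> = ennreal (exp (- (real n * ((?b - ?a)\<^sup>2 / 16))))"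
      by (simp add: ennreal_power exp_of_nat_mult[symmetric])
    finally show ?thesis .
  qed
  define LR where "LR z = (\<Prod>j<n. v P\<^sub>0 P\<^sub>1 (z j))" for z :: "nat \<Rightarrow> real"
  have LRm[measurable]: "LR \<in> borel_measurable (histories n)" unfolding LR_def by measurable
  \<comment> \<open>\<open>LR\<close> is the square root of the likelihood ratio, which does not change the test.\<close>
  define est where "est z = (if 1 \<le> LR z then \<theta> P\<^sub>1 else \<theta> P\<^sub>0)" for z
  have est: "est \<in> borel_measurable (histories n)" unfolding est_def by measurable
  define loss where "loss = L (\<theta> P\<^sub>1 - \<theta> P\<^sub>0)"
  have loss: "0 \<le> loss" "L (\<theta> P\<^sub>0 - \<theta> P\<^sub>1) = loss" "L 0 = 0"
    using B by (auto simp: loss_def L_def trunc_sq_loss_def power2_commute)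
  have o: "sets (output_law Q P n) = sets (histories n)" if "prob_space P" "sets P = sets borel" for P
    using output_law_prob[OF Qc that, of n] by (simp add: space_prob_algebra)
  have rt: "risk n \<theta> L est Q P \<le> ennreal loss * ennreal (exp (- (real n * ((\<beta> P' - \<beta> P)\<^sup>2 / 16))))"
    if P: "prob_space P" "sets P = sets borel" and P': "prob_space P'"
      and pt: "\<And>z. L (est z - \<theta> P) \<le> loss * (\<Prod>j<n. v P P' (z j))" for P P'
  proof -
    have "risk n \<theta> L est Q P \<le> (\<integral>\<^sup>+z. ennreal loss * (\<Prod>j<n. ennreal (v P P' (z j))) \<partial>output_law Q P n)"
      unfolding risk_def
    proof (rule nn_integral_mono)
      fix z
      have "ennreal (L (est z - \<theta> P)) \<le> ennreal (loss * (\<Prod>j<n. v P P' (z j)))" using pt by (rule ennreal_leI)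
      then show "ennreal (L (est z - \<theta> P)) \<le> ennreal loss * (\<Prod>j<n. ennreal (v P P' (z j)))"
        using loss v0[OF P(1) P'] by (simp add: ennreal_mult prod_ennreal prod_nonneg)
    qed
    also have "\<dots> = ennreal loss * (\<integral>\<^sup>+z. (\<Prod>j<n. ennreal (v P P' (z j))) \<partial>output_law Q P n)"
      by (rule nn_integral_cmult) (simp add: measurable_cong_sets[OF o[OF P] refl])
    also have "\<dots> \<le> ennreal loss * ennreal (exp (- (real n * ((\<beta> P' - \<beta> P)\<^sup>2 / 16))))"
      by (intro mult_left_mono E[OF P P']) simp
    finally show ?thesis .
  qed
  have r0: "risk n \<theta> L est Q P\<^sub>0 \<le> ennreal loss * ennreal (exp (- (real n * ((\<beta> P\<^sub>1 - \<beta> P\<^sub>0)\<^sup>2 / 16))))"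
  proof (rule rt[OF P0 P1(1)])
    fix z
    have "0 \<le> LR z" unfolding LR_def using v0[OF P0(1) P1(1)] by (intro prod_nonneg) auto
    then show "L (est z - \<theta> P\<^sub>0) \<le> loss * (\<Prod>j<n. v P\<^sub>0 P\<^sub>1 (z j))"
      unfolding LR_def[symmetric] est_def using loss mult_left_mono[of 1 "LR z" loss] by (auto simp: loss_def)
  qed
  have r1: "risk n \<theta> L est Q P\<^sub>1 \<le> ennreal loss * ennreal (exp (- (real n * ((\<beta> P\<^sub>0 - \<beta> P\<^sub>1)\<^sup>2 / 16))))"
  proof (rule rt[OF P1 P0(1)])
    fix z
    have "v P\<^sub>1 P\<^sub>0 y = inverse (v P\<^sub>0 P\<^sub>1 y)" for y by (simp add: v_def real_sqrt_divide)
    then have inv: "(\<Prod>j<n. v P\<^sub>1 P\<^sub>0 (z j)) = inverse (LR z)" unfolding LR_def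
      using prod_dividef[of "\<lambda>_. 1" "\<lambda>j. v P\<^sub>0 P\<^sub>1 (z j)" "{..<n}"] by (simp add: inverse_eq_divide)
    have vpos: "0 < v P\<^sub>0 P\<^sub>1 y" for y
      using \<beta>[OF P0(1)] \<beta>[OF P1(1)] by (auto simp: v_def response_sign_def)
    have "0 < LR z" unfolding LR_def using vpos by (intro prod_pos) auto
    then show "L (est z - \<theta> P\<^sub>1) \<le> loss * (\<Prod>j<n. v P\<^sub>1 P\<^sub>0 (z j))"
      unfolding inv est_def using loss mult_left_mono[of 1 "inverse (LR z)" loss] by (auto simp: one_le_inverse_iff)
  qed
  have \<beta>d: "(\<beta> P\<^sub>1 - \<beta> P\<^sub>0)\<^sup>2 / 16 = \<alpha>\<^sup>2 * (measure P\<^sub>1 {m<..} - measure P\<^sub>0 {m<..})\<^sup>2 / 4"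
  proof -
    have "\<beta> P\<^sub>1 - \<beta> P\<^sub>0 = 2 * \<alpha> * (measure P\<^sub>1 {m<..} - measure P\<^sub>0 {m<..})" by (simp add: \<beta>_def algebra_simps)
    then show ?thesis by (simp add: power_mult_distrib)
  qed
  have "max (risk n \<theta> L est Q P\<^sub>0) (risk n \<theta> L est Q P\<^sub>1)
      \<le> ennreal (loss * exp (- (real n * \<alpha>\<^sup>2 * (measure P\<^sub>1 {m<..} - measure P\<^sub>0 {m<..})\<^sup>2 / 4)))"
    using r0 r1 loss unfolding power2_commute[of "\<beta> P\<^sub>0"] \<beta>d by (simp add: ennreal_mult mult_ac)
  then show ?thesis unfolding loss_def using est Q
    by (intro INF_lower2[of "(est, Q)"]) auto
qed

section \<open>Sub-models and scores\<close>


lemma emeasure_sum_measure: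
  assumes P: "sets P = sets borel" "sets P' = sets borel" and A: "A \<in> sets borel"
  shows "emeasure (sum_measure P P') A = emeasure P A + emeasure P' A"
  unfolding sum_measure_def
proof (rule emeasure_measure_of_sigma[OF _ _ _ A])
  show "sigma_algebra UNIV (sets (borel :: real measure))" using sets.sigma_algebra_axioms[of "borel :: real measure"] by simp
  show "positive (sets borel) (\<lambda>A. emeasure P A + emeasure P' A)" by (simp add: positive_def)
  show "countably_additive (sets borel) (\<lambda>A. emeasure P A + emeasure P' A)"
  proof (rule countably_additiveI)
    fix F :: "nat \<Rightarrow> real set" assume F: "range F \<subseteq> sets borel" "disjoint_family F"
    have "(\<Sum>i. emeasure P (F i) + emeasure P' (F i)) = (\<Sum>i. emeasure P (F i)) + (\<Sum>i. emeasure P' (F i))"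
      by (rule suminf_add[symmetric]) auto
    then show "(\<Sum>i. emeasure P (F i) + emeasure P' (F i)) = emeasure P (\<Union> (range F)) + emeasure P' (\<Union> (range F))"
      using F P by (simp add: suminf_emeasure)
  qed
qed

lemma sets_sum_measure [simp]: "sets (sum_measure P P') = sets borel"
  and space_sum_measure [simp]: "space (sum_measure P P') = UNIV"
  using sets.sigma_sets_eq[of "borel :: real measure"] by (simp_all add: sum_measure_def)

lemma density_sum_measure:
  assumes P: "prob_space P" "sets P = sets borel" and P': "prob_space P'" "sets P' = sets borel"
    and N: "N = P \<or> N = P'"
  defines "\<nu> \<equiv> sum_measure P P'"
  shows "density \<nu> (\<lambda>x. ennreal (enn2real (RN_deriv \<nu> N x))) = N"
proof -
  interpret P: prob_space P by fact
  interpret P': prob_space P' by fact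
  have em: "emeasure \<nu> A = emeasure P A + emeasure P' A" if "A \<in> sets borel" for A
    unfolding \<nu>_def using emeasure_sum_measure[OF P(2) P'(2) that] .
  have fin: "finite_measure \<nu>"
    by (rule finite_measureI) (use em[of UNIV] in \<open>simp add: \<nu>_def P.emeasure_finite P'.emeasure_finite\<close>)
  interpret \<nu>: finite_measure \<nu> by fact
  interpret N: prob_space N using P P' N by auto
  have sN: "sets N = sets \<nu>" using P P' N by (auto simp: \<nu>_def)
  have ac: "absolutely_continuous \<nu> N"
    unfolding absolutely_continuous_def using em sN N by (auto simp: null_sets_def \<nu>_def)
  have "AE x in \<nu>. RN_deriv \<nu> N x \<noteq> \<infinity>"
    by (rule \<nu>.RN_deriv_finite[OF N.sigma_finite_measure_axioms ac sN])
  then have "density \<nu> (\<lambda>x. ennreal (enn2real (RN_deriv \<nu> N x))) = density \<nu> (RN_deriv \<nu> N)"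
    by (intro density_cong) (auto simp: less_top)
  also have "\<dots> = N" by (rule \<nu>.density_RN_deriv[OF ac sN])
  finally show "density \<nu> (\<lambda>x. ennreal (enn2real (RN_deriv \<nu> N x))) = N" .
qed

text \<open>The remainder controls every test function dominated by the weight, by integrating \<open>\<phi>\<close> against
the signed density \<open>p - q - h * g * q\<close>.\<close>

lemma remainder_bound:
  assumes P: "prob_space P" "sets P = sets borel" and P0: "prob_space P\<^sub>0" "sets P\<^sub>0 = sets borel"
    and w[measurable]: "w \<in> borel_measurable borel" and g[measurable]: "g \<in> borel_measurable borel"
    and rem: "remainder w P\<^sub>0 P g h \<le> ennreal \<rho>" and \<rho>: "0 \<le> \<rho>" and c: "0 \<le> c"
    and \<phi>[measurable]: "\<phi> \<in> borel_measurable borel"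
    and AE: "AE x in P. \<bar>\<phi> x\<bar> \<le> c * w x" "AE x in P\<^sub>0. \<bar>\<phi> x\<bar> \<le> c * w x"
    and I: "integrable P \<phi>" "integrable P\<^sub>0 \<phi>" "integrable P\<^sub>0 (\<lambda>x. \<phi> x * g x)"
  shows "\<bar>(\<integral>x. \<phi> x \<partial>P) - (\<integral>x. \<phi> x \<partial>P\<^sub>0) - h * (\<integral>x. \<phi> x * g x \<partial>P\<^sub>0)\<bar> \<le> c * \<rho>"
proof -
  define \<nu> where "\<nu> = sum_measure P P\<^sub>0"
  have [measurable_cong, simp]: "sets \<nu> = sets borel" "space \<nu> = UNIV" by (simp_all add: \<nu>_def)
  define p where "p x = enn2real (RN_deriv \<nu> P x)" for x
  define q where "q x = enn2real (RN_deriv \<nu> P\<^sub>0 x)" for x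
  have [measurable]: "p \<in> borel_measurable \<nu>" "q \<in> borel_measurable \<nu>" unfolding p_def q_def by measurable
  have p0: "AE x in \<nu>. 0 \<le> p x" "AE x in \<nu>. 0 \<le> q x" by (simp_all add: p_def q_def)
  have dP: "density \<nu> (\<lambda>x. ennreal (p x)) = P" and dP0: "density \<nu> (\<lambda>x. ennreal (q x)) = P\<^sub>0"
    unfolding \<nu>_def p_def q_def by (rule density_sum_measure[OF P P0]; simp)+
  have IP: "integrable \<nu> (\<lambda>x. p x * f x)" "(\<integral>x. f x \<partial>P) = (\<integral>x. p x * f x \<partial>\<nu>)"
    if [measurable]: "f \<in> borel_measurable borel" and "integrable P f" for f :: "real \<Rightarrow> real"
    using that p0 integrable_density[of f \<nu> p] integral_density[of f \<nu> p] by (simp_all add: dP)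
  have IQ: "integrable \<nu> (\<lambda>x. q x * f x)" "(\<integral>x. f x \<partial>P\<^sub>0) = (\<integral>x. q x * f x \<partial>\<nu>)"
    if [measurable]: "f \<in> borel_measurable borel" and "integrable P\<^sub>0 f" for f :: "real \<Rightarrow> real"
    using that p0 integrable_density[of f \<nu> q] integral_density[of f \<nu> q] by (simp_all add: dP0)
  define D where "D x = p x - q x - h * g x * q x" for x
  have [measurable]: "D \<in> borel_measurable \<nu>" unfolding D_def by measurable
  have rem': "(\<integral>\<^sup>+x. ennreal (w x * \<bar>D x\<bar>) \<partial>\<nu>) \<le> ennreal \<rho>"
    using rem unfolding remainder_def Let_def D_def p_def q_def \<nu>_def .
  have ID: "integrable \<nu> (\<lambda>x. \<phi> x * D x)"
    and eq: "(\<integral>x. \<phi> x \<partial>P) - (\<integral>x. \<phi> x \<partial>P\<^sub>0) - h * (\<integral>x. \<phi> x * g x \<partial>P\<^sub>0) = (\<integral>x. \<phi> x * D x \<partial>\<nu>)"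
  proof -
    have e: "\<phi> x * D x = p x * \<phi> x - q x * \<phi> x - h * (q x * (\<phi> x * g x))" for x by (simp add: D_def algebra_simps)
    note i = IP(1)[OF \<phi> I(1)] IQ(1)[OF \<phi> I(2)] IQ(1)[OF _ I(3)]
    show "integrable \<nu> (\<lambda>x. \<phi> x * D x)" unfolding e using i by simp
    show "(\<integral>x. \<phi> x \<partial>P) - (\<integral>x. \<phi> x \<partial>P\<^sub>0) - h * (\<integral>x. \<phi> x * g x \<partial>P\<^sub>0) = (\<integral>x. \<phi> x * D x \<partial>\<nu>)"
      unfolding e using i IP(2)[OF \<phi> I(1)] IQ(2)[OF \<phi> I(2)] IQ(2)[OF _ I(3)] by simp
  qed
  define N where "N = {x. \<not> \<bar>\<phi> x\<bar> \<le> c * w x}"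
  have N: "N \<in> sets borel" unfolding N_def by measurable
  have "emeasure P N = 0" "emeasure P\<^sub>0 N = 0"
    using AE[THEN AE_E2] P P0 sets_eq_imp_space_eq[OF P(2)] sets_eq_imp_space_eq[OF P0(2)] N by (simp_all add: N_def)
  then have "emeasure \<nu> N = 0" unfolding \<nu>_def by (subst emeasure_sum_measure[OF P(2) P0(2) N]) simp
  then have AE\<nu>: "AE x in \<nu>. \<bar>\<phi> x\<bar> \<le> c * w x"
    using N by (intro AE_I[of _ _ N]) (auto simp: N_def)
  have "ennreal (\<integral>x. \<bar>\<phi> x * D x\<bar> \<partial>\<nu>) = (\<integral>\<^sup>+x. ennreal \<bar>\<phi> x * D x\<bar> \<partial>\<nu>)"
    using ID by (subst nn_integral_eq_integral) auto
  also have "\<dots> \<le> (\<integral>\<^sup>+x. ennreal c * ennreal (w x * \<bar>D x\<bar>) \<partial>\<nu>)"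
  proof (rule nn_integral_mono_AE)
    show "AE x in \<nu>. ennreal \<bar>\<phi> x * D x\<bar> \<le> ennreal c * ennreal (w x * \<bar>D x\<bar>)"
      using AE\<nu>
    proof eventually_elim
      case (elim x)
      have "\<bar>\<phi> x * D x\<bar> \<le> c * (w x * \<bar>D x\<bar>)"
        using mult_right_mono[OF elim, of "\<bar>D x\<bar>"] by (simp add: abs_mult mult.assoc)
      then show ?case using c by (simp add: ennreal_mult'[symmetric] ennreal_leI)
    qed
  qed
  also have "\<dots> = ennreal c * (\<integral>\<^sup>+x. ennreal (w x * \<bar>D x\<bar>) \<partial>\<nu>)" by (rule nn_integral_cmult) measurable
  also have "\<dots> \<le> ennreal c * ennreal \<rho>" using rem' by (rule mult_left_mono) simp
  also have "\<dots> = ennreal (c * \<rho>)" using c \<rho> by (simp add: ennreal_mult)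
  finally have "(\<integral>x. \<bar>\<phi> x * D x\<bar> \<partial>\<nu>) \<le> c * \<rho>" using c \<rho> by (subst (asm) ennreal_le_iff) auto
  then show ?thesis unfolding eq using integral_abs_bound[of \<nu> "\<lambda>x. \<phi> x * D x"] by linarith
qed

lemma has_score_remainder:
  assumes "has_score w P\<^sub>0 P g" and "0 < \<eta>"
  obtains d where "0 < d" "\<And>h. h \<noteq> 0 \<Longrightarrow> \<bar>h\<bar> < d \<Longrightarrow> remainder w P\<^sub>0 (P h) g h \<le> ennreal (\<eta> * \<bar>h\<bar>)"
proof -
  have "((\<lambda>h. remainder w P\<^sub>0 (P h) g h / ennreal \<bar>h\<bar>) \<longlongrightarrow> 0) (at 0)"
    using assms(1) by (simp add: has_score_def)
  then have "\<forall>\<^sub>F h in at 0. remainder w P\<^sub>0 (P h) g h / ennreal \<bar>h\<bar> < ennreal \<eta>"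
    using assms(2) by (intro order_tendstoD(2)) auto
  then obtain d where d: "0 < d" "\<And>h. h \<noteq> 0 \<Longrightarrow> \<bar>h\<bar> < d \<Longrightarrow> remainder w P\<^sub>0 (P h) g h / ennreal \<bar>h\<bar> < ennreal \<eta>"
    by (auto simp: eventually_at dist_real_def)
  show thesis
  proof (rule that[OF d(1)])
    fix h :: real assume h: "h \<noteq> 0" "\<bar>h\<bar> < d"
    have "remainder w P\<^sub>0 (P h) g h = remainder w P\<^sub>0 (P h) g h / ennreal \<bar>h\<bar> * ennreal \<bar>h\<bar>"
      using h by (simp add: ennreal_divide_times ennreal_mult_divide_eq)
    also have "\<dots> \<le> ennreal \<eta> * ennreal \<bar>h\<bar>" using d(2)[OF h] by (intro mult_right_mono) auto
    also have "\<dots> = ennreal (\<eta> * \<bar>h\<bar>)" using assms(2) by (simp add: ennreal_mult)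
    finally show "remainder w P\<^sub>0 (P h) g h \<le> ennreal (\<eta> * \<bar>h\<bar>)" .
  qed
qed

lemma nonparametric_classD:
  assumes "P \<in> nonparametric_class \<mu> M"
  shows "prob_space P" "sets P = sets borel" "integrable P (\<lambda>x. x)"
    "mean P \<in> deriv (log_partition \<mu>) ` natural_params \<mu>"
proof -
  show P: "prob_space P" "sets P = sets borel" "mean P \<in> deriv (log_partition \<mu>) ` natural_params \<mu>"
    using assms by (auto simp: nonparametric_class_def)
  interpret prob_space P by fact
  have [measurable_cong]: "sets P = sets borel" by fact
  have "(\<integral>\<^sup>+x. ennreal (\<bar>x\<bar> ^ 4) \<partial>P) < \<infinity>"
    using assms by (auto simp: nonparametric_class_def intro: order.strict_trans1)
  then have I: "integrable P (\<lambda>x. \<bar>x\<bar> ^ 4)" by (intro integrableI_bounded) auto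
  show "integrable P (\<lambda>x. x)"
  proof (rule Bochner_Integration.integrable_bound)
    show "integrable P (\<lambda>x. 1 + \<bar>x\<bar> ^ 4)" using I by simp
    show "AE x in P. norm x \<le> norm (1 + \<bar>x\<bar> ^ 4)"
    proof (rule AE_I2)
      fix x :: real
      have "\<bar>x\<bar> \<le> 1 + \<bar>x\<bar> ^ 4"
      proof (cases "\<bar>x\<bar> \<le> 1")
        case False
        then have "\<bar>x\<bar> ^ 1 \<le> \<bar>x\<bar> ^ 4" by (intro power_increasing) auto
        then show ?thesis by simp
      qed (simp add: add_increasing2)
      then show "norm x \<le> norm (1 + \<bar>x\<bar> ^ 4)" by simp
    qed
  qed measurable
qed

text \<open>The mean has derivative \<open>var P\<close> at \<open>\<theta>\<close>. Far parameters need no continuity of the inverse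
of the mean map: they are separated by the cap \<open>s\<close> in any case.\<close>

lemma param_separation:
  assumes R: "regular_minimal_family \<mu>" and \<theta>: "\<theta> \<in> natural_params \<mu>"
  defines "P \<equiv> exp_member \<mu> \<theta>"
  obtains s where "0 < s"
    "\<And>\<theta>'. \<theta>' \<in> natural_params \<mu> \<Longrightarrow> min s (\<bar>mean (exp_member \<mu> \<theta>') - mean P\<bar> / (2 * var P)) \<le> \<bar>\<theta>' - \<theta>\<bar>"
proof -
  let ?m = "mean P"
  obtain s C where s: "0 < s" and C: "0 < C" and
    exp: "\<And>h \<phi>. \<bar>h\<bar> \<le> s \<Longrightarrow> \<phi> \<in> borel_measurable borel \<Longrightarrow> (\<And>x. \<bar>\<phi> x\<bar> \<le> 1 + \<bar>x - ?m\<bar>) \<Longrightarrow>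
      \<bar>(\<integral>x. \<phi> x \<partial>exp_member \<mu> (\<theta> + h)) - (\<integral>x. \<phi> x \<partial>P) - h * (\<integral>x. \<phi> x * (x - ?m) \<partial>P)\<bar> \<le> C * h\<^sup>2"
    unfolding P_def by (rule exp_family_expansion[OF R \<theta>]) blast
  have V: "0 < var P" using R \<theta> by (auto simp: regular_minimal_family_def P_def)
  show thesis
  proof (rule that[of "min s (var P / C)"])
    show "0 < min s (var P / C)" using s C V by simp
    fix \<theta>' assume \<theta>': "\<theta>' \<in> natural_params \<mu>"
    show "min (min s (var P / C)) (\<bar>mean (exp_member \<mu> \<theta>') - ?m\<bar> / (2 * var P)) \<le> \<bar>\<theta>' - \<theta>\<bar>"
    proof (cases "\<bar>\<theta>' - \<theta>\<bar> \<le> min s (var P / C)")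
      case True
      define h where "h = \<theta>' - \<theta>"
      interpret P: prob_space P unfolding P_def by (rule prob_exp_member[OF R \<theta>])
      interpret P': prob_space "exp_member \<mu> \<theta>'" by (rule prob_exp_member[OF R \<theta>'])
      have th: "\<theta> + h = \<theta>'" by (simp add: h_def)
      have I: "integrable P (\<lambda>x. x)" "integrable (exp_member \<mu> \<theta>') (\<lambda>x. x)"
        unfolding P_def using integrable_poly_exp_member(1)[OF R] \<theta> \<theta>' by auto
      have "\<bar>(\<integral>x. x - ?m \<partial>exp_member \<mu> \<theta>') - (\<integral>x. x - ?m \<partial>P) - h * (\<integral>x. (x - ?m) * (x - ?m) \<partial>P)\<bar> \<le> C * h\<^sup>2"
        using exp[of h "\<lambda>x. x - ?m"] True unfolding th by (simp add: h_def)
      also have "(\<integral>x. x - ?m \<partial>exp_member \<mu> \<theta>') = mean (exp_member \<mu> \<theta>') - ?m"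
        using I by (simp add: P'.prob_space mean_def)
      also have "(\<integral>x. x - ?m \<partial>P) = 0" using I by (simp add: P.prob_space mean_def)
      also have "(\<integral>x. (x - ?m) * (x - ?m) \<partial>P) = var P" by (simp add: var_def power2_eq_square)
      finally have "\<bar>mean (exp_member \<mu> \<theta>') - ?m\<bar> \<le> \<bar>h\<bar> * var P + C * h\<^sup>2"
        using abs_mult_pos[of "var P" h] V by linarith
      also have "C * h\<^sup>2 = \<bar>h\<bar> * (C * \<bar>h\<bar>)" by (simp add: power2_eq_square abs_if)
      also have "\<dots> \<le> \<bar>h\<bar> * var P" using True C by (intro mult_left_mono) (auto simp: h_def field_simps)
      finally have "\<bar>mean (exp_member \<mu> \<theta>') - ?m\<bar> \<le> \<bar>h\<bar> * (2 * var P)" by (simp add: mult_ac)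
      then have "\<bar>mean (exp_member \<mu> \<theta>') - ?m\<bar> / (2 * var P) \<le> \<bar>h\<bar>" using V by (simp add: divide_le_eq)
      then show ?thesis by (simp add: h_def)
    next
      case False
      then show ?thesis by linarith
    qed
  qed
qed

lemma exp_sub_one_le: "exp x - 1 \<le> x * exp x" for x :: real
proof -
  have "1 - x \<le> exp (- x)" using exp_ge_add_one_self[of "- x"] by simp
  then have "(1 - x) * exp x \<le> exp (- x) * exp x" by (intro mult_right_mono) auto
  then show ?thesis by (simp add: algebra_simps flip: exp_add)
qed

text \<open>What the two kinds of sub-models have in common. The weight dominates \<open>\<bar>x\<bar>\<close> up to the factor \<open>C\<close>, which
makes the mean differentiable along sub-models: for data in \<open>[-R, R]\<close> the weight is \<open>1\<close> and \<open>C\<close> is of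
order \<open>R\<close>, on the whole line the weight is \<open>1 + \<bar>x\<bar>\<close> and \<open>C = 1\<close>.\<close>

locale dense_submodels =
  fixes \<mu> :: "real measure" and \<theta>\<^sub>0 M C :: real and P\<^sub>0 :: "real measure" and w :: "real \<Rightarrow> real"
    and \<P> :: "real measure set" and \<S> :: "(real \<Rightarrow> real measure) set"
  assumes regular: "regular_minimal_family \<mu>" and in_params: "\<theta>\<^sub>0 \<in> natural_params \<mu>"
    and base_eq: "P\<^sub>0 = exp_member \<mu> \<theta>\<^sub>0"
    and cls: "\<P> \<subseteq> nonparametric_class \<mu> M"
    and w[measurable]: "w \<in> borel_measurable borel" and w1: "\<And>x. 1 \<le> w x" and wI: "integrable P\<^sub>0 w"
    and C: "0 < C" and dom: "\<And>P. P \<in> \<P> \<Longrightarrow> AE x in P. \<bar>x\<bar> \<le> C * w x"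
    and dense: "submodels_dense_scores w P\<^sub>0 \<P> \<S>"
begin

lemma base_prob: "prob_space P\<^sub>0" "sets P\<^sub>0 = sets borel" "integrable P\<^sub>0 (\<lambda>x. x)"
  using prob_exp_member[OF regular in_params] integrable_poly_exp_member(1)[OF regular in_params] sets_base_measure[OF regular]
  by (simp_all add: base_eq)

interpretation P0: prob_space P\<^sub>0 by (rule base_prob)

lemma [measurable_cong]: "sets P\<^sub>0 = sets borel" by (rule base_prob)

lemma space_base: "space P\<^sub>0 = UNIV" using sets_eq_imp_space_eq[OF base_prob(2)] by simp

lemma submodel:
  assumes "P \<in> \<S>"
  shows "P h \<in> \<P>" "prob_space (P h)" "sets (P h) = sets borel" "integrable (P h) (\<lambda>x. x)"
    "mean (P h) \<in> deriv (log_partition \<mu>) ` natural_params \<mu>"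
proof -
  show "P h \<in> \<P>" using dense assms by (simp add: submodels_dense_scores_def)
  then have "P h \<in> nonparametric_class \<mu> M" using cls by auto
  from nonparametric_classD[OF this] show "prob_space (P h)" "sets (P h) = sets borel" "integrable (P h) (\<lambda>x. x)"
    "mean (P h) \<in> deriv (log_partition \<mu>) ` natural_params \<mu>" by auto
qed

lemma score_integrable:
  assumes "has_score w P\<^sub>0 P g"
  shows "g \<in> borel_measurable borel" "integrable P\<^sub>0 g" "integrable P\<^sub>0 (\<lambda>x. w x * g x)"
proof -
  show [measurable]: "g \<in> borel_measurable borel" and I: "integrable P\<^sub>0 (\<lambda>x. w x * g x)"
    using assms by (auto simp: has_score_def)
  show "integrable P\<^sub>0 g"
  proof (rule Bochner_Integration.integrable_bound[OF I])
    show "AE x in P\<^sub>0. norm (g x) \<le> norm (w x * g x)"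
    proof (rule AE_I2)
      fix x show "norm (g x) \<le> norm (w x * g x)"
        using mult_right_mono[of 1 "\<bar>w x\<bar>" "\<bar>g x\<bar>"] w1[of x] by (simp add: abs_mult)
    qed
  qed simp
qed

lemma dense_score:
  assumes "f \<in> borel_measurable borel" "integrable P\<^sub>0 (\<lambda>x. w x * f x)" "(\<integral>x. f x \<partial>P\<^sub>0) = 0" "0 < e"
  obtains P g where "P \<in> \<S>" "has_score w P\<^sub>0 P g" "(\<integral>x. w x * \<bar>f x - g x\<bar> \<partial>P\<^sub>0) < e"
  using conjunct2[OF dense[unfolded submodels_dense_scores_def], THEN bspec, OF assms(1), rule_format, OF assms(2-4)]
  by blast

lemma submodel_bounded_test:
  assumes P: "P \<in> \<S>" and g: "has_score w P\<^sub>0 P g" and G: "(\<integral>x. \<bar>g x\<bar> \<partial>P\<^sub>0) \<le> G"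
    and rem: "remainder w P\<^sub>0 (P h) g h \<le> ennreal (\<eta> * \<bar>h\<bar>)" and \<eta>: "0 \<le> \<eta>"
    and \<phi>[measurable]: "\<phi> \<in> borel_measurable borel" and b: "\<And>x. \<bar>\<phi> x\<bar> \<le> a"
  shows "\<bar>(\<integral>x. \<phi> x \<partial>P h) - (\<integral>x. \<phi> x \<partial>P\<^sub>0)\<bar> \<le> a * ((\<eta> + G) * \<bar>h\<bar>)"
proof -
  note gi[measurable] = score_integrable[OF g]
  interpret Ph: prob_space "P h" by (rule submodel[OF P])
  have [measurable_cong]: "sets (P h) = sets borel" by (rule submodel[OF P])
  have a: "0 \<le> a" using b[of 0] by linarith
  have aw: "\<bar>\<phi> x\<bar> \<le> a * w x" for x
    using b[of x] mult_left_mono[OF w1 a, of x] by simp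
  have \<phi>g: "\<bar>\<phi> x * g x\<bar> \<le> a * \<bar>g x\<bar>" for x unfolding abs_mult using b by (intro mult_right_mono) auto
  have I: "integrable (P h) \<phi>" "integrable P\<^sub>0 \<phi>" "integrable P\<^sub>0 (\<lambda>x. \<phi> x * g x)"
  proof -
    show "integrable (P h) \<phi>" using b by (intro Ph.integrable_bounded_measurable[where b = a]) auto
    show "integrable P\<^sub>0 \<phi>" using b by (intro P0.integrable_bounded_measurable[where b = a]) auto
    show "integrable P\<^sub>0 (\<lambda>x. \<phi> x * g x)"
      using \<phi>g a gi by (intro Bochner_Integration.integrable_bound[OF integrable_mult_right[OF integrable_abs[OF gi(2)], of a]])
        (auto simp: abs_mult intro!: AE_I2)
  qed
  have "\<bar>(\<integral>x. \<phi> x \<partial>P h) - (\<integral>x. \<phi> x \<partial>P\<^sub>0) - h * (\<integral>x. \<phi> x * g x \<partial>P\<^sub>0)\<bar> \<le> a * (\<eta> * \<bar>h\<bar>)"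
    using \<eta> a aw by (intro remainder_bound[OF submodel(2,3)[OF P] base_prob(1,2) w gi(1) rem _ _ \<phi> _ _ I]) auto
  moreover have "\<bar>\<integral>x. \<phi> x * g x \<partial>P\<^sub>0\<bar> \<le> a * G"
  proof -
    have "\<bar>\<integral>x. \<phi> x * g x \<partial>P\<^sub>0\<bar> \<le> (\<integral>x. \<bar>\<phi> x * g x\<bar> \<partial>P\<^sub>0)" by (rule integral_abs_bound)
    also have "\<dots> \<le> (\<integral>x. a * \<bar>g x\<bar> \<partial>P\<^sub>0)" using I(3) gi(2) \<phi>g by (intro integral_mono) auto
    also have "\<dots> \<le> a * G" using G a by (simp add: mult_left_mono)
    finally show ?thesis .
  qed
  then have "\<bar>h * (\<integral>x. \<phi> x * g x \<partial>P\<^sub>0)\<bar> \<le> \<bar>h\<bar> * (a * G)" unfolding abs_mult by (rule mult_left_mono) simp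
  ultimately have "\<bar>(\<integral>x. \<phi> x \<partial>P h) - (\<integral>x. \<phi> x \<partial>P\<^sub>0)\<bar> \<le> a * (\<eta> * \<bar>h\<bar>) + \<bar>h\<bar> * (a * G)" by linarith
  then show ?thesis by (simp add: algebra_simps)
qed

text \<open>The sub-models put no mass on the violating set and converge to \<open>P\<^sub>0\<close> in total variation.\<close>

lemma base_dominated: "AE x in P\<^sub>0. \<bar>x\<bar> \<le> C * w x"
proof -
  define N where "N = {x. \<not> \<bar>x\<bar> \<le> C * w x}"
  have N: "N \<in> sets borel" unfolding N_def by measurable
  obtain P g where P: "P \<in> \<S>" and g: "has_score w P\<^sub>0 P g"
    by (rule dense_score[of "\<lambda>_. 0" 1]) auto
  note gi[measurable] = score_integrable[OF g]
  obtain d where d: "0 < d" and rem: "\<And>h. h \<noteq> 0 \<Longrightarrow> \<bar>h\<bar> < d \<Longrightarrow> remainder w P\<^sub>0 (P h) g h \<le> ennreal (1 * \<bar>h\<bar>)"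
    by (rule has_score_remainder[OF g zero_less_one]) blast
  define G where "G = (\<integral>x. \<bar>g x\<bar> \<partial>P\<^sub>0)"
  have G: "0 \<le> G" by (simp add: G_def)
  have le: "measure P\<^sub>0 N \<le> (1 + G) * h" if h: "0 < h" "h < d" for h
  proof -
    have "\<bar>(\<integral>x. indicator N x \<partial>P h) - (\<integral>x. indicator N x \<partial>P\<^sub>0)\<bar> \<le> 1 * ((1 + G) * \<bar>h\<bar>)"
      using rem[of h] h N by (intro submodel_bounded_test[OF P g]) (auto simp: G_def)
    moreover have "measure (P h) N = 0"
    proof -
      have "emeasure (P h) N = 0"
        using dom[OF submodel(1)[OF P], of h, THEN AE_E2] N submodel(3)[OF P, of h] sets_eq_imp_space_eq[OF submodel(3)[OF P, of h]]
        by (simp add: N_def)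
      then show ?thesis by (simp add: measure_def)
    qed
    ultimately show ?thesis using h N base_prob(2) submodel(3)[OF P, of h] by simp
  qed
  have "measure P\<^sub>0 N \<le> 0"
  proof (rule ccontr)
    assume "\<not> ?thesis"
    then have pos: "0 < measure P\<^sub>0 N" by simp
    \<comment> \<open>Small enough for the bound \<open>(1 + G) * h\<close> to drop below the supposed mass.\<close>
    define h where "h = min (d / 2) (measure P\<^sub>0 N / (2 * (1 + G)))"
    have h: "0 < h" "h < d" using pos G d by (auto simp: h_def)
    have "(1 + G) * h \<le> (1 + G) * (measure P\<^sub>0 N / (2 * (1 + G)))" using G by (intro mult_left_mono) (auto simp: h_def)
    also have "\<dots> = measure P\<^sub>0 N / 2" using G by (simp add: field_simps)
    finally show False using le[OF h] pos by simp
  qed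
  then have "emeasure P\<^sub>0 N = 0" by (simp add: P0.emeasure_eq_measure measure_le_0_iff)
  then show ?thesis using N base_prob(2) by (intro AE_I[of _ _ N]) (auto simp: N_def)
qed

text \<open>On a one-sided set \<open>S\<close> of probability \<open>p\<close> where \<open>x - m\<close> exceeds \<open>q = sqrt t / 2 * Var\<^sub>0\<close>, the
function \<open>f = 1\<^sub>S / p - 1\<close> has mean zero and \<open>L\<^sup>1\<close> norm at most \<open>2\<close>, yet \<open>E\<^sub>0[f X]\<close> is at
least \<open>q\<close> in absolute value. A sub-model whose score is close to \<open>f\<close> thus moves the parameter at speed
of order \<open>sqrt t\<close> per unit of \<open>L\<^sup>1\<close> distance. The constant is \<open>49152 = 48 * 4\<^sup>2 * 8\<^sup>2\<close>.\<close>

lemma submodel_lower_bound: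
  assumes t: "0 < t" and pos: "0 < measure P\<^sub>0 {x. sqrt t / 2 * var P\<^sub>0 < \<bar>x - mean P\<^sub>0\<bar>}"
    and \<epsilon>: "0 < \<epsilon>" and B: "0 < B"
  shows "\<forall>\<^sub>F n in sequentially.
    ennreal (t / (49152 * (real n * (exp (\<epsilon>\<^sup>2) - 1))))
      \<le> local_minimax n (param_of \<mu>) P\<^sub>0 (trunc_sq_loss B) (all_members \<S>) (renyi_private_channels \<epsilon>)"
proof -
  define m where "m = mean P\<^sub>0"
  define v where "v = var P\<^sub>0"
  have v: "0 < v" using regular in_params by (auto simp: v_def base_eq regular_minimal_family_def)
  define q where "q = sqrt t / 2 * v"
  have q: "0 < q" using t v by (simp add: q_def)
  have m0: "(\<integral>x. x - m \<partial>P\<^sub>0) = 0" using base_prob(3) by (simp add: P0.prob_space m_def mean_def)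
  obtain \<sigma> :: real where \<sigma>: "\<bar>\<sigma>\<bar> = 1" and Spos: "0 < measure P\<^sub>0 {x. q < \<sigma> * (x - m)}"
  proof -
    have "{x. q < \<bar>x - m\<bar>} \<subseteq> {x. q < 1 * (x - m)} \<union> {x. q < - 1 * (x - m)}" by auto
    then have "measure P\<^sub>0 {x. q < \<bar>x - m\<bar>} \<le> measure P\<^sub>0 ({x. q < 1 * (x - m)} \<union> {x. q < - 1 * (x - m)})"
      by (intro P0.finite_measure_mono) (simp_all add: base_prob(2))
    also have "\<dots> \<le> measure P\<^sub>0 {x. q < 1 * (x - m)} + measure P\<^sub>0 {x. q < - 1 * (x - m)}"
      by (intro measure_Un_le) (simp_all add: base_prob(2))
    finally have "0 < measure P\<^sub>0 {x. q < 1 * (x - m)} + measure P\<^sub>0 {x. q < - 1 * (x - m)}"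
      using pos by (simp add: q_def m_def v_def)
    then have "0 < measure P\<^sub>0 {x. q < 1 * (x - m)} \<or> 0 < measure P\<^sub>0 {x. q < - 1 * (x - m)}" by linarith
    then show thesis using that[of 1] that[of "- 1"] by auto
  qed
  define S where "S = {x. q < \<sigma> * (x - m)}"
  define p where "p = measure P\<^sub>0 S"
  have p: "0 < p" using Spos by (simp add: p_def S_def)
  have S[measurable]: "S \<in> sets borel" unfolding S_def by measurable
  have SP: "S \<in> sets P\<^sub>0" by (simp add: base_prob(2))
  have intS: "(\<integral>x. indicator S x \<partial>P\<^sub>0) = p" "integrable P\<^sub>0 (indicator S :: real \<Rightarrow> real)"
    using SP by (simp_all add: p_def integrable_indicator_iff P0.emeasure_finite less_top[symmetric])
  define f where "f x = indicator S x / p - 1" for x :: real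
  have [measurable]: "f \<in> borel_measurable borel" unfolding f_def by measurable
  have f0: "(\<integral>x. f x \<partial>P\<^sub>0) = 0" using intS p by (simp add: f_def P0.prob_space)
  have fS: "\<bar>f x\<bar> \<le> indicator S x / p + 1" for x
    using abs_triangle_ineq4[of "indicator S x / p" 1] p by (simp add: f_def)
  have fb: "\<bar>f x\<bar> \<le> 1 / p + 1" for x
    using fS[of x] p by (cases "x \<in> S") (auto intro: order_trans)
  have wf: "integrable P\<^sub>0 (\<lambda>x. w x * f x)"
  proof (rule Bochner_Integration.integrable_bound[OF integrable_mult_left[OF wI, of "1 / p + 1"]])
    show "AE x in P\<^sub>0. norm (w x * f x) \<le> norm (w x * (1 / p + 1))"
      using p fb by (intro AE_I2) (auto simp: abs_mult intro!: mult_left_mono)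
  qed simp
  have fI: "integrable P\<^sub>0 f" using fb by (intro P0.integrable_bounded_measurable) auto
  have f1: "(\<integral>x. \<bar>f x\<bar> \<partial>P\<^sub>0) \<le> 2"
  proof -
    have "(\<integral>x. \<bar>f x\<bar> \<partial>P\<^sub>0) \<le> (\<integral>x. indicator S x / p + 1 \<partial>P\<^sub>0)"
      using fI intS fS by (intro integral_mono) auto
    also have "\<dots> = 2" using intS p by (simp add: P0.prob_space)
    finally show ?thesis .
  qed
  have xfI: "integrable P\<^sub>0 (\<lambda>x. x * f x)"
  proof (rule Bochner_Integration.integrable_bound[OF integrable_mult_left[OF base_prob(3), of "1 / p + 1"]])
    show "AE x in P\<^sub>0. norm (x * f x) \<le> norm (x * (1 / p + 1))"
      using p fb by (intro AE_I2) (auto simp: abs_mult intro!: mult_left_mono)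
  qed simp
  have xf: "q \<le> \<bar>\<integral>x. x * f x \<partial>P\<^sub>0\<bar>"
  proof -
    have I1: "integrable P\<^sub>0 (\<lambda>x. (x - m) * indicator S x)"
      using base_prob(3) SP by (intro integrable_real_mult_indicator) auto
    have "(\<integral>x. x * f x \<partial>P\<^sub>0) = (\<integral>x. x * f x - m * f x \<partial>P\<^sub>0)" using xfI fI f0 by simp
    also have "\<dots> = (\<integral>x. ((x - m) * indicator S x) / p - (x - m) \<partial>P\<^sub>0)"
      by (intro Bochner_Integration.integral_cong) (auto simp: f_def algebra_simps diff_divide_distrib)
    also have "\<dots> = (\<integral>x. (x - m) * indicator S x \<partial>P\<^sub>0) / p"
      using I1 base_prob(3) m0 by simp
    finally have e: "(\<integral>x. x * f x \<partial>P\<^sub>0) = (\<integral>x. (x - m) * indicator S x \<partial>P\<^sub>0) / p" .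
    have "q * p = (\<integral>x. q * indicator S x \<partial>P\<^sub>0)" using intS by simp
    also have "\<dots> \<le> (\<integral>x. \<sigma> * ((x - m) * indicator S x) \<partial>P\<^sub>0)"
    proof (rule integral_mono)
      show "integrable P\<^sub>0 (\<lambda>x. q * indicator S x)" using intS by simp
      show "integrable P\<^sub>0 (\<lambda>x. \<sigma> * ((x - m) * indicator S x))" using I1 by simp
      show "q * indicator S x \<le> \<sigma> * ((x - m) * indicator S x)" for x
        by (cases "x \<in> S") (auto simp: S_def)
    qed
    also have "\<dots> = \<sigma> * (\<integral>x. (x - m) * indicator S x \<partial>P\<^sub>0)" by simp
    also have "\<dots> \<le> \<bar>\<sigma> * (\<integral>x. (x - m) * indicator S x \<partial>P\<^sub>0)\<bar>" by (rule abs_ge_self)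
    finally have "q * p \<le> \<bar>\<integral>x. (x - m) * indicator S x \<partial>P\<^sub>0\<bar>" using \<sigma> by (simp add: abs_mult)
    then show ?thesis unfolding e using p by (simp add: pos_le_divide_eq)
  qed
  \<comment> \<open>Replacing \<open>f\<close> by \<open>g\<close>, and then the difference of means by its linear part, costs a quarter of \<open>q\<close> each.\<close>
  define e where "e = min 1 (q / (4 * C))"
  have e: "0 < e" "e \<le> 1" "C * e \<le> q / 4" using q C by (auto simp: e_def min_def field_simps)
  obtain P g where P: "P \<in> \<S>" and g: "has_score w P\<^sub>0 P g" and fg: "(\<integral>x. w x * \<bar>f x - g x\<bar> \<partial>P\<^sub>0) < e"
    by (rule dense_score[OF _ wf f0 e(1)]) simp
  note gi[measurable] = score_integrable[OF g]
  have wfgI: "integrable P\<^sub>0 (\<lambda>x. w x * \<bar>f x - g x\<bar>)"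
  proof -
    have "integrable P\<^sub>0 (\<lambda>x. \<bar>w x * f x - w x * g x\<bar>)" using wf gi by auto
    moreover have "\<bar>w x * f x - w x * g x\<bar> = w x * \<bar>f x - g x\<bar>" for x
      using w1[of x] by (simp add: abs_mult flip: right_diff_distrib)
    ultimately show ?thesis by simp
  qed
  have g1: "(\<integral>x. \<bar>g x\<bar> \<partial>P\<^sub>0) \<le> 3"
  proof -
    have "(\<integral>x. \<bar>g x\<bar> \<partial>P\<^sub>0) \<le> (\<integral>x. \<bar>f x\<bar> + w x * \<bar>f x - g x\<bar> \<partial>P\<^sub>0)"
    proof (rule integral_mono)
      fix x
      have "\<bar>f x - g x\<bar> \<le> w x * \<bar>f x - g x\<bar>" using mult_right_mono[OF w1, of "\<bar>f x - g x\<bar>" x] by simp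
      then show "\<bar>g x\<bar> \<le> \<bar>f x\<bar> + w x * \<bar>f x - g x\<bar>" by linarith
    qed (use gi fI wfgI in auto)
    also have "\<dots> \<le> 3" using fI wfgI f1 fg e by simp
    finally show ?thesis .
  qed
  have xgI: "integrable P\<^sub>0 (\<lambda>x. x * g x)"
  proof (rule Bochner_Integration.integrable_bound[OF integrable_mult_right[OF gi(3), of C]])
    show "AE x in P\<^sub>0. norm (x * g x) \<le> norm (C * (w x * g x))"
      using base_dominated
    proof eventually_elim
      case (elim x)
      then have "\<bar>x\<bar> * \<bar>g x\<bar> \<le> C * w x * \<bar>g x\<bar>" by (intro mult_right_mono) auto
      then show ?case using C w1[of x] by (simp add: abs_mult mult.assoc)
    qed
  qed simp
  have xg: "3 * q / 4 \<le> \<bar>\<integral>x. x * g x \<partial>P\<^sub>0\<bar>"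
  proof -
    have "\<bar>\<integral>x. x * f x - x * g x \<partial>P\<^sub>0\<bar> \<le> (\<integral>x. \<bar>x * f x - x * g x\<bar> \<partial>P\<^sub>0)" by (rule integral_abs_bound)
    also have "\<dots> \<le> (\<integral>x. C * (w x * \<bar>f x - g x\<bar>) \<partial>P\<^sub>0)"
    proof (rule integral_mono_AE)
      show "AE x in P\<^sub>0. \<bar>x * f x - x * g x\<bar> \<le> C * (w x * \<bar>f x - g x\<bar>)"
        using base_dominated
      proof eventually_elim
        case (elim x)
        then have "\<bar>x\<bar> * \<bar>f x - g x\<bar> \<le> C * w x * \<bar>f x - g x\<bar>" by (intro mult_right_mono) auto
        then show ?case by (simp add: mult.assoc flip: abs_mult right_diff_distrib)
      qed
    qed (use xfI xgI wfgI in auto)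
    also have "\<dots> \<le> C * e" using fg C by simp
    finally have "\<bar>(\<integral>x. x * f x \<partial>P\<^sub>0) - (\<integral>x. x * g x \<partial>P\<^sub>0)\<bar> \<le> q / 4" using e xfI xgI by simp
    then show ?thesis using xf by linarith
  qed
  obtain d where d: "0 < d" and rem: "\<And>h. h \<noteq> 0 \<Longrightarrow> \<bar>h\<bar> < d \<Longrightarrow> remainder w P\<^sub>0 (P h) g h \<le> ennreal (e * \<bar>h\<bar>)"
    by (rule has_score_remainder[OF g e(1)]) blast
  obtain s where s: "0 < s" and sep: "\<And>\<theta>'. \<theta>' \<in> natural_params \<mu> \<Longrightarrow>
      min s (\<bar>mean (exp_member \<mu> \<theta>') - mean P\<^sub>0\<bar> / (2 * var P\<^sub>0)) \<le> \<bar>\<theta>' - \<theta>\<^sub>0\<bar>"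
    unfolding base_eq by (rule param_separation[OF regular in_params]) blast
  have T: "signed_dist_le P\<^sub>0 (P h) (4 * h)" if h: "0 < h" "h < d" for h
    unfolding signed_dist_le_def
  proof (intro ballI allI impI)
    fix \<phi> :: "real \<Rightarrow> real" and a :: real
    assume \<phi>: "\<phi> \<in> borel_measurable P\<^sub>0" and b: "\<forall>x\<in>space P\<^sub>0. \<bar>\<phi> x\<bar> \<le> a"
    have a: "0 \<le> a" using b by (force simp: space_base)
    have "\<bar>(\<integral>x. \<phi> x \<partial>P h) - (\<integral>x. \<phi> x \<partial>P\<^sub>0)\<bar> \<le> a * ((e + 3) * \<bar>h\<bar>)"
      using rem[of h] h e b \<phi> by (intro submodel_bounded_test[OF P g g1]) (auto simp: space_base)
    also have "\<dots> \<le> a * (4 * h)" using e h a by (intro mult_left_mono mult_mono) auto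
    finally show "\<bar>(\<integral>x. \<phi> x \<partial>P h) - (\<integral>x. \<phi> x \<partial>P\<^sub>0)\<bar> \<le> a * (4 * h)" .
  qed
  have \<Delta>: "min s (h * sqrt t / 8) \<le> \<bar>param_of \<mu> (P h) - param_of \<mu> P\<^sub>0\<bar>" if h: "0 < h" "h < d" for h
  proof -
    have "\<bar>(\<integral>x. x \<partial>P h) - (\<integral>x. x \<partial>P\<^sub>0) - h * (\<integral>x. x * g x \<partial>P\<^sub>0)\<bar> \<le> C * (e * \<bar>h\<bar>)"
      using rem[of h] h e C dom[OF submodel(1)[OF P]] base_dominated
      by (intro remainder_bound[OF submodel(2,3)[OF P] base_prob(1,2) w gi(1) _ _ _ _ _ _ submodel(4)[OF P] base_prob(3) xgI]) auto
    moreover have "C * (e * \<bar>h\<bar>) \<le> q / 4 * h" using mult_right_mono[OF e(3), of h] h by (simp add: mult.assoc)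
    moreover have "3 * q / 4 * h \<le> \<bar>h * (\<integral>x. x * g x \<partial>P\<^sub>0)\<bar>" using mult_right_mono[OF xg, of h] h by (simp add: abs_mult mult.commute)
    ultimately have mdiff: "q / 2 * h \<le> \<bar>mean (P h) - mean P\<^sub>0\<bar>" unfolding mean_def by linarith
    obtain \<theta>' where \<theta>': "\<theta>' \<in> natural_params \<mu>" "mean (P h) = mean (exp_member \<mu> \<theta>')"
      using submodel(5)[OF P, of h] deriv_log_partition[OF regular] by auto
    have "param_of \<mu> (P h) = \<theta>'" by (rule param_of_eq[OF regular \<theta>'(1) submodel(2,4)[OF P] \<theta>'(2)])
    moreover have "param_of \<mu> P\<^sub>0 = \<theta>\<^sub>0" unfolding base_eq by (rule param_of_exp_member[OF regular in_params])
    moreover have "h * sqrt t / 8 \<le> \<bar>mean (P h) - mean P\<^sub>0\<bar> / (2 * var P\<^sub>0)"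
      using mdiff v by (simp add: q_def v_def field_simps)
    ultimately show ?thesis using sep[OF \<theta>'(1)] \<theta>'(2) by auto
  qed
  have "\<forall>\<^sub>F n in sequentially. ennreal ((sqrt t / 8)\<^sup>2 / (48 * 4\<^sup>2 * (real n * (exp (\<epsilon>\<^sup>2) - 1))))
    \<le> local_minimax n (param_of \<mu>) P\<^sub>0 (trunc_sq_loss B) (all_members \<S>) (renyi_private_channels \<epsilon>)"
    using s d t T \<Delta> submodel(2,3)[OF P] P
    by (intro local_minimax_rate[OF \<epsilon> B base_prob(1,2), where d = d and s = s and P = P])
      (auto simp: all_members_def mult_ac)
  also have "(\<lambda>n. (sqrt t / 8)\<^sup>2 / (48 * 4\<^sup>2 * (real n * (exp (\<epsilon>\<^sup>2) - 1)))) = (\<lambda>n. t / (49152 * (real n * (exp (\<epsilon>\<^sup>2) - 1))))"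
    using t by (simp add: power_divide)
  finally show ?thesis .
qed

end

section \<open>The two rates\<close>


text \<open>Hoelder: \<open>Var = E[(X - m)\<^sup>2] \<le> ess sup \<bar>x - m\<bar> * E\<bar>X - m\<bar>\<close>.\<close>

lemma inverse_mad_le_esssup:
  assumes R: "regular_minimal_family \<mu>" and \<theta>: "\<theta> \<in> natural_params \<mu>"
  defines "P \<equiv> exp_member \<mu> \<theta>"
  shows "ennreal (1 / (mean_abs_dev P)\<^sup>2) \<le> esssup P (\<lambda>x. ennreal ((mean P - x)\<^sup>2 / (var P)\<^sup>2))"
    (is "_ \<le> ?V")
proof (cases "?V = \<top>")
  case False
  interpret prob_space P unfolding P_def by (rule prob_exp_member[OF R \<theta>])
  have sP[measurable_cong]: "sets P = sets borel" using sets_base_measure[OF R] by (simp add: P_def)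
  have v: "0 < var P" using R \<theta> by (auto simp: regular_minimal_family_def P_def)
  have D: "0 < mean_abs_dev P" unfolding P_def by (rule mean_abs_dev_pos[OF R \<theta>])
  obtain r where r: "0 \<le> r" "?V = ennreal r" using False by (cases ?V) auto
  have "AE x in P. ennreal ((mean P - x)\<^sup>2 / (var P)\<^sup>2) \<le> ?V" by (rule esssup_AE)
  then have AE: "AE x in P. \<bar>x - mean P\<bar> \<le> sqrt r * var P"
  proof eventually_elim
    case (elim x)
    then have "(mean P - x)\<^sup>2 / (var P)\<^sup>2 \<le> r" using r by simp
    then have "(x - mean P)\<^sup>2 \<le> (sqrt r * var P)\<^sup>2" using v r by (simp add: power_mult_distrib divide_le_eq power2_commute)
    then show ?case using v r by (metis abs_le_square_iff abs_of_nonneg mult_nonneg_nonneg real_sqrt_ge_zero less_imp_le)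
  qed
  have I: "integrable P (\<lambda>x. \<bar>x - mean P\<bar>)" "integrable P (\<lambda>x. (x - mean P)\<^sup>2)"
    unfolding P_def using integrable_poly_exp_member[OF R \<theta>] prob_exp_member[OF R \<theta>]
    by (auto intro!: integrable_abs Bochner_Integration.integrable_diff finite_measure.integrable_const simp: prob_space_def)
  have "var P \<le> (\<integral>x. sqrt r * var P * \<bar>x - mean P\<bar> \<partial>P)" unfolding var_def[of P]
  proof (rule integral_mono_AE)
    show "AE x in P. (x - mean P)\<^sup>2 \<le> sqrt r * (\<integral>x. (x - mean P)\<^sup>2 \<partial>P) * \<bar>x - mean P\<bar>"
      using AE
    proof eventually_elim
      case (elim x)
      have "(x - mean P)\<^sup>2 = \<bar>x - mean P\<bar> * \<bar>x - mean P\<bar>" by (simp add: power2_eq_square)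
      also have "\<dots> \<le> sqrt r * var P * \<bar>x - mean P\<bar>" using elim by (intro mult_right_mono) auto
      finally show ?case by (simp add: var_def)
    qed
  qed (use I in auto)
  also have "\<dots> = var P * (sqrt r * mean_abs_dev P)" by (simp add: mean_abs_dev_def mult_ac)
  finally have "1 \<le> sqrt r * mean_abs_dev P" using v by simp
  then have "1 \<le> (sqrt r * mean_abs_dev P)\<^sup>2" by (rule one_le_power)
  then have "1 / (mean_abs_dev P)\<^sup>2 \<le> r" using D r by (simp add: power_mult_distrib divide_le_eq)
  then show ?thesis using r by (simp add: ennreal_leI)
qed simp

text \<open>The score at \<open>\<theta>\<close> is \<open>x - m\<close>, so the family moves at \<open>L\<^sup>1\<close> speed \<open>E\<bar>X - m\<bar>\<close>; the factor \<open>2\<close> in the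
distance bound absorbs the quadratic remainder.\<close>

lemma parametric_lower:
  assumes R: "regular_minimal_family \<mu>" and \<theta>: "\<theta> \<in> natural_params \<mu>" and \<epsilon>: "0 < \<epsilon>" and B: "0 < B"
  defines "P\<^sub>0 \<equiv> exp_member \<mu> \<theta>"
  shows "\<forall>\<^sub>F n in sequentially. ennreal (1 / (mean_abs_dev P\<^sub>0)\<^sup>2 / (49152 * (real n * (exp (\<epsilon>\<^sup>2) - 1))))
    \<le> local_minimax n (param_of \<mu>) P\<^sub>0 (trunc_sq_loss B) (parametric_class \<mu>) (renyi_private_channels \<epsilon>)"
proof -
  let ?m = "mean P\<^sub>0" and ?D = "mean_abs_dev P\<^sub>0"
  have D: "0 < ?D" unfolding P\<^sub>0_def by (rule mean_abs_dev_pos[OF R \<theta>])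
  obtain s C where s: "0 < s" and C: "0 < C" and nat: "\<And>h. \<bar>h\<bar> \<le> s \<Longrightarrow> \<theta> + h \<in> natural_params \<mu>" and
    exp: "\<And>h \<phi>. \<bar>h\<bar> \<le> s \<Longrightarrow> \<phi> \<in> borel_measurable borel \<Longrightarrow> (\<And>x. \<bar>\<phi> x\<bar> \<le> 1 + \<bar>x - ?m\<bar>) \<Longrightarrow>
      \<bar>(\<integral>x. \<phi> x \<partial>exp_member \<mu> (\<theta> + h)) - (\<integral>x. \<phi> x \<partial>P\<^sub>0) - h * (\<integral>x. \<phi> x * (x - ?m) \<partial>P\<^sub>0)\<bar> \<le> C * h\<^sup>2"
    unfolding P\<^sub>0_def by (rule exp_family_expansion[OF R \<theta>]) blast
  interpret P0: prob_space P\<^sub>0 unfolding P\<^sub>0_def by (rule prob_exp_member[OF R \<theta>])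
  have pr: "prob_space (exp_member \<mu> t)" "sets (exp_member \<mu> t) = sets borel" if "t \<in> natural_params \<mu>" for t
    using prob_exp_member[OF R that] sets_base_measure[OF R] by auto
  have sP: "sets P\<^sub>0 = sets borel" unfolding P\<^sub>0_def by (rule pr(2)[OF \<theta>])
  have spP: "space P\<^sub>0 = UNIV" using sets_eq_imp_space_eq[OF sP] by simp
  have IX: "integrable P\<^sub>0 (\<lambda>x. x)" unfolding P\<^sub>0_def by (rule integrable_poly_exp_member(1)[OF R \<theta>])
  define s' where "s' = min s (?D / C)"
  have s': "0 < s'" using s C D by (simp add: s'_def)
  have T: "signed_dist_le P\<^sub>0 (exp_member \<mu> (\<theta> + h)) (2 * ?D * h)" if h: "0 < h" "h \<le> s'" for h
    unfolding signed_dist_le_def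
  proof (intro ballI allI impI)
    fix \<phi> :: "real \<Rightarrow> real" and a :: real
    assume "\<phi> \<in> borel_measurable P\<^sub>0" and b: "\<forall>x\<in>space P\<^sub>0. \<bar>\<phi> x\<bar> \<le> a"
    then have \<phi>[measurable]: "\<phi> \<in> borel_measurable borel" by (simp add: measurable_cong_sets[OF sP refl])
    have b: "\<bar>\<phi> x\<bar> \<le> a" for x using b by (simp add: spP)
    show "\<bar>(\<integral>x. \<phi> x \<partial>exp_member \<mu> (\<theta> + h)) - (\<integral>x. \<phi> x \<partial>P\<^sub>0)\<bar> \<le> a * (2 * ?D * h)"
    proof (cases "a = 0")
      case True
      then have "\<phi> x = 0" for x using b[of x] by simp
      then show ?thesis using True by simp
    next
      case False
      then have a: "0 < a" using b[of 0] by linarith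
      define \<psi> where "\<psi> x = \<phi> x / a" for x
      have [measurable]: "\<psi> \<in> borel_measurable borel" unfolding \<psi>_def by measurable
      have \<psi>1: "\<bar>\<psi> x\<bar> \<le> 1" for x using b[of x] a by (simp add: \<psi>_def)
      have \<psi>m: "\<bar>\<psi> x * (x - ?m)\<bar> \<le> \<bar>x - ?m\<bar>" for x
        using mult_right_mono[OF \<psi>1, of "\<bar>x - ?m\<bar>" x] by (simp add: abs_mult)
      have I: "integrable P\<^sub>0 (\<lambda>x. \<bar>x - ?m\<bar>)" using IX by auto
      have I2: "integrable P\<^sub>0 (\<lambda>x. \<psi> x * (x - ?m))"
        using \<psi>m by (intro Bochner_Integration.integrable_bound[OF I]) (auto simp: measurable_cong_sets[OF sP refl])
      have "\<bar>(\<integral>x. \<psi> x \<partial>exp_member \<mu> (\<theta> + h)) - (\<integral>x. \<psi> x \<partial>P\<^sub>0) - h * (\<integral>x. \<psi> x * (x - ?m) \<partial>P\<^sub>0)\<bar> \<le> C * h\<^sup>2"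
        using h \<psi>1 by (intro exp) (auto simp: s'_def intro: order_trans[OF \<psi>1])
      moreover have "\<bar>h * (\<integral>x. \<psi> x * (x - ?m) \<partial>P\<^sub>0)\<bar> \<le> h * ?D"
      proof -
        have "\<bar>\<integral>x. \<psi> x * (x - ?m) \<partial>P\<^sub>0\<bar> \<le> (\<integral>x. \<bar>\<psi> x * (x - ?m)\<bar> \<partial>P\<^sub>0)" by (rule integral_abs_bound)
        also have "\<dots> \<le> ?D" unfolding mean_abs_dev_def by (rule integral_mono[OF integrable_abs[OF I2] I \<psi>m])
        finally show ?thesis using h by (simp add: abs_mult)
      qed
      moreover have "C * h\<^sup>2 \<le> h * ?D"
      proof -
        have "C * h \<le> ?D" using h C by (simp add: s'_def field_simps)
        from mult_left_mono[OF this, of h] h show ?thesis by (simp add: power2_eq_square mult_ac)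
      qed
      ultimately have "\<bar>(\<integral>x. \<psi> x \<partial>exp_member \<mu> (\<theta> + h)) - (\<integral>x. \<psi> x \<partial>P\<^sub>0)\<bar> \<le> h * ?D + h * ?D" by linarith
      then have "\<bar>((\<integral>x. \<phi> x \<partial>exp_member \<mu> (\<theta> + h)) - (\<integral>x. \<phi> x \<partial>P\<^sub>0)) / a\<bar> \<le> 2 * ?D * h"
        by (simp add: \<psi>_def diff_divide_distrib mult_ac)
      then show ?thesis using a by (simp add: divide_le_eq mult_ac)
    qed
  qed
  have "\<forall>\<^sub>F n in sequentially. ennreal (1\<^sup>2 / (48 * (2 * ?D)\<^sup>2 * (real n * (exp (\<epsilon>\<^sup>2) - 1))))
    \<le> local_minimax n (param_of \<mu>) P\<^sub>0 (trunc_sq_loss B) (parametric_class \<mu>) (renyi_private_channels \<epsilon>)"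
  proof (rule local_minimax_rate[OF \<epsilon> B P0.prob_space_axioms sP s' s' _ zero_less_one])
    fix h assume h: "0 < h" "h < s'"
    have n: "\<theta> + h \<in> natural_params \<mu>" using h by (intro nat) (simp add: s'_def)
    show "exp_member \<mu> (\<theta> + h) \<in> parametric_class \<mu>" using n by (auto simp: parametric_class_def)
    show "prob_space (exp_member \<mu> (\<theta> + h)) \<and> sets (exp_member \<mu> (\<theta> + h)) = sets borel" using pr[OF n] by simp
    show "signed_dist_le P\<^sub>0 (exp_member \<mu> (\<theta> + h)) (2 * ?D * h)" using T h by simp
    show "min s' (1 * h) \<le> \<bar>param_of \<mu> (exp_member \<mu> (\<theta> + h)) - param_of \<mu> P\<^sub>0\<bar>"
      using h param_of_exp_member[OF R] \<theta> n by (simp add: P\<^sub>0_def)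
  qed (use D in simp)
  then show ?thesis using eventually_gt_at_top[of 0]
  proof eventually_elim
    case (elim n)
    have k: "0 < exp (\<epsilon>\<^sup>2) - 1" using \<epsilon> by simp
    have "1 / ?D\<^sup>2 / (49152 * (real n * (exp (\<epsilon>\<^sup>2) - 1))) \<le> 1 / ?D\<^sup>2 / (192 * (real n * (exp (\<epsilon>\<^sup>2) - 1)))"
      using D k elim by (intro divide_left_mono) auto
    also have "\<dots> = 1\<^sup>2 / (48 * (2 * ?D)\<^sup>2 * (real n * (exp (\<epsilon>\<^sup>2) - 1)))" by (simp add: power_mult_distrib mult_ac)
    finally show ?case using elim(1) by (rule order_trans[OF ennreal_leI])
  qed
qed

text \<open>The derivative of \<open>P\<^sub>\<theta>(X > m)\<close> is \<open>E[1\<^bsub>x>m\<^esub> (X - m)] = E\<bar>X - m\<bar> / 2\<close>, because \<open>X - m\<close> has mean zero. Half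
of it survives the remainder near \<open>\<theta>\<close>, and monotonicity in the parameter carries the bound to all
parameters.\<close>

lemma tail_separation:
  assumes R: "regular_minimal_family \<mu>" and \<theta>: "\<theta> \<in> natural_params \<mu>"
  defines "P \<equiv> exp_member \<mu> \<theta>"
  obtains s where "0 < s" "\<And>\<theta>'. \<theta>' \<in> natural_params \<mu> \<Longrightarrow>
    min s \<bar>\<theta>' - \<theta>\<bar> * mean_abs_dev P / 4 \<le> \<bar>measure (exp_member \<mu> \<theta>') {mean P<..} - measure P {mean P<..}\<bar>"
proof -
  let ?m = "mean P" and ?D = "mean_abs_dev P"
  have D: "0 < ?D" unfolding P_def by (rule mean_abs_dev_pos[OF R \<theta>])
  obtain s C where s: "0 < s" and C: "0 < C" and nat: "\<And>h. \<bar>h\<bar> \<le> s \<Longrightarrow> \<theta> + h \<in> natural_params \<mu>" and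
    exp: "\<And>h \<phi>. \<bar>h\<bar> \<le> s \<Longrightarrow> \<phi> \<in> borel_measurable borel \<Longrightarrow> (\<And>x. \<bar>\<phi> x\<bar> \<le> 1 + \<bar>x - ?m\<bar>) \<Longrightarrow>
      \<bar>(\<integral>x. \<phi> x \<partial>exp_member \<mu> (\<theta> + h)) - (\<integral>x. \<phi> x \<partial>P) - h * (\<integral>x. \<phi> x * (x - ?m) \<partial>P)\<bar> \<le> C * h\<^sup>2"
    unfolding P_def by (rule exp_family_expansion[OF R \<theta>]) blast
  interpret P: prob_space P unfolding P_def by (rule prob_exp_member[OF R \<theta>])
  have sP: "sets P = sets borel" "\<And>t. sets (exp_member \<mu> t) = sets borel"
    using sets_base_measure[OF R] by (auto simp: P_def)
  note [measurable_cong] = sP(1)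
  have IX: "integrable P (\<lambda>x. x)" unfolding P_def by (rule integrable_poly_exp_member(1)[OF R \<theta>])
  define F where "F t = measure (exp_member \<mu> t) {?m<..}" for t
  have half: "(\<integral>x. indicator {?m<..} x * (x - ?m) \<partial>P) = ?D / 2"
  proof -
    have pt: "indicator {?m<..} x * (x - ?m) = (\<bar>x - ?m\<bar> + (x - ?m)) / 2" for x by (simp add: indicator_def)
    have "(\<integral>x. indicator {?m<..} x * (x - ?m) \<partial>P) = (\<integral>x. (\<bar>x - ?m\<bar> + (x - ?m)) / 2 \<partial>P)"
      by (simp only: pt)
    also have "\<dots> = ?D / 2" using IX by (simp add: mean_abs_dev_def mean_def P.prob_space)
    finally show ?thesis .
  qed
  define s' where "s' = min s (?D / (4 * C))"
  have s': "0 < s'" using s C D by (simp add: s'_def)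
  have loc: "\<bar>h\<bar> * ?D / 4 \<le> \<bar>F (\<theta> + h) - F \<theta>\<bar>" if h: "\<bar>h\<bar> \<le> s'" for h
  proof -
    have "\<bar>(\<integral>x. indicator {?m<..} x \<partial>exp_member \<mu> (\<theta> + h)) - (\<integral>x. indicator {?m<..} x \<partial>P) - h * (\<integral>x. indicator {?m<..} x * (x - ?m) \<partial>P)\<bar> \<le> C * h\<^sup>2"
      using h by (intro exp) (auto simp: s'_def indicator_def)
    then have "\<bar>F (\<theta> + h) - F \<theta> - h * (?D / 2)\<bar> \<le> C * h\<^sup>2"
      unfolding half by (simp add: F_def sP sets_base_measure[OF R] P_def)
    moreover have "C * h\<^sup>2 \<le> \<bar>h\<bar> * ?D / 4"
    proof -
      have "C * \<bar>h\<bar> \<le> ?D / 4" using h C by (simp add: s'_def field_simps)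
      from mult_left_mono[OF this, of "\<bar>h\<bar>"] show ?thesis by (simp add: power2_eq_square mult_ac)
    qed
    moreover have "\<bar>h * (?D / 2)\<bar> = \<bar>h\<bar> * ?D / 2" using D by (simp add: abs_mult)
    ultimately show ?thesis by linarith
  qed
  have mono: "F t \<le> F t'" if "t \<in> natural_params \<mu>" "t' \<in> natural_params \<mu>" "t \<le> t'" for t t'
    unfolding F_def by (rule upper_tail_mono[OF R that])
  show thesis
  proof (rule that[OF s'])
    fix \<theta>' assume \<theta>': "\<theta>' \<in> natural_params \<mu>"
    have nats: "\<theta> + s' \<in> natural_params \<mu>" "\<theta> - s' \<in> natural_params \<mu>"
      using nat[of s'] nat[of "- s'"] s' by (auto simp: s'_def)
    have far: "\<bar>F (\<theta> + h) - F \<theta>\<bar> \<le> \<bar>F \<theta>' - F \<theta>\<bar>"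
      if "(0 \<le> h \<and> \<theta> + h \<le> \<theta>') \<or> (h \<le> 0 \<and> \<theta>' \<le> \<theta> + h)" "\<theta> + h \<in> natural_params \<mu>" for h
      using that(1)
    proof
      assume h: "0 \<le> h \<and> \<theta> + h \<le> \<theta>'"
      have "F \<theta> \<le> F (\<theta> + h)" "F (\<theta> + h) \<le> F \<theta>'" using h \<theta> \<theta>' that(2) by (auto intro!: mono)
      then show ?thesis by linarith
    next
      assume h: "h \<le> 0 \<and> \<theta>' \<le> \<theta> + h"
      have "F (\<theta> + h) \<le> F \<theta>" "F \<theta>' \<le> F (\<theta> + h)" using h \<theta> \<theta>' that(2) by (auto intro!: mono)
      then show ?thesis by linarith
    qed
    have "min s' \<bar>\<theta>' - \<theta>\<bar> * ?D / 4 \<le> \<bar>F \<theta>' - F \<theta>\<bar>"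
    proof -
      consider "\<bar>\<theta>' - \<theta>\<bar> \<le> s'" | "\<theta> + s' \<le> \<theta>'" | "\<theta>' \<le> \<theta> + - s'" by linarith
      then show ?thesis
      proof cases
        case 1
        then show ?thesis using loc[of "\<theta>' - \<theta>"] by simp
      next
        case 2
        then have "min s' \<bar>\<theta>' - \<theta>\<bar> = \<bar>s'\<bar>" using s' by simp
        then show ?thesis using loc[of s'] far[of s'] 2 s' nats by auto
      next
        case 3
        then have "min s' \<bar>\<theta>' - \<theta>\<bar> = \<bar>- s'\<bar>" using s' by simp
        then show ?thesis using loc[of "- s'"] far[of "- s'"] 3 s' nats by auto
      qed
    qed
    then show "min s' \<bar>\<theta>' - \<theta>\<bar> * ?D / 4 \<le> \<bar>measure (exp_member \<mu> \<theta>') {?m<..} - measure P {?m<..}\<bar>"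
      by (simp add: F_def P_def)
  qed
qed

lemma parametric_upper:
  assumes R: "regular_minimal_family \<mu>" and \<theta>: "\<theta> \<in> natural_params \<mu>" and B: "0 < B"
    and \<alpha>: "0 < \<alpha>" "\<alpha> \<le> 1 / 2" "8 * \<alpha>\<^sup>2 \<le> \<epsilon>\<^sup>2"
  defines "P\<^sub>0 \<equiv> exp_member \<mu> \<theta>"
  shows "\<forall>\<^sub>F n in sequentially.
    local_minimax n (param_of \<mu>) P\<^sub>0 (trunc_sq_loss B) (parametric_class \<mu>) (renyi_private_channels \<epsilon>)
      \<le> ennreal (64 / (real n * \<alpha>\<^sup>2 * (mean_abs_dev P\<^sub>0)\<^sup>2))"
proof -
  let ?m = "mean P\<^sub>0" and ?D = "mean_abs_dev P\<^sub>0"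
  have D: "0 < ?D" unfolding P\<^sub>0_def by (rule mean_abs_dev_pos[OF R \<theta>])
  obtain s where s: "0 < s" and sep: "\<And>\<theta>'. \<theta>' \<in> natural_params \<mu> \<Longrightarrow>
    min s \<bar>\<theta>' - \<theta>\<bar> * ?D / 4 \<le> \<bar>measure (exp_member \<mu> \<theta>') {?m<..} - measure P\<^sub>0 {?m<..}\<bar>"
    unfolding P\<^sub>0_def by (rule tail_separation[OF R \<theta>]) blast
  have pr: "prob_space (exp_member \<mu> t)" "sets (exp_member \<mu> t) = sets borel" if "t \<in> natural_params \<mu>" for t
    using prob_exp_member[OF R that] sets_base_measure[OF R] by auto
  define \<tau> where "\<tau> n = real n * (\<alpha>\<^sup>2 * ?D\<^sup>2 / 64)" for n
  have "filterlim \<tau> at_top sequentially" unfolding \<tau>_def using \<alpha> D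
    by (intro filterlim_at_top_mult_tendsto_pos[OF tendsto_const] filterlim_real_sequentially) auto
  then have "\<forall>\<^sub>F n in sequentially. max 1 (2 * B / s ^ 4) \<le> \<tau> n"
    unfolding filterlim_at_top by blast
  then show ?thesis
  proof eventually_elim
    case (elim n)
    have \<tau>: "0 < \<tau> n" using elim by simp
    have n: "0 < real n" using \<tau> \<alpha> D by (simp add: \<tau>_def zero_less_mult_iff)
    have goal: "64 / (real n * \<alpha>\<^sup>2 * ?D\<^sup>2) = 1 / \<tau> n" using \<alpha> D n by (simp add: \<tau>_def field_simps)
    show "local_minimax n (param_of \<mu>) P\<^sub>0 (trunc_sq_loss B) (parametric_class \<mu>) (renyi_private_channels \<epsilon>)
      \<le> ennreal (64 / (real n * \<alpha>\<^sup>2 * ?D\<^sup>2))"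
      unfolding local_minimax_def
    proof (rule SUP_least)
      fix P\<^sub>1 assume "P\<^sub>1 \<in> parametric_class \<mu>"
      then obtain \<theta>' where \<theta>': "\<theta>' \<in> natural_params \<mu>" and P1: "P\<^sub>1 = exp_member \<mu> \<theta>'"
        by (auto simp: parametric_class_def)
      define \<Delta> where "\<Delta> = \<theta>' - \<theta>"
      have par: "param_of \<mu> P\<^sub>1 - param_of \<mu> P\<^sub>0 = \<Delta>"
        using param_of_exp_member[OF R] \<theta> \<theta>' by (simp add: P1 P\<^sub>0_def \<Delta>_def)
      let ?d = "measure P\<^sub>1 {?m<..} - measure P\<^sub>0 {?m<..}"
      have "(INF (est, Q)\<in>borel_measurable (histories n) \<times> renyi_private_channels \<epsilon> n.
        max (risk n (param_of \<mu>) (trunc_sq_loss B) est Q P\<^sub>0) (risk n (param_of \<mu>) (trunc_sq_loss B) est Q P\<^sub>1))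
        \<le> ennreal (trunc_sq_loss B (param_of \<mu> P\<^sub>1 - param_of \<mu> P\<^sub>0) * exp (- (real n * \<alpha>\<^sup>2 * ?d\<^sup>2 / 4)))"
        using \<alpha> by (intro two_point_risk_upper B) (simp_all add: P1 P\<^sub>0_def pr \<theta> \<theta>' sets_base_measure[OF R])
      also have "\<dots> \<le> ennreal (1 / \<tau> n)"
      proof (rule ennreal_leI)
        have "(min s \<bar>\<Delta>\<bar> * ?D / 4)\<^sup>2 \<le> \<bar>?d\<bar>\<^sup>2"
          using sep[OF \<theta>'] s D by (intro power_mono) (auto simp: \<Delta>_def P1)
        then have d2: "(min s \<bar>\<Delta>\<bar>)\<^sup>2 * ?D\<^sup>2 / 16 \<le> ?d\<^sup>2" by (simp add: power_mult_distrib power_divide)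
        have "\<tau> n * (min s \<bar>\<Delta>\<bar>)\<^sup>2 = real n * \<alpha>\<^sup>2 / 4 * ((min s \<bar>\<Delta>\<bar>)\<^sup>2 * ?D\<^sup>2 / 16)" by (simp add: \<tau>_def)
        also have "\<dots> \<le> real n * \<alpha>\<^sup>2 / 4 * ?d\<^sup>2" using d2 by (intro mult_left_mono) auto
        finally have e: "exp (- (real n * \<alpha>\<^sup>2 * ?d\<^sup>2 / 4)) \<le> exp (- (\<tau> n * (min s \<bar>\<Delta>\<bar>)\<^sup>2))" by simp
        have "trunc_sq_loss B \<Delta> * exp (- (real n * \<alpha>\<^sup>2 * ?d\<^sup>2 / 4)) \<le> 1 / \<tau> n"
        proof (cases "\<bar>\<Delta>\<bar> \<le> s")
          case True
          have "trunc_sq_loss B \<Delta> * exp (- (real n * \<alpha>\<^sup>2 * ?d\<^sup>2 / 4)) \<le> \<Delta>\<^sup>2 * exp (- (\<tau> n * \<Delta>\<^sup>2))"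
            using e[unfolded min_absorb2[OF True] power2_abs] B
            by (intro mult_mono) (auto simp: trunc_sq_loss_def)
          also have "\<dots> \<le> 1 / \<tau> n"
          proof -
            have "\<tau> n * \<Delta>\<^sup>2 \<le> exp (\<tau> n * \<Delta>\<^sup>2)" using exp_ge_add_one_self[of "\<tau> n * \<Delta>\<^sup>2"] by linarith
            then show ?thesis using \<tau> by (simp add: exp_minus field_simps)
          qed
          finally show ?thesis .
        next
          case False
          have "trunc_sq_loss B \<Delta> * exp (- (real n * \<alpha>\<^sup>2 * ?d\<^sup>2 / 4)) \<le> B * exp (- (\<tau> n * s\<^sup>2))"
            using e False B by (intro mult_mono) (auto simp: trunc_sq_loss_def)
          also have "\<dots> \<le> 1 / \<tau> n"
          proof -
            have nn: "0 \<le> \<tau> n * s\<^sup>2" using \<tau> by simp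
            have "2 * B / s ^ 4 \<le> \<tau> n" using elim by simp
            then have "B \<le> \<tau> n * s ^ 4 / 2" using s by (simp add: field_simps)
            then have "\<tau> n * B \<le> \<tau> n * (\<tau> n * s ^ 4 / 2)" using \<tau> by (intro mult_left_mono) auto
            also have "\<dots> = (\<tau> n * s\<^sup>2)\<^sup>2 / 2" by (simp add: power2_eq_square power4_eq_xxxx)
            also have "\<dots> \<le> exp (\<tau> n * s\<^sup>2)" using exp_lower_Taylor_quadratic[OF nn] nn by linarith
            finally show ?thesis using \<tau> by (simp add: exp_minus field_simps)
          qed
          finally show ?thesis .
        qed
        then show "trunc_sq_loss B (param_of \<mu> P\<^sub>1 - param_of \<mu> P\<^sub>0) * exp (- (real n * \<alpha>\<^sup>2 * ?d\<^sup>2 / 4)) \<le> 1 / \<tau> n"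
          by (simp add: par)
      qed
      finally show "(INF (est, Q)\<in>borel_measurable (histories n) \<times> renyi_private_channels \<epsilon> n.
        max (risk n (param_of \<mu>) (trunc_sq_loss B) est Q P\<^sub>0) (risk n (param_of \<mu>) (trunc_sq_loss B) est Q P\<^sub>1))
        \<le> ennreal (64 / (real n * \<alpha>\<^sup>2 * ?D\<^sup>2))" unfolding goal .
    qed
  qed
qed

text \<open>Passing from \<open>t\<close> to \<open>t / 4\<close> puts the level strictly below the essential supremum, also when \<open>t\<close>
equals it.\<close>

lemma esssup_deviation_pos:
  assumes R: "regular_minimal_family \<mu>" and \<theta>: "\<theta> \<in> natural_params \<mu>"
  defines "P \<equiv> exp_member \<mu> \<theta>"
  assumes t: "0 < t" and le: "ennreal t \<le> esssup P (\<lambda>x. ennreal ((mean P - x)\<^sup>2 / (var P)\<^sup>2))"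
  shows "0 < measure P {x. sqrt t / 2 * var P < \<bar>x - mean P\<bar>}"
proof -
  interpret P: prob_space P unfolding P_def by (rule prob_exp_member[OF R \<theta>])
  have sP: "sets P = sets borel" using sets_base_measure[OF R] by (simp add: P_def)
  have spP: "space P = UNIV" using sets_eq_imp_space_eq[OF sP] by simp
  have v: "0 < var P" using R \<theta> by (auto simp: regular_minimal_family_def P_def)
  have "ennreal (t / 4) < ennreal t" using t by (intro ennreal_lessI) auto
  then have "ennreal (t / 4) < esssup P (\<lambda>x. ennreal ((mean P - x)\<^sup>2 / (var P)\<^sup>2))" using le by (rule order.strict_trans2)
  then have "0 < emeasure P {x \<in> space P. ennreal (t / 4) < ennreal ((mean P - x)\<^sup>2 / (var P)\<^sup>2)}"
    by (intro esssup_pos_measure) (auto simp: measurable_cong_sets[OF sP refl])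
  also have "{x \<in> space P. ennreal (t / 4) < ennreal ((mean P - x)\<^sup>2 / (var P)\<^sup>2)} = {x. sqrt t / 2 * var P < \<bar>x - mean P\<bar>}"
  proof -
    have "ennreal (t / 4) < ennreal ((mean P - x)\<^sup>2 / (var P)\<^sup>2) \<longleftrightarrow> sqrt t / 2 * var P < \<bar>x - mean P\<bar>" for x
    proof -
      have "ennreal (t / 4) < ennreal ((mean P - x)\<^sup>2 / (var P)\<^sup>2) \<longleftrightarrow> t / 4 < (mean P - x)\<^sup>2 / (var P)\<^sup>2"
        using t by (intro ennreal_less_iff) auto
      also have "\<dots> \<longleftrightarrow> (sqrt t / 2 * var P)\<^sup>2 < \<bar>x - mean P\<bar>\<^sup>2"
        using v t by (simp add: pos_less_divide_eq power_mult_distrib power_divide power2_commute)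
      also have "\<dots> \<longleftrightarrow> sqrt t / 2 * var P < \<bar>x - mean P\<bar>"
        using v t by (intro iffI) (erule power2_less_imp_less, simp, erule power_strict_mono, simp_all)
      finally show ?thesis .
    qed
    then show ?thesis by (simp add: spP)
  qed
  finally show ?thesis by (simp add: P.emeasure_eq_measure)
qed

text \<open>The dependence of the constants on the largest privacy level enters through
\<open>exp (\<epsilon>\<^sup>2) - 1 \<le> \<epsilon>\<^sup>2 * exp (\<epsilon>_max\<^sup>2)\<close>.\<close>

lemma privacy_constant:
  assumes "0 < \<epsilon>" "\<epsilon> \<le> \<epsilon>_max" "0 < real n" "0 \<le> t"
  shows "1 / (49152 * exp (\<epsilon>_max\<^sup>2)) * (1 / (real n * \<epsilon>\<^sup>2)) * t \<le> t / (49152 * (real n * (exp (\<epsilon>\<^sup>2) - 1)))"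
proof -
  have "exp (\<epsilon>\<^sup>2) - 1 \<le> \<epsilon>\<^sup>2 * exp (\<epsilon>\<^sup>2)" by (rule exp_sub_one_le)
  also have "\<dots> \<le> \<epsilon>\<^sup>2 * exp (\<epsilon>_max\<^sup>2)" using assms by (intro mult_left_mono) (auto intro: power_mono)
  finally have "49152 * (real n * (exp (\<epsilon>\<^sup>2) - 1)) \<le> 49152 * (real n * (\<epsilon>\<^sup>2 * exp (\<epsilon>_max\<^sup>2)))"
    using assms by (intro mult_left_mono) auto
  moreover have "0 < exp (\<epsilon>\<^sup>2) - 1" using assms by simp
  ultimately have "t / (49152 * (real n * (\<epsilon>\<^sup>2 * exp (\<epsilon>_max\<^sup>2)))) \<le> t / (49152 * (real n * (exp (\<epsilon>\<^sup>2) - 1)))"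
    using assms by (intro divide_left_mono) auto
  then show ?thesis by (simp add: mult_ac)
qed

lemma submodels_lower:
  assumes R: "regular_minimal_family \<mu>" and \<theta>: "\<theta>\<^sub>0 \<in> natural_params \<mu>"
    and \<epsilon>: "0 < \<epsilon>" "\<epsilon> \<le> \<epsilon>_max" and B: "0 < B"
  defines "P\<^sub>0 \<equiv> exp_member \<mu> \<theta>\<^sub>0"
  assumes cls: "\<P> \<subseteq> nonparametric_class \<mu> M"
    and w: "w \<in> borel_measurable borel" "\<And>x. 1 \<le> w x" "integrable P\<^sub>0 w"
    and C: "0 < C" "\<And>P. P \<in> \<P> \<Longrightarrow> AE x in P. \<bar>x\<bar> \<le> C * w x"
    and dense: "submodels_dense_scores w P\<^sub>0 \<P> \<S>"
    and v: "v < \<infinity>" "v \<le> esssup P\<^sub>0 (\<lambda>x. ennreal ((mean P\<^sub>0 - x)\<^sup>2 / (var P\<^sub>0)\<^sup>2))"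
  shows "\<forall>\<^sub>F n in sequentially.
    ennreal (1 / (49152 * exp (\<epsilon>_max\<^sup>2)) * (1 / (real n * \<epsilon>\<^sup>2))) * v
      \<le> local_minimax n (param_of \<mu>) P\<^sub>0 (trunc_sq_loss B) (all_members \<S>) (renyi_private_channels \<epsilon>)"
proof -
  obtain t where t: "0 \<le> t" "v = ennreal t" using v by (cases v) auto
  show ?thesis
  proof (cases "t = 0")
    case True
    then show ?thesis using t by simp
  next
    case False
    then have t0: "0 < t" using t by simp
    have pos: "0 < measure P\<^sub>0 {x. sqrt t / 2 * var P\<^sub>0 < \<bar>x - mean P\<^sub>0\<bar>}"
      unfolding P\<^sub>0_def using t v by (intro esssup_deviation_pos[OF R \<theta> t0]) (simp add: P\<^sub>0_def)
    interpret submodels: dense_submodels \<mu> \<theta>\<^sub>0 M C P\<^sub>0 w \<P> \<S>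
      by unfold_locales (use R \<theta> cls w C dense in \<open>auto simp: P\<^sub>0_def\<close>)
    have "\<forall>\<^sub>F n in sequentially. ennreal (t / (49152 * (real n * (exp (\<epsilon>\<^sup>2) - 1))))
      \<le> local_minimax n (param_of \<mu>) P\<^sub>0 (trunc_sq_loss B) (all_members \<S>) (renyi_private_channels \<epsilon>)"
      by (rule submodels.submodel_lower_bound[OF t0 pos \<epsilon>(1) B])
    then show ?thesis using eventually_gt_at_top[of 0]
    proof eventually_elim
      case (elim n)
      have "ennreal (1 / (49152 * exp (\<epsilon>_max\<^sup>2)) * (1 / (real n * \<epsilon>\<^sup>2))) * v
          = ennreal (1 / (49152 * exp (\<epsilon>_max\<^sup>2)) * (1 / (real n * \<epsilon>\<^sup>2)) * t)"
        unfolding t(2) using t by (intro ennreal_mult[symmetric]) auto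
      also have "\<dots> \<le> ennreal (t / (49152 * (real n * (exp (\<epsilon>\<^sup>2) - 1))))"
        using elim t by (intro ennreal_leI privacy_constant[OF \<epsilon>]) auto
      also note elim(1)
      finally show ?case .
    qed
  qed
qed

section \<open>The local minimax risk\<close>

theorem claim3:
  fixes \<epsilon>_max :: real
  assumes "0 < \<epsilon>_max"
  shows "\<exists>c\<^sub>0 c\<^sub>1. 0 < c\<^sub>0 \<and> c\<^sub>0 \<le> c\<^sub>1 \<and>
    (\<forall>\<mu> \<theta>\<^sub>0 M B \<epsilon>.
       regular_minimal_family \<mu> \<longrightarrow> \<theta>\<^sub>0 \<in> natural_params \<mu> \<longrightarrow>
       0 < B \<longrightarrow> 0 < \<epsilon> \<longrightarrow> \<epsilon> \<le> \<epsilon>_max \<longrightarrow>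
       (let P\<^sub>0 = exp_member \<mu> \<theta>\<^sub>0;
            \<MM> = (\<lambda>n \<P>. local_minimax n (param_of \<mu>) P\<^sub>0 (trunc_sq_loss B) \<P>
                              (renyi_private_channels \<epsilon>));
            V = esssup P\<^sub>0 (\<lambda>x. ennreal ((mean P\<^sub>0 - x)\<^sup>2 / (var P\<^sub>0)\<^sup>2));
            D = 1 / (mean_abs_dev P\<^sub>0)\<^sup>2
        in
          (\<comment> \<open>sub-models on a bounded sample space\<close>
           \<forall>R \<S>.
             submodels_dense_scores (\<lambda>_. 1) P\<^sub>0
               {P \<in> nonparametric_class \<mu> M. AE x in P. \<bar>x\<bar> \<le> R} \<S> \<longrightarrow>
             (\<forall>\<^sub>F n in sequentially.
                \<MM> n (all_members \<S>) \<ge> ennreal (c\<^sub>0 * (1 / (real n * \<epsilon>\<^sup>2))) * V)) \<and>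
          (\<comment> \<open>sub-models on the whole line, with the essential supremum possibly infinite\<close>
           \<forall>\<S>.
             submodels_dense_scores (\<lambda>x. 1 + \<bar>x\<bar>) P\<^sub>0 (nonparametric_class \<mu> M) \<S> \<longrightarrow>
             (\<forall>v<\<infinity>. v \<le> V \<longrightarrow>
               (\<forall>\<^sub>F n in sequentially.
                  \<MM> n (all_members \<S>) \<ge> ennreal (c\<^sub>0 * (1 / (real n * \<epsilon>\<^sup>2))) * v))) \<and>
          (\<forall>\<^sub>F n in sequentially.
             \<MM> n (parametric_class \<mu>)
               \<in> {ennreal (c\<^sub>0 * (1 / (real n * \<epsilon>\<^sup>2)) * D) ..
                  ennreal (c\<^sub>1 * (1 / (real n * \<epsilon>\<^sup>2)) * D)}) \<and>
          ennreal D \<le> V))"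
proof -
  define c\<^sub>0 where "c\<^sub>0 = 1 / (49152 * exp (\<epsilon>_max\<^sup>2))"
  define c\<^sub>1 where "c\<^sub>1 = 64 * (4 + 2 * \<epsilon>_max)\<^sup>2"
  have c0: "0 < c\<^sub>0" by (simp add: c\<^sub>0_def)
  have c01: "c\<^sub>0 \<le> c\<^sub>1"
  proof -
    have "1 \<le> 49152 * exp (\<epsilon>_max\<^sup>2)" using one_le_exp_iff[of "\<epsilon>_max\<^sup>2"] zero_le_power2[of \<epsilon>_max] by linarith
    then have "c\<^sub>0 \<le> 1" by (simp add: c\<^sub>0_def)
    also have "1 \<le> (4 + 2 * \<epsilon>_max)\<^sup>2" using assms by (intro one_le_power) simp
    then have "1 \<le> c\<^sub>1" by (simp add: c\<^sub>1_def)
    finally show ?thesis .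
  qed
  show ?thesis
    unfolding Let_def
  proof (rule exI[of _ c\<^sub>0], rule exI[of _ c\<^sub>1], intro conjI allI impI)
    show "0 < c\<^sub>0" "c\<^sub>0 \<le> c\<^sub>1" by (rule c0 c01)+
    fix \<mu> and \<theta>\<^sub>0 M B \<epsilon> :: real
    assume R: "regular_minimal_family \<mu>" and \<theta>: "\<theta>\<^sub>0 \<in> natural_params \<mu>"
      and B: "0 < B" and \<epsilon>: "0 < \<epsilon>" "\<epsilon> \<le> \<epsilon>_max"
    let ?P = "exp_member \<mu> \<theta>\<^sub>0"
    let ?V = "esssup ?P (\<lambda>x. ennreal ((mean ?P - x)\<^sup>2 / (var ?P)\<^sup>2))"
    interpret prob_space ?P by (rule prob_exp_member[OF R \<theta>])
    have sP: "sets ?P = sets borel" using sets_base_measure[OF R] by simp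
    have IX: "integrable ?P (\<lambda>x. x)" by (rule integrable_poly_exp_member(1)[OF R \<theta>])
    show "ennreal (1 / (mean_abs_dev ?P)\<^sup>2) \<le> ?V" by (rule inverse_mad_le_esssup[OF R \<theta>])
    {
      fix r \<S>
      assume dense: "submodels_dense_scores (\<lambda>_. 1) ?P {P \<in> nonparametric_class \<mu> M. AE x in P. \<bar>x\<bar> \<le> r} \<S>"
      define C where "C = max 1 \<bar>r\<bar>"
      have C: "0 < C" by (simp add: C_def)
      let ?C = "{P \<in> nonparametric_class \<mu> M. AE x in P. \<bar>x\<bar> \<le> r}"
      have cls: "?C \<subseteq> nonparametric_class \<mu> M" by auto
      have dom: "AE x in P. \<bar>x\<bar> \<le> C * 1" if "P \<in> ?C" for P
        using that by (auto simp: C_def elim!: eventually_mono)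
      interpret submodels: dense_submodels \<mu> \<theta>\<^sub>0 M C ?P "\<lambda>_. 1" ?C \<S>
        by unfold_locales (use R \<theta> C dom dense in auto)
      have bd: "AE x in ?P. \<bar>x\<bar> \<le> C * 1" by (rule submodels.base_dominated)
      have "?V \<le> ennreal ((\<bar>mean ?P\<bar> + C)\<^sup>2 / (var ?P)\<^sup>2)"
      proof (rule esssup_I)
        show "(\<lambda>x. ennreal ((mean ?P - x)\<^sup>2 / (var ?P)\<^sup>2)) \<in> borel_measurable ?P"
          by (simp add: measurable_cong_sets[OF sP refl])
        show "AE x in ?P. ennreal ((mean ?P - x)\<^sup>2 / (var ?P)\<^sup>2) \<le> ennreal ((\<bar>mean ?P\<bar> + C)\<^sup>2 / (var ?P)\<^sup>2)"
          using bd
        proof eventually_elim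
          case (elim x)
          then have "\<bar>mean ?P - x\<bar>\<^sup>2 \<le> (\<bar>mean ?P\<bar> + C)\<^sup>2" by (intro power_mono) auto
          then show ?case by (intro ennreal_leI divide_right_mono) auto
        qed
      qed
      then have fin: "?V < \<infinity>" by (rule order.strict_trans1) simp
      show "\<forall>\<^sub>F n in sequentially. ennreal (c\<^sub>0 * (1 / (real n * \<epsilon>\<^sup>2))) * ?V
          \<le> local_minimax n (param_of \<mu>) ?P (trunc_sq_loss B) (all_members \<S>) (renyi_private_channels \<epsilon>)"
        unfolding c\<^sub>0_def by (rule submodels_lower[OF R \<theta> \<epsilon> B cls _ _ _ C dom dense fin order_refl]) auto
    }
    {
      fix \<S> v
      assume dense: "submodels_dense_scores (\<lambda>x. 1 + \<bar>x\<bar>) ?P (nonparametric_class \<mu> M) \<S>"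
        and v: "v < \<infinity>" "v \<le> ?V"
      show "\<forall>\<^sub>F n in sequentially. ennreal (c\<^sub>0 * (1 / (real n * \<epsilon>\<^sup>2))) * v
          \<le> local_minimax n (param_of \<mu>) ?P (trunc_sq_loss B) (all_members \<S>) (renyi_private_channels \<epsilon>)"
        unfolding c\<^sub>0_def
      proof (rule submodels_lower[OF R \<theta> \<epsilon> B order_refl _ _ _ zero_less_one _ dense v])
        show "integrable ?P (\<lambda>x. 1 + \<bar>x\<bar>)" using IX by auto
        show "AE x in P. \<bar>x\<bar> \<le> 1 * (1 + \<bar>x\<bar>)" for P :: "real measure" by simp
      qed auto
    }
    \<comment> \<open>The \<open>4\<close> ensures \<open>8 * \<alpha>\<^sup>2 \<le> \<epsilon>\<^sup>2\<close>, the second summand \<open>\<alpha> \<le> 1 / 2\<close>.\<close>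
    define \<alpha> where "\<alpha> = \<epsilon> / (4 + 2 * \<epsilon>_max)"
    have \<alpha>: "0 < \<alpha>" "\<alpha> \<le> 1 / 2" "8 * \<alpha>\<^sup>2 \<le> \<epsilon>\<^sup>2"
    proof -
      show "0 < \<alpha>" "\<alpha> \<le> 1 / 2" using \<epsilon> assms by (auto simp: \<alpha>_def field_simps)
      have "8 \<le> (4::real)\<^sup>2" by simp
      also have "\<dots> \<le> (4 + 2 * \<epsilon>_max)\<^sup>2" using assms by (intro power_mono) auto
      finally have "8 * \<epsilon>\<^sup>2 \<le> (4 + 2 * \<epsilon>_max)\<^sup>2 * \<epsilon>\<^sup>2" by (intro mult_right_mono) auto
      then show "8 * \<alpha>\<^sup>2 \<le> \<epsilon>\<^sup>2" using assms by (simp add: \<alpha>_def power_divide divide_le_eq mult.commute)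
    qed
    show "\<forall>\<^sub>F n in sequentially.
        local_minimax n (param_of \<mu>) ?P (trunc_sq_loss B) (parametric_class \<mu>) (renyi_private_channels \<epsilon>)
          \<in> {ennreal (c\<^sub>0 * (1 / (real n * \<epsilon>\<^sup>2)) * (1 / (mean_abs_dev ?P)\<^sup>2)) ..
             ennreal (c\<^sub>1 * (1 / (real n * \<epsilon>\<^sup>2)) * (1 / (mean_abs_dev ?P)\<^sup>2))}"
      using parametric_lower[OF R \<theta> \<epsilon>(1) B] parametric_upper[OF R \<theta> B \<alpha>] eventually_gt_at_top[of 0]
    proof eventually_elim
      case (elim n)
      have lo: "ennreal (c\<^sub>0 * (1 / (real n * \<epsilon>\<^sup>2)) * (1 / (mean_abs_dev ?P)\<^sup>2))
          \<le> ennreal (1 / (mean_abs_dev ?P)\<^sup>2 / (49152 * (real n * (exp (\<epsilon>\<^sup>2) - 1))))"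
        unfolding c\<^sub>0_def using elim by (intro ennreal_leI privacy_constant[OF \<epsilon>]) auto
      have hi: "64 / (real n * \<alpha>\<^sup>2 * (mean_abs_dev ?P)\<^sup>2) = c\<^sub>1 * (1 / (real n * \<epsilon>\<^sup>2)) * (1 / (mean_abs_dev ?P)\<^sup>2)"
        using assms by (simp add: c\<^sub>1_def \<alpha>_def power_divide)
      from order_trans[OF lo elim(1)] elim(2) show ?case by (simp only: hi atLeastAtMost_iff)
    qed
  qed
qed

end
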